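(* Assume the Riemann hypothesis. Let $Q(\xi):=1/(1+\xi^2)$. Then there are absolute constants $C>0$ and $K>0$ such that for all $x\geq 2$ and all $T\geq 2$, $$ \frac{1}{T}\,\mathrm{meas}\Big\{ t\in [T,2T]:\, \sum_\gamma Q\Big(\frac{\log T}{2\pi}(\gamma-t)\Big) \geq x\Big\} \leq K e^{-C x\log x}, $$ where $\mathrm{meas}$ denotes Lebesgue measure.
   Context: The non-trivial zeros of the Riemann zeta function are written $1/2+i\gamma$ with $\gamma\in\mathbb{R}$ (real by the Riemann hypothesis); sums over $\gamma$ run over all such ordinates, counted with multiplicity. *)

theory Defs
  imports "HOL-Complex_Analysis.Complex_Analysis"
begin

definition zeta_continuation :: "(complex \<Rightarrow> complex) \<Rightarrow> bool" where
  "zeta_continuation f \<longleftrightarrow>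
     f holomorphic_on (- {1}) \<and>
     (\<forall>z. Re z > 1 \<longrightarrow> (\<lambda>n. 1 / of_nat (Suc n) powr z) sums f z)"

(* The value 0 at the pole is a convention; it is never used below. *)
definition zeta :: "complex \<Rightarrow> complex" where
  "zeta s = (if s = 1 then 0 else (THE w. \<exists>f. zeta_continuation f \<and> w = f s))"

definition nontrivial_zeta_zeros :: "complex set" where
  "nontrivial_zeta_zeros = {s. 0 < Re s \<and> Re s < 1 \<and> zeta s = 0}"

definition riemann_hypothesis :: bool where
  "riemann_hypothesis \<longleftrightarrow> (\<forall>s\<in>nontrivial_zeta_zeros. Re s = 1/2)"

definition zeta_ordinates :: "real set" where
  "zeta_ordinates = {\<gamma>. Complex (1/2) \<gamma> \<in> nontrivial_zeta_zeros}"

definition ordinate_multiplicity :: "real \<Rightarrow> nat" where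
  "ordinate_multiplicity \<gamma> = nat (zorder zeta (Complex (1/2) \<gamma>))"

(* A sum of nonnegative terms over all ordinates with multiplicity. It is taken in [0, \<infinity>],
   so that its meaning does not depend on a convention for divergent sums. *)
definition ordinate_sum :: "(real \<Rightarrow> real) \<Rightarrow> ennreal" where
  "ordinate_sum h =
     (\<Sum>\<^sub>\<infinity>\<gamma>\<in>zeta_ordinates. of_nat (ordinate_multiplicity \<gamma>) * ennreal (h \<gamma>))"

definition Q_kernel :: "real \<Rightarrow> real" where
  "Q_kernel \<xi> = 1 / (1 + \<xi>\<^sup>2)"

(* Existence of the continuation: for M \<ge> 1, summing over n the Taylor expansion of order M of
   (n+1) powr (1-s) - n powr (1-s) in 1/n expresses (s-1) zeta(s) by the values at s+1, ..., s+M-1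
   and a remainder series that is holomorphic for Re s > 1-M. *)
abbreviation (input) zR :: "nat \<Rightarrow> nat \<Rightarrow> complex \<Rightarrow> complex" where
  "zR M n s \<equiv> of_nat (Suc n) powr (1 - s) - of_nat (Suc (Suc n)) powr (1 - s)
     + (\<Sum>j=1..M. ((1 - s) gchoose j) * of_nat (Suc n) powr (1 - s - of_nat j))"

lemma zeta_remainder_bound:
  "norm (zR M n s) \<le> norm (\<Prod>i<Suc M. 1 - s - of_nat i) * 2 powr \<bar>Re (1 - s) - real (Suc M)\<bar>
      * real (Suc n) powr (- Re s - real M)"
proof -
  define a where "a = 1 - s"
  define m where "m = Suc n"
  define f :: "nat \<Rightarrow> complex \<Rightarrow> complex"
    where "f = (\<lambda>k z. (\<Prod>i<k. a - of_nat i) * (1 + z) powr (a - of_nat k))"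
  define B where "B = norm (\<Prod>i<Suc M. a - of_nat i) * 2 powr \<bar>Re a - real (Suc M)\<bar>"
  have seg: "\<exists>u. x = of_real u \<and> 0 \<le> u \<and> u \<le> 1" if "x \<in> closed_segment 0 (1::complex)" for x
    using that by (auto simp: closed_segment_def scaleR_conv_of_real)
  have "cmod (f 0 (1 / of_nat m) - (\<Sum>i\<le>M. f i 0 * (1 / of_nat m - 0) ^ i / fact i))
      \<le> B * cmod (1 / of_nat m - 0) ^ Suc M / fact M"
  proof (rule complex_Taylor[of "closed_segment 0 1"])
    show "convex (closed_segment 0 (1::complex))" by (rule convex_closed_segment)
    show "(f i has_field_derivative f (Suc i) x) (at x within closed_segment 0 1)"
      if "x \<in> closed_segment 0 1" "i \<le> M" for i x
    proof -
      obtain u where u: "x = of_real u" "0 \<le> u" "u \<le> 1" using seg[OF \<open>x \<in> _\<close>] by auto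
      have "1 + x \<notin> \<real>\<^sub>\<le>\<^sub>0" using u by (auto simp: complex_nonpos_Reals_iff)
      then show ?thesis unfolding f_def
        by (auto intro!: derivative_eq_intros simp: algebra_simps)
    qed
    show "cmod (f (Suc M) x) \<le> B" if "x \<in> closed_segment 0 1" for x
    proof -
      obtain u where u: "x = of_real u" "0 \<le> u" "u \<le> 1" using seg[OF \<open>x \<in> _\<close>] by auto
      define e where "e = Re a - real (Suc M)"
      have 1: "cmod ((1 + x) powr (a - of_nat (Suc M))) = (1 + u) powr e"
        using u norm_powr_real_powr[of "1 + x" "a - of_nat (Suc M)"] by (auto simp: e_def)
      have "(1 + u) powr e \<le> (1 + u) powr \<bar>e\<bar>"
        using u by (intro powr_mono) auto
      also have "\<dots> \<le> 2 powr \<bar>e\<bar>" using u by (intro powr_mono2) auto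
      finally have 2: "(1 + u) powr e \<le> 2 powr \<bar>e\<bar>" .
      show ?thesis unfolding f_def B_def norm_mult 1 e_def[symmetric]
        by (intro mult_left_mono 2) auto
    qed
    show "0 \<in> closed_segment 0 (1::complex)" by simp
    show "1 / of_nat m \<in> closed_segment 0 (1::complex)"
      by (auto simp: closed_segment_def m_def scaleR_conv_of_real intro!: exI[of _ "1 / real (Suc n)"])
  qed
  also have "\<dots> \<le> B * cmod (1 / of_nat m) ^ Suc M"
  proof -
    have "B * cmod (1 / of_nat m) ^ Suc M / fact M \<le> B * cmod (1 / of_nat m) ^ Suc M / 1"
      by (intro divide_left_mono mult_nonneg_nonneg) (auto simp: B_def fact_ge_1)
    then show ?thesis by simp
  qed
  finally have T: "cmod (f 0 (1 / of_nat m) - (\<Sum>i\<le>M. f i 0 * (1 / of_nat m) ^ i / fact i))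
      \<le> B * (1 / real m) ^ Suc M" by (simp add: norm_divide)
  have fi: "f i 0 / fact i = a gchoose i" for i
    by (simp add: f_def gbinomial_prod_rev atLeast0LessThan)
  have m0: "(of_nat m :: complex) \<noteq> 0" "real m > 0" by (auto simp: m_def simp del: of_nat_Suc)
  have pw: "of_nat m powr a * (1 / of_nat m) ^ i = (of_nat m powr (a - of_nat i) :: complex)" for i
    using m0 by (simp add: powr_diff powr_nat' field_simps)
  have pw1: "of_nat m powr a * (1 + 1 / of_nat m) powr a = (of_nat (Suc m) powr a :: complex)"
  proof -
    have "(of_nat (Suc m) :: complex) = of_real (real m) * of_real (1 + 1 / real m)"
      using m0 by (simp add: field_simps)
    also have "\<dots> powr a = of_real (real m) powr a * of_real (1 + 1 / real m) powr a"
      by (rule powr_times_real) auto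
    finally show ?thesis by simp
  qed
  have "of_nat m powr a * (f 0 (1 / of_nat m) - (\<Sum>i\<le>M. f i 0 * (1 / of_nat m) ^ i / fact i))
     = of_nat (Suc m) powr a - (\<Sum>i\<le>M. (a gchoose i) * of_nat m powr (a - of_nat i))"
  proof -
    have "of_nat m powr a * (\<Sum>i\<le>M. f i 0 * (1 / of_nat m) ^ i / fact i)
        = (\<Sum>i\<le>M. (f i 0 / fact i) * (of_nat m powr a * (1 / of_nat m) ^ i))"
      by (simp add: sum_distrib_left field_simps)
    also have "\<dots> = (\<Sum>i\<le>M. (a gchoose i) * of_nat m powr (a - of_nat i))"
      by (simp only: fi pw)
    finally show ?thesis using pw1 by (simp add: f_def right_diff_distrib)
  qed
  also have "(\<Sum>i\<le>M. (a gchoose i) * of_nat m powr (a - of_nat i))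
     = of_nat m powr a + (\<Sum>j=1..M. (a gchoose j) * of_nat m powr (a - of_nat j))"
    by (simp add: atMost_atLeast0 sum.atLeast_Suc_atMost)
  also have "of_nat (Suc m) powr a - \<dots> = - zR M n s"
    by (simp add: a_def m_def)
  finally have eq: "of_nat m powr a *
      (f 0 (1 / of_nat m) - (\<Sum>i\<le>M. f i 0 * (1 / of_nat m) ^ i / fact i)) = - zR M n s" .
  have "cmod (zR M n s) = cmod (- zR M n s)" by (rule norm_minus_cancel[symmetric])
  also have "\<dots> = cmod (of_nat m powr a) *
      cmod (f 0 (1 / of_nat m) - (\<Sum>i\<le>M. f i 0 * (1 / of_nat m) ^ i / fact i))"
    unfolding eq[symmetric] by (rule norm_mult)
  also have "\<dots> \<le> cmod (of_nat m powr a) * (B * (1 / real m) ^ Suc M)"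
    by (intro mult_left_mono T) auto
  also have "cmod (of_nat m powr a) = real m powr Re a"
    using norm_powr_real_powr[of "of_nat m" a] by simp
  also have "real m powr Re a * (B * (1 / real m) ^ Suc M) = B * real m powr (Re a - real (Suc M))"
    using m0 powr_realpow[of "real m" "Suc M"]
    by (simp add: powr_diff field_simps del: of_nat_Suc power_Suc)
  finally show ?thesis unfolding B_def a_def m_def by (simp add: algebra_simps)
qed

lemma zeta_remainder_holomorphic:
  "(\<lambda>s. \<Sum>n. zR M n s) holomorphic_on {s. Re s > 1 - real M}"
proof (rule holomorphic_uniform_sequence[where f = "\<lambda>N s. \<Sum>n<N. zR M n s"])
  show "open {s. Re s > 1 - real M}" by (rule open_halfspace_Re_gt)
  show "(\<lambda>s. \<Sum>n<N. zR M n s) holomorphic_on {s. Re s > 1 - real M}" for N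
    unfolding gbinomial_prod_rev
    by (intro holomorphic_intros) (auto simp flip: of_nat_Suc)
  fix x :: complex assume x: "x \<in> {s. Re s > 1 - real M}"
  define d where "d = (Re x - (1 - real M)) / 2"
  define c where "c = Re x - d"
  have d: "d > 0" "c > 1 - real M" using x by (auto simp: d_def c_def field_simps)
  have Re_ge: "Re s \<ge> c" if "s \<in> cball x d" for s
    using that abs_Re_le_cmod[of "x - s"] by (auto simp: dist_norm c_def)
  define A where "A = (\<lambda>s. norm (\<Prod>i<Suc M. 1 - s - of_nat i) * 2 powr \<bar>Re (1 - s) - real (Suc M)\<bar>)"
  have "continuous_on (cball x d) A" unfolding A_def by (intro continuous_intros) auto
  then have "bounded (A ` cball x d)" by (intro compact_imp_bounded compact_continuous_image) auto
  then obtain B where B: "\<And>s. s \<in> cball x d \<Longrightarrow> A s \<le> B"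
    unfolding bounded_iff by (metis abs_le_D1 image_eqI real_norm_def)
  have A0: "A s \<ge> 0" for s by (simp add: A_def)
  have "uniform_limit (cball x d) (\<lambda>N s. \<Sum>n<N. zR M n s) (\<lambda>s. \<Sum>n. zR M n s) sequentially"
  proof (rule Weierstrass_m_test)
    show "norm (zR M n s) \<le> B * real (Suc n) powr (- c - real M)" if "s \<in> cball x d" for n s
    proof -
      have "norm (zR M n s) \<le> A s * real (Suc n) powr (- Re s - real M)"
        using zeta_remainder_bound unfolding A_def by blast
      also have "\<dots> \<le> B * real (Suc n) powr (- c - real M)"
        using B[OF that] A0[of s] Re_ge[OF that] by (intro mult_mono powr_mono) auto
      finally show ?thesis .
    qed
    have "summable (\<lambda>n. real n powr (- c - real M))"
      using d by (simp add: summable_real_powr_iff)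
    then show "summable (\<lambda>n. B * real (Suc n) powr (- c - real M))"
      by (intro summable_mult) (subst summable_Suc_iff)
  qed
  moreover have "cball x d \<subseteq> {s. Re s > 1 - real M}"
    using Re_ge d by force
  ultimately show "\<exists>d>0. cball x d \<subseteq> {s. Re s > 1 - real M} \<and>
      uniform_limit (cball x d) (\<lambda>N s. \<Sum>n<N. zR M n s) (\<lambda>s. \<Sum>n. zR M n s) sequentially"
    using d by blast
qed

abbreviation (input) zD :: "complex \<Rightarrow> complex" where
  "zD s \<equiv> (\<Sum>n. of_nat (Suc n) powr (- s))"

lemma zeta_series_sums: "(\<lambda>n. of_nat (Suc n) powr (- s)) sums zD s" if "Re s > 1" for s :: complex
proof (rule summable_sums, rule summable_norm_cancel)
  have "summable (\<lambda>n. real (Suc n) powr (- Re s))"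
    using that by (subst summable_Suc_iff) (simp add: summable_real_powr_iff)
  moreover have "norm (of_nat (Suc n) powr (- s) :: complex) = real (Suc n) powr (- Re s)" for n
    using norm_powr_real_powr[of "of_nat (Suc n)" "- s"] by simp
  ultimately show "summable (\<lambda>n. norm (of_nat (Suc n) powr (- s) :: complex))" by simp
qed

lemma zeta_remainder_sum:
  assumes "Re s > 1" "M \<ge> 1"
  shows "(s - 1) * zD s = 1 - (\<Sum>i=1..<M. ((1 - s) gchoose i) / of_nat (Suc i) *
           ((s + of_nat i - 1) * zD (s + of_nat i))) - (\<Sum>n. zR M n s)"
proof -
  define h where "h = (\<lambda>n. of_nat (Suc n) powr (1 - s) :: complex)"
  have "h \<longlonglongrightarrow> 0"
  proof (rule tendsto_norm_zero_cancel)
    have "(\<lambda>n. real (Suc n) powr (1 - Re s)) \<longlonglongrightarrow> 0"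
      using assms
      by (intro tendsto_neg_powr filterlim_compose[OF filterlim_real_sequentially] filterlim_Suc) auto
    moreover have "norm (h n) = real (Suc n) powr (1 - Re s)" for n
      using norm_powr_real_powr[of "of_nat (Suc n)" "1 - s"] by (simp add: h_def)
    ultimately show "(\<lambda>n. norm (h n)) \<longlonglongrightarrow> 0" by simp
  qed
  then have 1: "(\<lambda>n. h n - h (Suc n)) sums 1"
    using telescope_sums'[of h 0] by (simp add: h_def)
  have 2: "(\<lambda>n. of_nat (Suc n) powr (1 - s - of_nat j)) sums zD (s + of_nat j - 1)" if "j \<ge> 1" for j
    using zeta_series_sums[of "s + of_nat j - 1"] that assms by (simp add: algebra_simps)
  have "(\<lambda>n. h n - h (Suc n) + (\<Sum>j=1..M. ((1 - s) gchoose j) * of_nat (Suc n) powr (1 - s - of_nat j)))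
      sums (1 + (\<Sum>j=1..M. ((1 - s) gchoose j) * zD (s + of_nat j - 1)))"
    by (intro sums_add 1 sums_sum sums_mult 2) auto
  then have *: "(\<Sum>n. zR M n s) = 1 + (\<Sum>j=1..M. ((1 - s) gchoose j) * zD (s + of_nat j - 1))"
    unfolding h_def by (rule sums_unique[symmetric])
  have "(\<Sum>j=1..M. ((1 - s) gchoose j) * zD (s + of_nat j - 1))
     = (\<Sum>i<M. ((1 - s) gchoose Suc i) * zD (s + of_nat i))"
    by (rule sum.reindex_bij_witness[of _ Suc "\<lambda>j. j - 1"])
       (auto simp: of_nat_diff algebra_simps Suc_le_eq)
  also have "\<dots> = (\<Sum>i<M. - (((1 - s) gchoose i) / of_nat (Suc i) *
           ((s + of_nat i - 1) * zD (s + of_nat i))))"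
  proof (rule sum.cong)
    fix i :: nat
    have "of_nat (Suc i) * ((1 - s) gchoose Suc i) = ((1 - s) gchoose i) * (1 - s - of_nat i)"
      by (simp add: gbinomial_prod_rev field_simps del: of_nat_Suc)
    then have "((1 - s) gchoose Suc i) = ((1 - s) gchoose i) * (1 - s - of_nat i) / of_nat (Suc i)"
      by (simp add: nonzero_eq_divide_eq mult.commute del: of_nat_Suc)
    also have "\<dots> = - (((1 - s) gchoose i) / of_nat (Suc i) * (s + of_nat i - 1))"
      by (simp add: divide_simps del: of_nat_Suc) (simp add: algebra_simps)
    finally show "((1 - s) gchoose Suc i) * zD (s + of_nat i) = - (((1 - s) gchoose i) / of_nat (Suc i) *
           ((s + of_nat i - 1) * zD (s + of_nat i)))" by simp
  qed simp
  also have "{..<M} = insert 0 {1..<M}" using assms by auto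
  also have "(\<Sum>i\<in>insert 0 {1..<M}. - (((1 - s) gchoose i) / of_nat (Suc i) *
           ((s + of_nat i - 1) * zD (s + of_nat i))))
      = - ((s - 1) * zD s) - (\<Sum>i=1..<M. ((1 - s) gchoose i) / of_nat (Suc i) *
           ((s + of_nat i - 1) * zD (s + of_nat i)))"
    by (subst sum.insert) (simp_all add: sum_negf)
  finally show ?thesis unfolding * by simp
qed

lemma zeta_halfplane:
  "\<exists>g. g holomorphic_on {s. Re s > 1 - real (Suc N)} \<and> (\<forall>s. Re s > 1 \<longrightarrow> g s = (s - 1) * zD s)"
proof (induction N)
  case 0
  show ?case
    by (rule exI[of _ "\<lambda>s. 1 - (\<Sum>n. zR 1 n s)"], intro conjI holomorphic_intros)
       (use zeta_remainder_holomorphic[of 1] zeta_remainder_sum[of _ 1] in simp_all)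
next
  case (Suc N)
  then obtain g where g: "g holomorphic_on {s. Re s > 1 - real (Suc N)}"
    "\<And>s. Re s > 1 \<Longrightarrow> g s = (s - 1) * zD s" by auto
  define M where "M = Suc (Suc N)"
  define g' where "g' = (\<lambda>s. 1 - (\<Sum>i=1..<M. ((1 - s) gchoose i) / of_nat (Suc i) * g (s + of_nat i))
       - (\<Sum>n. zR M n s))"
  have shift: "(\<lambda>s. g (s + of_nat i)) holomorphic_on {s. Re s > 1 - real M}" if "i \<ge> 1" for i
  proof -
    have "(g \<circ> (\<lambda>s. s + of_nat i)) holomorphic_on {s. Re s > 1 - real M}"
      by (rule holomorphic_on_compose_gen[OF _ g(1)])
         (use that in \<open>auto intro!: holomorphic_intros simp: M_def\<close>)
    then show ?thesis by (simp add: o_def)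
  qed
  have "(\<lambda>s. (1 - s) gchoose i) holomorphic_on A" for i A
    unfolding gbinomial_prod_rev by (intro holomorphic_intros) auto
  then have "g' holomorphic_on {s. Re s > 1 - real M}"
    unfolding g'_def
    by (intro holomorphic_on_diff holomorphic_on_sum holomorphic_on_mult holomorphic_on_divide
          holomorphic_on_const zeta_remainder_holomorphic shift)
       (simp_all del: of_nat_Suc)
  moreover have "g' s = (s - 1) * zD s" if "Re s > 1" for s
  proof -
    have "g (s + of_nat i) = (s + of_nat i - 1) * zD (s + of_nat i)" for i
      using that by (intro g(2)) auto
    then show ?thesis unfolding g'_def
      using zeta_remainder_sum[of s M] that by (simp add: M_def del: of_nat_Suc)
  qed
  ultimately show ?case unfolding M_def by blast
qed

theorem zeta_continuation_exists: "\<exists>f. zeta_continuation f"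
proof -
  define H where "H = (\<lambda>N::nat. {s. Re s > 1 - real (Suc N)})"
  obtain G where G: "\<And>N. G N holomorphic_on H N" "\<And>N s. Re s > 1 \<Longrightarrow> G N s = (s - 1) * zD s"
    using zeta_halfplane unfolding H_def by metis
  have le: "G M s = G N s" if "s \<in> H M" "M \<le> N" for M N s
  proof (rule analytic_continuation_open[of "{s. Re s > 1}" "H M" "G M" "G N"])
    show "{s. Re s > 1} \<noteq> {}" by (auto intro!: exI[of _ "2::complex"])
    show "connected (H M)"
      unfolding H_def by (intro convex_connected convex_halfspace_Re_gt)
    show "G N holomorphic_on H M"
      by (rule holomorphic_on_subset[OF G(1)]) (use that in \<open>auto simp: H_def\<close>)
  qed (use that G in \<open>auto simp: H_def open_halfspace_Re_gt\<close>)
  define g where "g = (\<lambda>s. G (nat \<lceil>1 - Re s\<rceil>) s)"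
  have gG: "g s = G N s" if "s \<in> H N" for s N
  proof -
    have "s \<in> H (nat \<lceil>1 - Re s\<rceil>)" unfolding H_def by simp linarith
    then show ?thesis using le[of s] that unfolding g_def by (metis nat_le_linear)
  qed
  have "g holomorphic_on (\<Union>N\<in>UNIV. H N)"
  proof (rule holomorphic_on_UN_open)
    show "g holomorphic_on H N" for N
      using G(1)[of N] gG by (metis holomorphic_cong)
    show "open (H N)" for N unfolding H_def by (rule open_halfspace_Re_gt)
  qed
  moreover have "(\<Union>N\<in>UNIV. H N) = UNIV"
  proof -
    have "s \<in> H (nat \<lceil>1 - Re s\<rceil>)" for s unfolding H_def by simp linarith
    then show ?thesis by blast
  qed
  ultimately have g: "g holomorphic_on UNIV" by simp
  have "zeta_continuation (\<lambda>s. g s / (s - 1))"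
    unfolding zeta_continuation_def
  proof (intro conjI allI impI)
    show "(\<lambda>s. g s / (s - 1)) holomorphic_on - {1}"
      by (intro holomorphic_intros holomorphic_on_subset[OF g]) auto
    fix z :: complex assume z: "Re z > 1"
    have "g z = (z - 1) * zD z" using gG[of z 0] G(2)[OF z] z by (simp add: H_def)
    moreover have "z \<noteq> 1" using z by auto
    ultimately have "g z / (z - 1) = zD z" by simp
    then show "(\<lambda>n. 1 / of_nat (Suc n) powr z) sums (g z / (z - 1))"
      using zeta_series_sums[OF z] by (simp add: powr_minus field_simps del: of_nat_Suc)
  qed
  then show ?thesis by blast
qed

lemma zeta_continuation_unique:
  assumes "zeta_continuation f" "zeta_continuation g" "s \<noteq> 1"
  shows "f s = g s"
proof (rule analytic_continuation_open[of "{s. Re s > 1}" "- {1}" f g])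
  show "{s. Re s > 1} \<noteq> {}" by (auto intro!: exI[of _ "2::complex"])
  show "connected (- {1::complex})" by (rule connected_punctured_universe) simp
  show "f z = g z" if "z \<in> {s. Re s > 1}" for z
    using assms that unfolding zeta_continuation_def by (metis mem_Collect_eq sums_unique2)
qed (use assms in \<open>auto simp: zeta_continuation_def open_halfspace_Re_gt\<close>)

theorem zeta_continuation_zeta: "zeta_continuation zeta"
proof -
  obtain f where f: "zeta_continuation f" using zeta_continuation_exists by blast
  have eq: "zeta s = f s" if "s \<noteq> 1" for s
    unfolding zeta_def using that f
    by (auto intro!: the_equality dest: zeta_continuation_unique)
  have "zeta holomorphic_on - {1}"
    using f eq unfolding zeta_continuation_def by (metis ComplD holomorphic_cong singletonI)
  moreover have "zeta z = f z" if "Re z > 1" for z using that by (intro eq) auto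
  ultimately show ?thesis using f by (simp add: zeta_continuation_def)
qed

lemma zeta_not_constant: "\<not> zeta constant_on - {1}"
proof -
  have sums: "\<And>z. Re z > 1 \<Longrightarrow> (\<lambda>n. 1 / of_nat (Suc n) powr z) sums zeta z"
    using zeta_continuation_zeta unfolding zeta_continuation_def by auto
  have re: "(\<lambda>n. 1 / real (Suc n) powr x) sums Re (zeta (of_real x))" if "x > 1" for x
  proof -
    have "(1 / of_nat (Suc n) powr of_real x :: complex) = of_real (1 / real (Suc n) powr x)" for n
      using powr_of_real[of "real (Suc n)" x] by simp
    then show ?thesis using sums_Re[OF sums[of "of_real x"]] that by simp
  qed
  have "(\<lambda>n. 1 / real (Suc n) powr 2 - 1 / real (Suc n) powr 3)
      sums (Re (zeta (of_real 2)) - Re (zeta (of_real 3)))"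
    by (intro sums_diff re) auto
  moreover have "0 \<le> 1 / real (Suc n) powr 2 - 1 / real (Suc n) powr 3" for n
    using powr_mono[of 2 3 "real (Suc n)"] by (simp add: field_simps del: of_nat_Suc powr_numeral)
  moreover have "0 < 1 / real (Suc 1) powr 2 - 1 / real (Suc 1) powr 3"
    by simp
  ultimately have "0 < Re (zeta (of_real 2)) - Re (zeta (of_real 3))"
    using suminf_pos2[of "\<lambda>n. 1 / real (Suc n) powr 2 - 1 / real (Suc n) powr 3" 1]
    by (simp only: sums_iff)
  then have "zeta 2 \<noteq> zeta 3" by force
  moreover have "2 \<in> - {1::complex}" "3 \<in> - {1::complex}" by auto
  ultimately show ?thesis
    unfolding constant_on_def by metis
qed

lemma countable_zeta_ordinates: "countable zeta_ordinates"
proof -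
  have "zeta holomorphic_on - {1}"
    using zeta_continuation_zeta unfolding zeta_continuation_def by auto
  moreover have "fsigma (- {1::complex})"
  proof -
    have "- {1::complex} = (\<Union>n. - ball 1 (1 / real (Suc n)))"
    proof (intro equalityI subsetI)
      fix z :: complex assume "z \<in> - {1}"
      then have "dist 1 z > 0" by simp
      then obtain n where "1 / real (Suc n) < dist 1 z"
        using nat_approx_posE by blast
      then show "z \<in> (\<Union>n. - ball 1 (1 / real (Suc n)))"
        by (intro UN_I[of n]) (auto simp del: of_nat_Suc)
    qed auto
    moreover have "fsigma (\<Union>n. - ball (1::complex) (1 / real (Suc n)))"
      by (intro fsigma.intros closed_Compl open_ball)
    ultimately show ?thesis by simp
  qed
  ultimately have "countable {z \<in> - {1}. zeta z = 0}"
    using zeta_not_constant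
    by (intro holomorphic_countable_zeros connected_punctured_universe) auto
  then have "countable (Im ` {z \<in> - {1}. zeta z = 0})" by (rule countable_image)
  moreover have "zeta_ordinates \<subseteq> Im ` {z \<in> - {1}. zeta z = 0}"
  proof
    fix \<gamma> assume "\<gamma> \<in> zeta_ordinates"
    then have "Complex (1/2) \<gamma> \<in> {z \<in> - {1}. zeta z = 0}"
      by (auto simp: zeta_ordinates_def nontrivial_zeta_zeros_def complex_eq_iff)
    then show "\<gamma> \<in> Im ` {z \<in> - {1}. zeta z = 0}"
      by (intro image_eqI[of _ _ "Complex (1/2) \<gamma>"]) simp_all
  qed
  ultimately show ?thesis by (rule countable_subset[rotated])
qed

lemma ordinate_multiplicity_pos:
  assumes "\<gamma> \<in> zeta_ordinates"
  shows "ordinate_multiplicity \<gamma> > 0"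
proof -
  define z where "z = Complex (1/2) \<gamma>"
  have hol: "zeta holomorphic_on - {1}"
    using zeta_continuation_zeta unfolding zeta_continuation_def by auto
  have z: "z \<in> - {1}" "zeta z = 0"
    using assms by (auto simp: zeta_ordinates_def nontrivial_zeta_zeros_def z_def complex_eq_iff)
  have "\<exists>w\<in>- {1}. zeta w \<noteq> 0"
    using zeta_not_constant z unfolding constant_on_def by metis
  then have "zorder zeta z > 0"
    using zorder_exist_zero[of zeta "- {1}" z] hol z connected_punctured_universe[of "1::complex"]
    by (auto simp: Let_def)
  then show ?thesis by (simp add: ordinate_multiplicity_def z_def)
qed

lemma ordinate_sum_measurable:
  assumes [measurable]: "\<And>\<gamma>. (\<lambda>t. h t \<gamma>) \<in> borel_measurable borel"
  shows "(\<lambda>t. ordinate_sum (h t)) \<in> borel_measurable borel"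
proof -
  have "(\<lambda>t. SUP F\<in>{F. finite F \<and> F \<subseteq> zeta_ordinates}.
           \<Sum>\<gamma>\<in>F. of_nat (ordinate_multiplicity \<gamma>) * ennreal (h t \<gamma>)) \<in> borel_measurable borel"
    by (intro borel_measurable_SUP countable_Collect_finite_subset countable_zeta_ordinates) measurable
  then show ?thesis
    unfolding ordinate_sum_def by (subst nonneg_infsum_complete) auto
qed

lemma level_set_measurable:
  "{t \<in> {T..2 * T}. ordinate_sum (\<lambda>\<gamma>. Q_kernel (ln T / (2 * pi) * (\<gamma> - t))) \<ge> ennreal x}
     \<in> sets lebesgue"
proof -
  have [measurable]: "(\<lambda>t. ordinate_sum (\<lambda>\<gamma>. Q_kernel (ln T / (2 * pi) * (\<gamma> - t)))) \<in> borel_measurable borel"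
    by (rule ordinate_sum_measurable) (unfold Q_kernel_def, measurable)
  have "{t \<in> {T..2 * T}. ordinate_sum (\<lambda>\<gamma>. Q_kernel (ln T / (2 * pi) * (\<gamma> - t))) \<ge> ennreal x}
     \<in> sets borel" by measurable
  then show ?thesis by (intro sets_completionI_sets) simp
qed

end

theory Submission
  imports Defs "HOL-Number_Theory.Prime_Powers" "HOL-Real_Asymp.Real_Asymp" "HOL-Combinatorics.Multiset_Permutations"
begin

text \<open>
  Let \<open>S(t)\<close> be the sum of the Poisson kernels \<open>b / (b^2 + (t - \<gamma>)^2)\<close> over the ordinates with \<open>|\<gamma> - t| \<le> 1/2\<close>,
  where \<open>b = 1/L\<close>. Under RH, Landau's local expansion (by Blaschke factors) shows that the logarithmic derivative
  of \<open>(s - 1) \<zeta>(s)\<close> at \<open>1/2 + b + it\<close> has real part at least \<open>S(t) - O(log t)\<close>. Integrate it along this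
  vertical line against a nonnegative kernel of exponential type \<open>L\<close> and move the line to \<open>Re s = 2\<close>: there it is
  \<open>1/(s - 1)\<close> minus the Dirichlet series of the von Mangoldt function, and the type of the kernel cuts this series
  at \<open>n \<le> e^L\<close>. So \<open>S(t)\<close> is at most a Dirichlet polynomial of length \<open>e^L\<close> plus \<open>O(log t + e^(3L/2) / t)\<close>.

  With \<open>L = K log T / x\<close> for a large constant \<open>K\<close>, a sum over zeros of size at least \<open>x\<close> forces the part of the
  polynomial over primes to be of order \<open>x L\<close>, because the prime powers contribute only \<open>O(L)\<close>. Its moment of order
  \<open>2k\<close> is at most \<open>T k! (C L^2)^k\<close> plus a term of the size of \<open>e^(2kL) (C L)^(2k)\<close>, since a product of \<open>k\<close> primes
  determines the primes up to order, and \<open>e^(2kL) \<le> T\<close> for \<open>k = x/(2K)\<close>. Markov's inequality then bounds the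
  measure by \<open>T (C/x)^k\<close>. If \<open>L < 4\<close>, then \<open>x\<close> exceeds a large multiple of \<open>log T\<close>, and the bound \<open>O(log T)\<close>
  for the number of zeros near \<open>t\<close> shows that the set is empty.
\<close>

section \<open>Landau's local expansion of a logarithmic derivative\<close>

text \<open>The scale L is a compromise. Every pointwise bound at height t loses a fixed multiple of
  log T, and zeros whose kernels sum to about x force a Poisson sum of order x L, so x L has to be a
  large multiple of log T. Any larger L would lower the moments that are affordable, and the saving
  is a factor of order 1/x per moment.

  \<open>riemann_hypothesis\<close> speaks of zeros with 0 < Re s < 1 only, while the line of
  integration crosses Re s = 1, so nonvanishing there has to be proved separately. It follows from
  the same local expansion, in which zeros to the left of a point contribute nonnegative real parts.
  So does the one quantitative fact about primes that is used, a bound O(L) for the sum of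
  \<open>mangoldt n / n\<close> over n up to e^L: it controls the coefficients of the prime
  polynomial both in mean square and in absolute sum, and also the prime powers.\<close>

lemma Borel_Caratheodory:
  fixes g :: "complex \<Rightarrow> complex"
  assumes hol: "g holomorphic_on ball 0 r" and g0: "g 0 = 0"
    and A: "\<And>z. z \<in> ball 0 r \<Longrightarrow> Re (g z) < A" and z: "norm z < r"
  shows "norm (g z) \<le> 2 * A * norm z / (r - norm z)"
proof -
  have r: "r > 0" using z norm_ge_zero[of z] by linarith
  have Apos: "A > 0" using A[of 0] g0 r by simp
  \<comment> \<open>A value w with Re w < A lies closer to 0 than to its mirror image 2A, so g / (2A
    - g) maps into the unit disc and fixes 0. This turns a one-sided bound on the real part into the
    situation of Schwarz's lemma.\<close>
  define \<phi> where "\<phi> = (\<lambda>u. g (of_real r * u) / (of_real (2 * A) - g (of_real r * u)))"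
  have mem: "of_real r * u \<in> ball 0 r" if "norm u < 1" for u :: complex
    using that r by (simp add: norm_mult)
  have nz: "of_real (2 * A) - g (of_real r * u) \<noteq> 0" if "norm u < 1" for u
  proof
    assume "of_real (2 * A) - g (of_real r * u) = 0"
    then have "Re (g (of_real r * u)) = 2 * A" by (simp add: complex_eq_iff)
    then show False using A[OF mem[OF that]] Apos by simp
  qed
  have "norm (\<phi> (z / of_real r)) \<le> norm (z / of_real r)"
  proof (rule Schwarz_Lemma(1))
    have "(g \<circ> (\<lambda>u. of_real r * u)) holomorphic_on ball 0 1"
      by (rule holomorphic_on_compose_gen[OF _ hol]) (use mem in \<open>auto intro!: holomorphic_intros\<close>)
    then show "\<phi> holomorphic_on ball 0 1"
      unfolding \<phi>_def by (intro holomorphic_intros) (use nz in \<open>auto simp: o_def\<close>)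
    show "\<phi> 0 = 0" by (simp add: \<phi>_def g0)
    show "norm (\<phi> u) < 1" if u: "norm u < 1" for u
    proof -
      define w where "w = g (of_real r * u)"
      have "Re w < A" using A[OF mem[OF u]] by (simp add: w_def)
      then have "(norm w)\<^sup>2 < (norm (of_real (2 * A) - w))\<^sup>2"
        using Apos unfolding cmod_power2 by (simp add: power2_eq_square algebra_simps)
      then have "norm w < norm (of_real (2 * A) - w)"
        by (rule power_less_imp_less_base) simp
      then show ?thesis
        using nz[OF u] by (simp add: \<phi>_def norm_divide w_def)
    qed
    show "norm (z / of_real r) < 1" using z r by (simp add: norm_divide)
  qed
  then have *: "norm (g z) * r \<le> norm z * norm (of_real (2 * A) - g z)"
    using r nz[of "z / of_real r"] z by (simp add: \<phi>_def norm_divide field_simps)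
  also have "\<dots> \<le> norm z * (2 * A + norm (g z))"
    using norm_triangle_ineq4[of "of_real (2 * A)" "g z"] Apos
    by (intro mult_left_mono) auto
  finally show ?thesis using z by (simp add: field_simps)
qed

text \<open>Without zeros h has a holomorphic logarithm, and the growth bound controls the real part
  of it. \<open>Borel_Caratheodory\<close> upgrades this to a bound on the modulus, and Cauchy's
  inequality on a disc of radius (r - q)/2 passes to the derivative; each of the two passages costs
  one factor r - q in the denominator.\<close>

lemma nonvanishing_log_deriv_bound:
  fixes h :: "complex \<Rightarrow> complex"
  assumes hol: "h holomorphic_on ball 0 r" and nz: "\<And>z. z \<in> ball 0 r \<Longrightarrow> h z \<noteq> 0"
    and bd: "\<And>z. z \<in> ball 0 r \<Longrightarrow> norm (h z) \<le> M * norm (h 0)"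
    and M: "M > 1" and q: "0 \<le> q" "q < r" and z: "norm z \<le> q"
  shows "norm (deriv h z / h z) \<le> 16 * r / (r - q)\<^sup>2 * ln M"
proof -
  have r: "r > 0" using q by simp
  obtain g where g: "g holomorphic_on ball 0 r" "\<And>z. z \<in> ball 0 r \<Longrightarrow> h z = exp (g z)"
    using holomorphic_logarithm_exists[OF convex_ball open_ball hol nz, of 0] r by (metis centre_in_ball)
  define k where "k = (\<lambda>z. g z - g 0)"
  have lnM: "ln M > 0" using M by simp
  have kh: "k holomorphic_on ball 0 r" unfolding k_def by (intro holomorphic_intros g)
  \<comment> \<open>The factor 2 provides the strict inequality that
    \<open>Borel_Caratheodory\<close> asks for; this is where M > 1 enters.\<close>
  have kbd: "Re (k w) < 2 * ln M" if "w \<in> ball 0 r" for w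
  proof -
    have "exp (Re (g w)) \<le> M * exp (Re (g 0))"
      using bd[OF that] g(2)[OF that] g(2)[of 0] r by simp
    also have "\<dots> = exp (ln M + Re (g 0))" using M by (simp add: exp_add)
    finally have "Re (k w) \<le> ln M" by (simp add: k_def)
    then show ?thesis using lnM by simp
  qed
  define e where "e = (r - q) / 2"
  have e: "e > 0" using q by (simp add: e_def)
  have sub: "norm w \<le> q + e" if "w \<in> cball z e" for w
    using that z norm_triangle_ineq2[of w z] by (auto simp: dist_norm norm_minus_commute)
  have "q + e < r" using q by (simp add: e_def field_simps)
  then have sub': "cball z e \<subseteq> ball 0 r" using sub by force
  have kb: "norm (k w) \<le> 2 * (2 * ln M) * r / e" if "w \<in> cball z e" for w
  proof -
    have w: "norm w < r" "r - norm w \<ge> e" using sub[OF that] q by (auto simp: e_def field_simps)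
    have "norm (k w) \<le> 2 * (2 * ln M) * norm w / (r - norm w)"
      by (rule Borel_Caratheodory[OF kh _ kbd w(1)]) (simp_all add: k_def)
    also have "\<dots> \<le> 2 * (2 * ln M) * r / e"
      using w e lnM r by (intro frac_le mult_left_mono) auto
    finally show ?thesis .
  qed
  have "norm ((deriv ^^ 1) k z) \<le> fact 1 * (2 * (2 * ln M) * r / e) / e ^ 1"
  proof (rule Cauchy_inequality)
    show "k holomorphic_on ball z e"
      by (rule holomorphic_on_subset[OF kh]) (use sub' ball_subset_cball in blast)
    show "continuous_on (cball z e) k"
      using holomorphic_on_imp_continuous_on[OF kh] sub' continuous_on_subset by blast
    show "norm (k x) \<le> 2 * (2 * ln M) * r / e" if "norm (z - x) = e" for x
      using that by (intro kb) (simp add: dist_norm)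
  qed (use e in auto)
  also have "fact 1 * (2 * (2 * ln M) * r / e) / e ^ 1 = 16 * r / (r - q)\<^sup>2 * ln M"
    by (simp add: e_def power2_eq_square)
  also have "(deriv ^^ 1) k z = deriv h z / h z"
  proof -
    have zin: "z \<in> ball 0 r" using z q by auto
    have gd: "(g has_field_derivative deriv g z) (at z)"
      using g(1) zin by (simp add: holomorphic_derivI)
    have "((\<lambda>w. exp (g w)) has_field_derivative exp (g z) * deriv g z) (at z)"
      using gd by (auto intro!: derivative_eq_intros)
    then have "(h has_field_derivative exp (g z) * deriv g z) (at z)"
      by (rule has_field_derivative_transform_within_open[of _ _ _ "ball 0 r"]) (use g(2) zin in auto)
    then have "deriv h z = h z * deriv g z" using DERIV_imp_deriv g(2)[OF zin] by fastforce
    moreover have "deriv k z = deriv g z"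
      unfolding k_def by (rule DERIV_imp_deriv) (use gd in \<open>auto intro!: derivative_eq_intros\<close>)
    ultimately show ?thesis using nz[OF zin] by simp
  qed
  finally show ?thesis .
qed

text \<open>Zeros are split off one at a time. The exponents can be the orders of f itself, because
  the factors already extracted do not vanish at the next zero a, so the current quotient has the
  same order there as f.\<close>

lemma holomorphic_factor_finite_zeros:
  fixes f :: "complex \<Rightarrow> complex"
  assumes f: "f holomorphic_on S" "open S" "connected S" and nc: "\<exists>w\<in>S. f w \<noteq> 0"
    and Z: "finite Z" "Z \<subseteq> S"
  shows "\<exists>g. g holomorphic_on S \<and> (\<forall>z\<in>S. f z = g z * (\<Prod>\<rho>\<in>Z. (z - \<rho>) ^ nat (zorder f \<rho>)))
    \<and> (\<forall>\<rho>\<in>Z. g \<rho> \<noteq> 0)"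
  using Z
proof (induction Z rule: finite_induct)
  case empty
  then show ?case using f by (intro exI[of _ f]) auto
next
  case (insert a Z)
  define P where "P = (\<lambda>z. \<Prod>\<rho>\<in>Z. (z - \<rho>) ^ nat (zorder f \<rho>))"
  from insert obtain g where g: "g holomorphic_on S" "\<And>z. z \<in> S \<Longrightarrow> f z = g z * P z"
     "\<And>\<rho>. \<rho> \<in> Z \<Longrightarrow> g \<rho> \<noteq> 0" unfolding P_def by auto
  define n where "n = nat (zorder f a)"
  define p where "p = zor_poly f a"
  have aS: "a \<in> S" using insert by auto
  obtain r where r: "r > 0" "cball a r \<subseteq> S" "p holomorphic_on cball a r"
      "\<And>w. w \<in> cball a r \<Longrightarrow> f w = p w * (w - a) ^ n \<and> p w \<noteq> 0"
    using zorder_exist_zero[OF f(1,2,3) aS nc] unfolding n_def p_def by blast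
  have Pa: "P a \<noteq> 0" using insert by (auto simp: P_def)
  have Ph: "P holomorphic_on A" for A unfolding P_def by (intro holomorphic_intros)
  \<comment> \<open>The quotient by (w - a)^n, with the removable singularity filled in: near a it
    agrees with p / P, which is holomorphic because P does not vanish on U.\<close>
  define g' where "g' = (\<lambda>w. if w = a then p a / P a else g w / (w - a) ^ n)"
  have oU: "open {w \<in> ball a r. P w \<noteq> 0}"
  proof -
    have "open (ball a r \<inter> P -` (- {0}))"
      using Ph[of "ball a r"] by (intro continuous_open_preimage holomorphic_on_imp_continuous_on) auto
    then show ?thesis by (simp add: vimage_def Int_def)
  qed
  define U where "U = {w \<in> ball a r. P w \<noteq> 0}"
  have U: "open U" "a \<in> U" "U \<subseteq> S" using oU r Pa unfolding U_def by auto
  have geq: "g' w = p w / P w" if "w \<in> U" for w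
  proof (cases "w = a")
    case False
    have "g w * P w = p w * (w - a) ^ n" using g(2)[of w] r that U by (auto simp: U_def)
    then show ?thesis using False that by (simp add: g'_def U_def field_simps)
  qed (simp add: g'_def)
  have "g' holomorphic_on (S - {a}) \<union> U"
  proof (rule holomorphic_on_Un)
    show "g' holomorphic_on S - {a}"
    proof -
      have "(\<lambda>w. g w / (w - a) ^ n) holomorphic_on S - {a}"
        by (intro holomorphic_intros holomorphic_on_subset[OF g(1)]) auto
      then show ?thesis by (rule holomorphic_transform) (simp add: g'_def)
    qed
    have "(\<lambda>w. p w / P w) holomorphic_on U"
      by (intro holomorphic_intros holomorphic_on_subset[OF r(3)] Ph) (auto simp: U_def)
    then show "g' holomorphic_on U" by (rule holomorphic_transform) (simp add: geq)
  qed (use U f(2) in auto)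
  moreover have "(S - {a}) \<union> U = S" using U aS by auto
  moreover have "f z = g' z * (\<Prod>\<rho>\<in>insert a Z. (z - \<rho>) ^ nat (zorder f \<rho>))" if "z \<in> S" for z
  proof -
    have "(\<Prod>\<rho>\<in>insert a Z. (z - \<rho>) ^ nat (zorder f \<rho>)) = (z - a) ^ n * P z"
      using insert by (simp add: n_def P_def)
    moreover have "f z = g' z * ((z - a) ^ n * P z)"
    proof (cases "z = a")
      case True
      then show ?thesis using r(4)[of a] r(1) Pa by (simp add: g'_def)
    next
      case False
      then show ?thesis using g(2)[OF that] by (simp add: g'_def)
    qed
    ultimately show ?thesis by simp
  qed
  moreover have "g' \<rho> \<noteq> 0" if "\<rho> \<in> insert a Z" for \<rho>
    using that g(3) r(4)[of a] r(1) Pa insert by (auto simp: g'_def)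
  ultimately show ?case by (intro exI[of _ g']) auto
qed

text \<open>The factors \<open>u\<close> are left general because the formula is applied twice, to
  the factors z - \<rho> of f and to the Blaschke factors that replace them.\<close>

lemma logderiv_mult_prod_power:
  fixes g :: "complex \<Rightarrow> complex" and u :: "'a \<Rightarrow> complex \<Rightarrow> complex"
  assumes Z: "finite Z" and g: "(g has_field_derivative g') (at z)" "g z \<noteq> 0"
    and u: "\<And>\<rho>. \<rho> \<in> Z \<Longrightarrow> (u \<rho> has_field_derivative u' \<rho>) (at z)" "\<And>\<rho>. \<rho> \<in> Z \<Longrightarrow> u \<rho> z \<noteq> 0"
  shows "deriv (\<lambda>w. g w * (\<Prod>\<rho>\<in>Z. u \<rho> w ^ m \<rho>)) z / (g z * (\<Prod>\<rho>\<in>Z. u \<rho> z ^ m \<rho>))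
     = g' / g z + (\<Sum>\<rho>\<in>Z. of_nat (m \<rho>) * u' \<rho> / u \<rho> z)"
proof -
  let ?P = "\<lambda>w. \<Prod>\<rho>\<in>Z. u \<rho> w ^ m \<rho>"
  have "(?P has_field_derivative (?P z * (\<Sum>\<rho>\<in>Z. (of_nat (m \<rho>) * u \<rho> z ^ (m \<rho> - 1) * u' \<rho>) / u \<rho> z ^ m \<rho>))) (at z)"
    by (rule has_field_derivative_prod') (use u in \<open>auto intro!: derivative_eq_intros\<close>)
  also have "(\<Sum>\<rho>\<in>Z. (of_nat (m \<rho>) * u \<rho> z ^ (m \<rho> - 1) * u' \<rho>) / u \<rho> z ^ m \<rho>) = (\<Sum>\<rho>\<in>Z. of_nat (m \<rho>) * u' \<rho> / u \<rho> z)"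
  proof (rule sum.cong)
    fix \<rho> assume "\<rho> \<in> Z"
    then show "(of_nat (m \<rho>) * u \<rho> z ^ (m \<rho> - 1) * u' \<rho>) / u \<rho> z ^ m \<rho> = of_nat (m \<rho>) * u' \<rho> / u \<rho> z"
      using u(2) by (cases "m \<rho>") auto
  qed simp
  finally have "deriv (\<lambda>w. g w * ?P w) z = g z * (?P z * (\<Sum>\<rho>\<in>Z. of_nat (m \<rho>) * u' \<rho> / u \<rho> z)) + g' * ?P z"
    by (intro DERIV_imp_deriv DERIV_mult' g(1))
  moreover have "?P z \<noteq> 0" using u(2) Z by auto
  ultimately show ?thesis using g(2) by (simp add: field_simps)
qed

text \<open>A Jensen-type argument with three radii: zeros in the disc of radius r are divided out,
  the growth bound is given on the circle of radius R, and the expansion is valid in the disc of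
  radius q. The quotient \<open>h\<close> still satisfies the growth bound and has no zeros in the
  r-disc, so \<open>nonvanishing_log_deriv_bound\<close> applies to it. The second summand of the
  constant pays for the logarithmic derivatives of the Blaschke factors, one for each zero
  counted.\<close>

lemma Landau_log_deriv:
  fixes f :: "complex \<Rightarrow> complex" and R r q M :: real
  assumes f: "f holomorphic_on S" "open S" "connected S" "cball s R \<subseteq> S"
    and s: "f s \<noteq> 0" and bd: "\<And>z. z \<in> sphere s R \<Longrightarrow> norm (f z) \<le> M * norm (f s)"
    and M: "M > 1" and qr: "0 < q" "q < r" "r < R"
  defines "Z \<equiv> {z \<in> cball s r. f z = 0}"
  shows "finite Z" (is ?A)
    and "(\<Sum>\<rho>\<in>Z. real (nat (zorder f \<rho>))) \<le> ln M / ln (R / r)" (is ?B)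
    and "\<And>z. z \<in> cball s q \<Longrightarrow> f z \<noteq> 0 \<Longrightarrow>
       norm (deriv f z / f z - (\<Sum>\<rho>\<in>Z. of_nat (nat (zorder f \<rho>)) / (z - \<rho>)))
         \<le> (16 * r / (r - q)\<^sup>2 + r / (R\<^sup>2 - r * q) / ln (R / r)) * ln M" (is "\<And>z. _ \<Longrightarrow> _ \<Longrightarrow> ?C z")
proof -
  have sS: "s \<in> S" using f(4) qr by auto
  have nc: "\<exists>w\<in>S. f w \<noteq> 0" using s sS by blast
  have sub: "cball s r \<subseteq> S" using f(4) qr by auto
  define m where "m = (\<lambda>\<rho>. nat (zorder f \<rho>))"
  show fin: ?A
  proof (cases "f constant_on S")
    case True
    then have "Z = {}" unfolding Z_def constant_on_def using s sS sub by force
    then show ?thesis by simp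
  next
    case False
    then show ?thesis unfolding Z_def
      using f sub by (intro holomorphic_compact_finite_zeros[of f S]) auto
  qed
  have ZS: "Z \<subseteq> S" using sub by (auto simp: Z_def)
  obtain g where g: "g holomorphic_on S" "\<And>z. z \<in> S \<Longrightarrow> f z = g z * (\<Prod>\<rho>\<in>Z. (z - \<rho>) ^ m \<rho>)"
     "\<And>\<rho>. \<rho> \<in> Z \<Longrightarrow> g \<rho> \<noteq> 0"
    using holomorphic_factor_finite_zeros[OF f(1-3) nc fin ZS] unfolding m_def by blast
  define u where "u = (\<lambda>\<rho> z. (of_real (R\<^sup>2) - cnj (\<rho> - s) * (z - s)) / of_real R)"
  (* dividing f by Blaschke factors instead of z - \<rho> keeps its modulus on the circle *)
  define h where "h = (\<lambda>z. g z * (\<Prod>\<rho>\<in>Z. u \<rho> z ^ m \<rho>))"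
  have R: "R > 0" "r > 0" using qr by auto
  have Zr: "norm (\<rho> - s) \<le> r" "\<rho> \<noteq> s" if "\<rho> \<in> Z" for \<rho>
    using that s by (auto simp: Z_def dist_norm norm_minus_commute)
  have ulow: "norm (of_real (R\<^sup>2) - cnj (\<rho> - s) * (z - s)) \<ge> R\<^sup>2 - r * d"
    if "\<rho> \<in> Z" "norm (z - s) \<le> d" for \<rho> z d
  proof -
    have "norm (cnj (\<rho> - s) * (z - s)) \<le> r * d"
      unfolding norm_mult complex_mod_cnj using Zr[OF that(1)] that(2) R by (intro mult_mono) auto
    moreover have "norm (of_real (R\<^sup>2) :: complex) = R\<^sup>2" unfolding norm_of_real by simp
    ultimately show ?thesis
      using norm_triangle_ineq2[of "of_real (R\<^sup>2)" "cnj (\<rho> - s) * (z - s)"] by linarith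
  qed
  have Rr: "R\<^sup>2 - r * R > 0" "r * r < R\<^sup>2" "r * q < R\<^sup>2"
  proof -
    show "R\<^sup>2 - r * R > 0" using R qr by (simp add: power2_eq_square)
    show "r * r < R\<^sup>2" "r * q < R\<^sup>2" unfolding power2_eq_square using qr by (intro mult_strict_mono'; simp)+
  qed
  have unz: "u \<rho> z \<noteq> 0" if "\<rho> \<in> Z" "z \<in> cball s R" for \<rho> z
  proof -
    have "norm (of_real (R\<^sup>2) - cnj (\<rho> - s) * (z - s)) > 0"
      using ulow[OF that(1), of z R] that(2) Rr by (auto simp: dist_norm norm_minus_commute)
    then show ?thesis unfolding u_def using R by (metis divide_eq_0_iff less_irrefl norm_zero of_real_eq_0_iff)
  qed
  have uR: "norm (u \<rho> z) = norm (z - \<rho>)" if "z \<in> sphere s R" for \<rho> z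
  proof -
    define w a where "w = z - s" and "a = \<rho> - s"
    have w: "norm w = R" using that by (simp add: w_def dist_norm norm_minus_commute)
    have "of_real (R\<^sup>2) - cnj a * w = w * cnj (w - a)"
      using complex_norm_square[of w] w by (simp add: algebra_simps)
    then have "norm (of_real (R\<^sup>2) - cnj a * w) = R * norm (w - a)"
      using w by (metis complex_mod_cnj norm_mult)
    then show ?thesis using R unfolding u_def norm_divide a_def[symmetric] w_def[symmetric]
      by (simp add: w_def a_def)
  qed
  have hh: "h holomorphic_on S" unfolding h_def u_def using R by (intro holomorphic_intros g) auto
  have hR: "norm (h z) \<le> M * norm (f s)" if "z \<in> sphere s R" for z
  proof -
    have "z \<in> S" using that f(4) by auto
    then have "norm (h z) = norm (f z)"
      using g(2) that by (simp add: h_def norm_mult prod_norm[symmetric] norm_power uR)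
    then show ?thesis using bd[OF that] by simp
  qed
  have hb: "norm (h z) \<le> M * norm (f s)" if "z \<in> cball s R" for z
  proof (rule maximum_modulus_frontier[of h "cball s R"])
    show "h holomorphic_on interior (cball s R)"
      using hh f(4) by (rule holomorphic_on_subset[OF _ subset_trans[OF interior_subset]])
    show "continuous_on (closure (cball s R)) h"
      using holomorphic_on_imp_continuous_on[OF hh] f(4) by (simp add: continuous_on_subset)
  qed (use that hR R in \<open>auto simp: frontier_cball\<close>)
  have hnz: "h z \<noteq> 0" if "z \<in> cball s r" for z
  proof -
    have "g z \<noteq> 0"
    proof (cases "z \<in> Z")
      case False
      then have "f z \<noteq> 0" using that by (auto simp: Z_def)
      then show ?thesis using g(2)[of z] that sub by auto
    qed (use g(3) in auto)
    moreover have "u \<rho> z \<noteq> 0" if "\<rho> \<in> Z" for \<rho> using unz[OF that, of z] \<open>z \<in> cball s r\<close> qr by auto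
    ultimately show ?thesis using fin by (simp add: h_def)
  qed
  define N where "N = (\<Sum>\<rho>\<in>Z. m \<rho>)"
  have us: "u \<rho> s = of_real R" for \<rho> using R by (simp add: u_def power2_eq_square)
  \<comment> \<open>At the centre each factor \<open>u\<close> has modulus R, while the factor s -
    \<rho> that it replaces has modulus at most r. So every zero makes \<open>h s\<close> larger by
    R / r, and the maximum principle for \<open>h\<close> limits their number.\<close>
  have hs: "norm (h s) \<ge> norm (f s) * (R / r) ^ N"
  proof -
    have "norm (f s) * (R / r) ^ N = norm (g s) * (\<Prod>\<rho>\<in>Z. norm (s - \<rho>) ^ m \<rho>) * (\<Prod>\<rho>\<in>Z. (R / r) ^ m \<rho>)"
      using g(2)[OF sS] by (simp add: N_def power_sum norm_mult prod_norm[symmetric] norm_power)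
    also have "\<dots> = norm (g s) * (\<Prod>\<rho>\<in>Z. (norm (s - \<rho>) * (R / r)) ^ m \<rho>)"
      by (simp only: prod.distrib[symmetric] power_mult_distrib mult.assoc)
    also have "\<dots> \<le> norm (g s) * (\<Prod>\<rho>\<in>Z. R ^ m \<rho>)"
    proof (intro mult_left_mono prod_mono conjI power_mono)
      fix \<rho> assume "\<rho> \<in> Z"
      then show "norm (s - \<rho>) * (R / r) \<le> R"
        using Zr(1)[of \<rho>] R by (simp add: field_simps norm_minus_commute)
    qed (use R in auto)
    also have "\<dots> = norm (h s)" using R by (simp add: h_def us norm_mult prod_norm[symmetric] norm_power)
    finally show ?thesis .
  qed
  have RN1: "(R / r) ^ N \<ge> 1" using R qr by (intro one_le_power) simp
  have lnRr: "ln (R / r) > 0" using R qr by simp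
  show B: ?B
  proof -
    have "norm (f s) * (R / r) ^ N \<le> norm (f s) * M" using hs hb[of s] R by (simp add: mult.commute)
    then have "(R / r) ^ N \<le> M" using s by simp
    then have "ln ((R / r) ^ N) \<le> ln M" using R M by (subst ln_le_cancel_iff) auto
    then have "real N * ln (R / r) \<le> ln M" using R by (simp add: ln_realpow)
    then show ?thesis using lnRr by (simp add: N_def m_def field_simps)
  qed
  show "?C z" if z: "z \<in> cball s q" "f z \<noteq> 0" for z
  proof -
    define H where "H = (\<lambda>w. h (s + w))"
    have Hh: "H holomorphic_on ball 0 r"
    proof -
      have "(h \<circ> (\<lambda>w. s + w)) holomorphic_on ball 0 r"
        by (rule holomorphic_on_compose_gen[OF _ hh])
          (use sub in \<open>auto intro!: holomorphic_intros simp: dist_norm\<close>)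
      then show ?thesis by (simp add: H_def o_def)
    qed
    have zS: "z \<in> S" "z \<in> cball s R" using z qr f(4) by auto
    have dh: "(h has_field_derivative deriv h z) (at z)" using hh zS f by (simp add: holomorphic_derivI)
    have "(H has_field_derivative deriv h z) (at (z - s))"
      unfolding H_def using dh DERIV_shift[of h "deriv h z" "z - s" s] by (simp add: add.commute)
    then have dH: "deriv H (z - s) = deriv h z" by (rule DERIV_imp_deriv)
    have "norm (deriv H (z - s) / H (z - s)) \<le> 16 * r / (r - q)\<^sup>2 * ln M"
    proof (rule nonvanishing_log_deriv_bound[OF Hh])
      show "H w \<noteq> 0" if "w \<in> ball 0 r" for w
        unfolding H_def using that by (intro hnz) (simp add: dist_norm)
      show "norm (H w) \<le> M * norm (H 0)" if "w \<in> ball 0 r" for w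
      proof -
        have "norm (H w) \<le> M * norm (f s)"
          unfolding H_def using that qr by (intro hb) (simp add: dist_norm)
        also have "\<dots> \<le> M * norm (H 0)"
        proof -
          have "norm (f s) * 1 \<le> norm (f s) * (R / r) ^ N" using RN1 by (intro mult_left_mono) auto
          then show ?thesis using hs M by (simp add: H_def)
        qed
        finally show ?thesis .
      qed
    qed (use M qr z in \<open>auto simp: dist_norm norm_minus_commute\<close>)
    then have 1: "norm (deriv h z / h z) \<le> 16 * r / (r - q)\<^sup>2 * ln M" unfolding dH by (simp add: H_def)
    have gz: "g z \<noteq> 0" "z \<notin> Z" using z g(2)[OF zS(1)] by (auto simp: Z_def)
    define dg where "dg = deriv g z"
    have dgz: "(g has_field_derivative dg) (at z)"
      using g(1) zS f unfolding dg_def by (simp add: holomorphic_derivI)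
    have df: "deriv f z / f z = dg / g z + (\<Sum>\<rho>\<in>Z. of_nat (m \<rho>) / (z - \<rho>))"
    proof -
      have "deriv (\<lambda>w. g w * (\<Prod>\<rho>\<in>Z. (w - \<rho>) ^ m \<rho>)) z / (g z * (\<Prod>\<rho>\<in>Z. (z - \<rho>) ^ m \<rho>))
          = dg / g z + (\<Sum>\<rho>\<in>Z. of_nat (m \<rho>) * 1 / (z - \<rho>))"
        by (rule logderiv_mult_prod_power[OF fin dgz gz(1)]) (use gz in \<open>auto intro!: derivative_eq_intros\<close>)
      moreover have "deriv (\<lambda>w. g w * (\<Prod>\<rho>\<in>Z. (w - \<rho>) ^ m \<rho>)) z = deriv f z"
        by (rule deriv_cong_ev) (use g(2) zS f in \<open>auto intro!: eventually_nhds_in_open[THEN eventually_mono]\<close>)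
      ultimately show ?thesis using g(2)[OF zS(1)] by simp
    qed
    define c where "c = (\<lambda>\<rho>. - cnj (\<rho> - s) / of_real R)"
    let ?C = "\<Sum>\<rho>\<in>Z. of_nat (m \<rho>) * c \<rho> / u \<rho> z"
    have dh': "deriv h z / h z = dg / g z + ?C"
      unfolding h_def
    proof (rule logderiv_mult_prod_power[OF fin dgz gz(1)])
      show "(u \<rho> has_field_derivative c \<rho>) (at z)" for \<rho>
        unfolding u_def c_def using R by (auto intro!: derivative_eq_intros)
    qed (rule unz[OF _ zS(2)])
    have 2: "norm ?C \<le> (\<Sum>\<rho>\<in>Z. real (m \<rho>)) * (r / (R\<^sup>2 - r * q))"
      unfolding sum_distrib_right
    proof (rule sum_norm_le)
      fix \<rho> assume \<rho>: "\<rho> \<in> Z"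
      let ?v = "of_real (R\<^sup>2) - cnj (\<rho> - s) * (z - s)"
      have "c \<rho> / u \<rho> z = - cnj (\<rho> - s) / ?v" using R by (simp add: c_def u_def)
      then have "norm (c \<rho> / u \<rho> z) = norm (\<rho> - s) / norm ?v"
        by (simp only: norm_divide norm_minus_cancel complex_mod_cnj)
      also have "\<dots> \<le> r / (R\<^sup>2 - r * q)"
        using Zr(1)[OF \<rho>] ulow[OF \<rho>, of z q] z Rr R
        by (intro frac_le) (auto simp: dist_norm norm_minus_commute)
      finally have "norm (c \<rho> / u \<rho> z) \<le> r / (R\<^sup>2 - r * q)" .
      then have "real (m \<rho>) * norm (c \<rho> / u \<rho> z) \<le> real (m \<rho>) * (r / (R\<^sup>2 - r * q))"
        by (intro mult_left_mono) auto
      then show "norm (of_nat (m \<rho>) * c \<rho> / u \<rho> z) \<le> real (m \<rho>) * (r / (R\<^sup>2 - r * q))"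
        by (simp only: times_divide_eq_right[symmetric] norm_mult norm_of_nat)
    qed
    have 3: "(\<Sum>\<rho>\<in>Z. real (m \<rho>)) * (r / (R\<^sup>2 - r * q)) \<le> ln M / ln (R / r) * (r / (R\<^sup>2 - r * q))"
      using B Rr R unfolding m_def by (intro mult_right_mono) auto
    have "deriv f z / f z - (\<Sum>\<rho>\<in>Z. of_nat (m \<rho>) / (z - \<rho>))
       = deriv h z / h z - ?C"
      unfolding df dh' by simp
    then have "norm (deriv f z / f z - (\<Sum>\<rho>\<in>Z. of_nat (m \<rho>) / (z - \<rho>)))
       \<le> norm (deriv h z / h z) + norm ?C"
      by (metis norm_triangle_ineq4)
    also have "\<dots> \<le> 16 * r / (r - q)\<^sup>2 * ln M + ln M / ln (R / r) * (r / (R\<^sup>2 - r * q))"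
      using 1 2 3 by linarith
    also have "\<dots> = (16 * r / (r - q)\<^sup>2 + r / (R\<^sup>2 - r * q) / ln (R / r)) * ln M"
      by (simp add: algebra_simps)
    finally show ?thesis unfolding m_def .
  qed
qed

section \<open>The logarithmic derivative of the zeta function as a Dirichlet series\<close>

abbreviation (input) npow :: "nat \<Rightarrow> complex \<Rightarrow> complex" where
  "npow n s \<equiv> of_nat n powr (- s)"

lemma norm_nat_powr: "norm (npow n s :: complex) = real n powr (- Re s)"
  using norm_powr_real_powr[of "of_nat n" "- s"] by simp

lemma summable_ln_powr:
  assumes "c > (1::real)"
  shows "summable (\<lambda>n. ln (real n) * real n powr (- c))"
proof (rule summable_comparison_test')
  define e where "e = (c - 1) / 2"
  have e: "e > 0" using assms by (simp add: e_def)
  show "summable (\<lambda>n. 1 / e * real n powr (e - c))"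
    using assms by (intro summable_mult) (simp add: summable_real_powr_iff e_def field_simps)
  fix n :: nat assume n: "n \<ge> 1"
  have "norm (ln (real n) * real n powr (- c)) = ln (real n) * real n powr (- c)" using n by simp
  also have "\<dots> \<le> real n powr e / e * real n powr (- c)"
    using n e by (intro mult_right_mono ln_powr_bound) auto
  also have "\<dots> = 1 / e * real n powr (e - c)" using n by (simp add: powr_add[symmetric] flip: powr_diff)
  finally show "norm (ln (real n) * real n powr (- c)) \<le> 1 / e * real n powr (e - c)" .
qed

lemma Dirichlet_series_summable:
  fixes a :: "nat \<Rightarrow> complex"
  assumes "\<And>c. c > 1 \<Longrightarrow> summable (\<lambda>n. norm (a n) * real n powr (- c))" "Re s > 1"
  shows "summable (\<lambda>n. norm (a n * npow n s))"
  using assms(1)[OF assms(2)] by (simp add: norm_mult norm_nat_powr)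

lemma Dirichlet_series_deriv:
  fixes a :: "nat \<Rightarrow> complex"
  assumes a: "\<And>c. c > 1 \<Longrightarrow> summable (\<lambda>n. norm (a n) * real n powr (- c))" and s: "Re s > 1"
  shows "((\<lambda>s. \<Sum>n. a n * npow n s) has_field_derivative
      (\<Sum>n. a n * (- of_real (ln (real n)) * npow n s))) (at s)"
proof -
  have "\<exists>g g'. \<forall>x\<in>{s. Re s > 1}. (\<lambda>n. a n * npow n x) sums g x \<and>
      (\<lambda>n. a n * (- of_real (ln (real n)) * npow n x)) sums g' x \<and>
      (g has_field_derivative g' x) (at x)"
  proof (rule series_and_derivative_comparison_complex)
    show "open {s. Re s > 1}" by (rule open_halfspace_Re_gt)
    show "((\<lambda>x. a n * npow n x) has_field_derivative
        a n * (- of_real (ln (real n)) * npow n x)) (at x)" for n x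
    proof (cases "n = 0")
      case False
      then have "((\<lambda>x. npow n x) has_field_derivative
          (- of_real (ln (real n)) * npow n x)) (at x)"
        using DERIV_chain2[OF has_field_derivative_powr_right[of "of_nat n" "- x"] DERIV_minus[OF DERIV_ident]]
        by (simp add: Ln_of_nat)
      then show ?thesis by (rule DERIV_cmult)
    qed simp
    fix x assume x: "x \<in> {s. Re s > 1}"
    define d where "d = (Re x - 1) / 2"
    have d: "d > 0" using x by (simp add: d_def)
    show "\<exists>d h. 0 < d \<and> summable h \<and> range h \<subseteq> \<real>\<^sub>\<ge>\<^sub>0 \<and>
       (\<forall>\<^sub>F n in sequentially. \<forall>y\<in>ball x d \<inter> {s. Re s > 1}. cmod (a n * npow n y) \<le> cmod (h n))"
    proof (rule exI[of _ d], rule exI[of _ "\<lambda>n. of_real (norm (a n) * real n powr (- (1 + d)))"], intro conjI d)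
      show "summable (\<lambda>n. of_real (norm (a n) * real n powr (- (1 + d))) :: complex)"
        using a[of "1 + d"] d by (intro summable_of_real) auto
      show "range (\<lambda>n. of_real (norm (a n) * real n powr (- (1 + d))) :: complex) \<subseteq> \<real>\<^sub>\<ge>\<^sub>0"
        by (auto simp: nonneg_Reals_of_real_iff simp del: of_real_mult)
      show "\<forall>\<^sub>F n in sequentially. \<forall>y\<in>ball x d \<inter> {s. Re s > 1}. cmod (a n * npow n y)
         \<le> cmod (of_real (norm (a n) * real n powr (- (1 + d))) :: complex)"
      proof (intro eventually_sequentiallyI[of 1] ballI)
        fix n :: nat and y assume n: "n \<ge> 1" and y: "y \<in> ball x d \<inter> {s. Re s > 1}"
        have "\<bar>Re (x - y)\<bar> < d" using y abs_Re_le_cmod[of "x - y"] by (auto simp: dist_norm)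
        moreover have "Re x = 1 + 2 * d" by (simp add: d_def field_simps)
        ultimately have "Re y \<ge> 1 + d" by simp
        then have "real n powr (- Re y) \<le> real n powr (- (1 + d))" using n by (intro powr_mono) auto
        then show "cmod (a n * npow n y) \<le> cmod (of_real (norm (a n) * real n powr (- (1 + d))) :: complex)"
          unfolding norm_of_real by (auto simp: norm_mult norm_nat_powr intro!: mult_left_mono)
      qed
    qed
  qed
  then obtain g g' where g: "\<And>x. Re x > 1 \<Longrightarrow> (\<lambda>n. a n * npow n x) sums g x"
      "\<And>x. Re x > 1 \<Longrightarrow> (\<lambda>n. a n * (- of_real (ln (real n)) * npow n x)) sums g' x"
      "\<And>x. Re x > 1 \<Longrightarrow> (g has_field_derivative g' x) (at x)" by auto
  have "((\<lambda>s. \<Sum>n. a n * npow n s) has_field_derivative g' s) (at s)"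
    by (rule has_field_derivative_transform_within_open[OF g(3)[OF s] open_halfspace_Re_gt[of 1]])
       (use s g(1) in \<open>auto simp: sums_iff\<close>)
  moreover have "g' s = (\<Sum>n. a n * (- of_real (ln (real n)) * npow n s))"
    using g(2)[OF s] by (simp add: sums_iff)
  ultimately show ?thesis by simp
qed

lemma summable_nat_powr_neg: "c > 1 \<Longrightarrow> summable (\<lambda>n. real n powr (- c))"
  by (simp add: summable_real_powr_iff)

lemma zeta_sums: "(\<lambda>n. npow n s) sums zeta s" if "Re s > 1"
proof -
  have "(\<lambda>n. 1 / of_nat (Suc n) powr s) sums zeta s"
    using zeta_continuation_zeta that by (auto simp: zeta_continuation_def)
  then have "(\<lambda>n. npow (Suc n) s) sums zeta s" by (simp add: powr_minus field_simps)
  then show ?thesis using sums_Suc_iff[of "\<lambda>n. npow n s :: complex" "zeta s"] by simp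
qed

definition mangoldt_series :: "complex \<Rightarrow> complex" where
  "mangoldt_series s = (\<Sum>n. mangoldt n * npow n s)"

lemma summable_mangoldt_powr: "c > 1 \<Longrightarrow> summable (\<lambda>n. mangoldt n * real n powr (- c))"
proof (rule summable_comparison_test'[OF summable_ln_powr])
  fix n :: nat assume "n \<ge> 1"
  then show "norm (mangoldt n * real n powr (- c)) \<le> ln (real n) * real n powr (- c)"
    using mangoldt_le[of n] mangoldt_nonneg[of n] by (auto simp: abs_mult intro!: mult_right_mono)
qed

lemma mangoldt_series_sums:
  assumes "Re s > 1"
  shows "(\<lambda>n. mangoldt n * npow n s) sums mangoldt_series s"
proof -
  have "summable (\<lambda>n. norm (mangoldt n * npow n s :: complex))"
    by (rule Dirichlet_series_summable[OF _ assms]) (simp add: summable_mangoldt_powr)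
  then show ?thesis unfolding mangoldt_series_def by (rule summable_sums[OF summable_norm_cancel])
qed

text \<open>The identity behind this is that \<open>mangoldt\<close> summed over the divisors of n
  gives ln n. Both series converge absolutely, so their product may be summed over pairs (d, k) and
  regrouped by n = d k.\<close>

lemma mangoldt_series_convolution:
  assumes s: "Re s > 1"
  shows "(\<lambda>n. of_real (ln (real n)) * npow n s) sums (mangoldt_series s * zeta s)"
proof -
  define a where "a = (\<lambda>n::nat. mangoldt n * npow n s :: complex)"
  define b where "b = (\<lambda>n::nat. npow n s :: complex)"
  have na: "summable (\<lambda>n. norm (a n))"
    using Dirichlet_series_summable[of "mangoldt" s] summable_mangoldt_powr s by (simp add: a_def)
  have nb: "summable (\<lambda>n. norm (b n))"
    using summable_nat_powr_neg s by (simp add: b_def norm_nat_powr)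
  have a: "(a has_sum mangoldt_series s) UNIV"
    by (rule norm_summable_imp_has_sum[OF na]) (use mangoldt_series_sums[OF s] in \<open>simp add: a_def\<close>)
  have b: "(b has_sum zeta s) UNIV"
    by (rule norm_summable_imp_has_sum[OF nb]) (use zeta_sums[OF s] in \<open>simp add: b_def\<close>)
  have "((\<lambda>(d, k). a d * b k) has_sum (mangoldt_series s * zeta s)) (UNIV \<times> UNIV)"
  proof (rule has_sum_SigmaI)
    show "((\<lambda>k. (case (d, k) of (d, k) \<Rightarrow> a d * b k)) has_sum (a d * zeta s)) UNIV" for d
      using has_sum_cmult_right[OF b, of "a d"] by simp
    show "((\<lambda>d. a d * zeta s) has_sum (mangoldt_series s * zeta s)) UNIV"
      by (rule has_sum_cmult_left[OF a])
    have "(\<lambda>p. norm (case p of (d, k) \<Rightarrow> a d * b k)) summable_on UNIV \<times> UNIV"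
      unfolding Infinite_Sum.abs_summable_on_Sigma_iff
    proof (intro conjI ballI)
      show "(\<lambda>k. norm (case (d, k) of (d, k) \<Rightarrow> a d * b k)) summable_on UNIV" for d
        using summable_mult[OF nb, of "norm (a d)"]
        by (simp add: norm_mult summable_on_UNIV_nonneg_real_iff)
      have "infsum (\<lambda>k. norm (case (d, k) of (d, k) \<Rightarrow> a d * b k)) UNIV = norm (a d) * infsum (\<lambda>k. norm (b k)) UNIV" for d
        by (simp add: norm_mult infsum_cmult_right')
      then show "(\<lambda>d. norm (infsum (\<lambda>k. norm (case (d, k) of (d, k) \<Rightarrow> a d * b k)) UNIV)) summable_on UNIV"
        using summable_mult2[OF na, of "infsum (\<lambda>k. norm (b k)) UNIV"]
        by (simp add: norm_mult summable_on_UNIV_nonneg_real_iff infsum_nonneg)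
    qed
    then show "(\<lambda>(d, k). a d * b k) summable_on UNIV \<times> UNIV" by (rule abs_summable_summable)
  qed
  \<comment> \<open>Terms of index 0 vanish since 0 powr (- s) is 0. They are removed first because
    (d, k) can be recovered from (d k, d) only for positive indices.\<close>
  then have "((\<lambda>(d, k). a d * b k) has_sum (mangoldt_series s * zeta s)) ({0<..} \<times> {0<..})"
    by (rule has_sum_cong_neutral[THEN iffD1, rotated 3]) (auto simp: a_def b_def)
  then have "((\<lambda>(n, d). mangoldt d * b n) has_sum (mangoldt_series s * zeta s)) (Sigma {0<..} (\<lambda>n. {d. d dvd n}))"
  proof (rule has_sum_reindex_bij_witness[where i = "\<lambda>(n, d). (d, n div d)" and j = "\<lambda>(d, k). (d * k, d)", THEN iffD1, rotated 6])
    show "(case (case p of (d, k) \<Rightarrow> (d * k, d)) of (n, d) \<Rightarrow> mangoldt d * b n) = (case p of (d, k) \<Rightarrow> a d * b k)"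
      if "p \<in> {0<..} \<times> {0<..}" for p
      using powr_times_real[of "of_nat (fst p)" "of_nat (snd p)" "- s"]
      by (auto simp: a_def b_def case_prod_unfold)
  qed (auto simp: dvd_div_eq_0_iff intro!: Nat.gr0I)
  then have "((\<lambda>n. of_real (ln (real n)) * b n) has_sum (mangoldt_series s * zeta s)) {0<..}"
  proof (rule has_sum_SigmaD)
    fix n :: nat assume n: "n \<in> {0<..}"
    have "((\<lambda>d. mangoldt d * b n) has_sum (\<Sum>d | d dvd n. mangoldt d * b n)) {d. d dvd n}"
      using n by (intro has_sum_finite) auto
    then show "((\<lambda>d. case (n, d) of (n, d) \<Rightarrow> mangoldt d * b n) has_sum of_real (ln (real n)) * b n) {d. d dvd n}"
      using mangoldt_sum[of n, where ?'a = complex] n by (simp add: sum_distrib_right[symmetric])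
  qed
  then have "((\<lambda>n. of_real (ln (real n)) * b n) has_sum (mangoldt_series s * zeta s)) UNIV"
    by (rule has_sum_cong_neutral[THEN iffD1, rotated 3]) (auto simp: b_def)
  then show ?thesis unfolding b_def by (rule has_sum_imp_sums)
qed

lemma zeta_deriv_mangoldt:
  assumes s: "Re s > 1"
  shows "(zeta has_field_derivative - mangoldt_series s * zeta s) (at s)"
proof -
  have "((\<lambda>s. \<Sum>n. 1 * npow n s) has_field_derivative
      (\<Sum>n. 1 * (- of_real (ln (real n)) * npow n s))) (at s)"
    by (rule Dirichlet_series_deriv[of "\<lambda>_. 1", OF _ s]) (simp add: summable_nat_powr_neg)
  moreover have "(\<Sum>n. 1 * (- of_real (ln (real n)) * npow n s)) = - mangoldt_series s * zeta s"
    using sums_minus[OF mangoldt_series_convolution[OF s]] by (simp add: sums_iff)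
  ultimately have "((\<lambda>s. \<Sum>n. 1 * npow n s) has_field_derivative - mangoldt_series s * zeta s) (at s)"
    by simp
  then show ?thesis
    by (rule has_field_derivative_transform_within_open[OF _ open_halfspace_Re_gt[of 1]])
       (use s zeta_sums in \<open>auto simp: sums_iff\<close>)
qed

text \<open>Replacing 1/m^2 by 1/(m^2 - 1/4) = 1/(m - 1/2) - 1/(m + 1/2) makes the tail over m >= 2
  telescope to 2/3; \<open>h n\<close> is 1/(m - 1/2) at m = n + 2. A lower bound uniform in the
  height makes 2 + it a good centre for the discs in Landau's expansion.\<close>

lemma norm_zeta_Re_2_ge: "norm (zeta s) \<ge> 1/3" if "Re s = 2"
proof -
  define h where "h = (\<lambda>n::nat. 2 / (2 * real n + 3))"
  have "(\<lambda>n. h n - h (Suc n)) sums (h 0 - 0)"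
    by (rule telescope_sums') (unfold h_def, real_asymp)
  then have hs: "(\<lambda>n. h n - h (Suc n)) sums (2/3)" by (simp add: h_def)
  have le: "norm (of_nat (Suc (Suc n)) powr (- s) :: complex) \<le> h n - h (Suc n)" for n
  proof -
    have "norm (of_nat (Suc (Suc n)) powr (- s) :: complex) = 1 / (real n + 2) ^ 2"
      unfolding norm_nat_powr that
      by (simp add: powr_minus powr_numeral inverse_eq_divide add.commute)
    also have "\<dots> \<le> 4 / ((2 * real n + 3) * (2 * real n + 5))"
      by (simp add: divide_simps power2_eq_square) (simp add: algebra_simps)
    also have "\<dots> = h n - h (Suc n)" by (simp add: h_def field_simps)
    finally show ?thesis .
  qed
  have "(\<lambda>n. of_nat (Suc (Suc n)) powr (- s)) sums (zeta s - 1)"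
    using zeta_sums[of s] that by (subst sums_Suc_iff) (subst sums_Suc_iff, simp)
  then have "norm (zeta s - 1) \<le> 2/3"
    using hs le by (metis (no_types, lifting) norm_suminf_le sums_iff)
  then show ?thesis using norm_triangle_ineq2[of 1 "1 - zeta s"] by (simp add: norm_minus_commute)
qed

text \<open>The relation of \<open>zeta_deriv_mangoldt\<close> holds without dividing by zeta. It
  makes zeta times the exponential of a primitive of \<open>mangoldt_series\<close> constant, and
  the value at 2 shows that this constant is not 0. No Euler product is involved.\<close>

lemma zeta_nonzero_Re_gt_1:
  assumes s: "Re s > 1"
  shows "zeta s \<noteq> 0"
proof -
  let ?H = "{s. Re s > 1}"
  have "mangoldt_series holomorphic_on ?H"
  proof -
    have "\<exists>D. (mangoldt_series has_field_derivative D) (at z)" if "Re z > 1" for z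
      using Dirichlet_series_deriv[of "mangoldt" z] summable_mangoldt_powr that
      unfolding mangoldt_series_def[abs_def] by auto
    then show ?thesis by (subst holomorphic_on_open) (auto simp: open_halfspace_Re_gt)
  qed
  then obtain E where E: "\<And>x. x \<in> ?H \<Longrightarrow> (E has_field_derivative mangoldt_series x) (at x within ?H)"
    using holomorphic_convex_primitive'[of ?H mangoldt_series] convex_halfspace_Re_gt open_halfspace_Re_gt by metis
  have "((\<lambda>x. zeta x * exp (E x)) has_field_derivative 0) (at x within ?H)" if "x \<in> ?H" for x
  proof -
    have z: "(zeta has_field_derivative - mangoldt_series x * zeta x) (at x within ?H)"
      using zeta_deriv_mangoldt that by (auto intro: has_field_derivative_at_within)
    have e: "((\<lambda>x. exp (E x)) has_field_derivative exp (E x) * mangoldt_series x) (at x within ?H)"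
      using E[OF that] by (auto intro!: derivative_eq_intros)
    show ?thesis using DERIV_mult'[OF z e] by (simp add: algebra_simps)
  qed
  then have "\<exists>c. \<forall>x\<in>?H. zeta x * exp (E x) = c"
    by (rule has_field_derivative_zero_constant[OF convex_halfspace_Re_gt])
  then obtain c where c: "\<And>x. x \<in> ?H \<Longrightarrow> zeta x * exp (E x) = c" by auto
  have "c \<noteq> 0" using c[of 2] norm_zeta_Re_2_ge[of 2] by auto
  then show ?thesis using c[of s] s by auto
qed

section \<open>The function (s - 1) zeta(s) on Re s > 0, holomorphic also at s = 1\<close>

definition zeta_reg :: "complex \<Rightarrow> complex" where
  "zeta_reg s = 1 - (\<Sum>n. zR 1 n s)"

lemma zeta_reg_holomorphic: "zeta_reg holomorphic_on {s. Re s > 0}"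
  unfolding zeta_reg_def[abs_def]
  using zeta_remainder_holomorphic[of 1] unfolding of_nat_1 diff_self
  by (rule holomorphic_on_diff[OF holomorphic_on_const])

lemma zeta_reg_1: "zeta_reg 1 = 1"
  by (simp add: zeta_reg_def del: of_nat_Suc)

lemma zeta_reg_eq: "zeta_reg s = (s - 1) * zeta s" if "Re s > 0" "s \<noteq> 1"
proof (rule analytic_continuation_open[of "{s. Re s > 1}" "{s. Re s > 0} - {1}" zeta_reg "\<lambda>s. (s - 1) * zeta s"])
  show "{s. Re s > 1} \<noteq> {}" by (auto intro!: exI[of _ "2::complex"])
  show "connected ({s. Re s > 0} - {1})"
    by (rule connected_open_delete) (auto simp: open_halfspace_Re_gt intro!: convex_connected convex_halfspace_Re_gt)
  show "zeta_reg holomorphic_on {s. Re s > 0} - {1}"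
    by (rule holomorphic_on_subset[OF zeta_reg_holomorphic]) auto
  have "zeta holomorphic_on - {1}" using zeta_continuation_zeta by (simp add: zeta_continuation_def)
  then show "(\<lambda>s. (s - 1) * zeta s) holomorphic_on {s. Re s > 0} - {1}"
    by (intro holomorphic_on_mult holomorphic_on_diff holomorphic_on_ident holomorphic_on_const)
       (erule holomorphic_on_subset, auto)
  fix z assume z: "z \<in> {s. Re s > 1}"
  then have "zeta z = zD z"
    using zeta_series_sums[of z] zeta_sums[of z] sums_Suc_iff[of "\<lambda>n. npow n z :: complex" "zeta z"]
    by (auto intro: sums_unique2)
  then show "zeta_reg z = (z - 1) * zeta z"
    using zeta_remainder_sum[of z 1] z by (simp add: zeta_reg_def)
qed (use that in \<open>auto simp: open_halfspace_Re_gt\<close>)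

text \<open>The strip contains all discs of radius 15/8 about points 2 + it, and 9/8 is the decay
  exponent of the remainder series at its left edge. The quadratic growth is that of the factor s (s
  - 1) in the remainder of order 1; later it enters through its logarithm only.\<close>

lemma zeta_reg_bound: "\<exists>C>0. \<forall>s. 1/8 \<le> Re s \<and> Re s \<le> 4 \<longrightarrow> norm (zeta_reg s) \<le> C * (4 + \<bar>Im s\<bar>)\<^sup>2"
proof -
  define B where "B = (\<Sum>n. real (Suc n) powr (- (9/8)))"
  have sB: "summable (\<lambda>n. real (Suc n) powr (- (9/8)))"
    by (subst summable_Suc_iff) (simp add: summable_real_powr_iff)
  have B0: "B \<ge> 0" unfolding B_def by (intro suminf_nonneg sB) auto
  have "norm (zeta_reg s) \<le> (1 + 64 * B) * (4 + \<bar>Im s\<bar>)\<^sup>2" if s: "1/8 \<le> Re s" "Re s \<le> 4" for s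
  proof -
    define w where "w = 4 + \<bar>Im s\<bar>"
    have w: "w \<ge> 1" by (simp add: w_def)
    have ns: "norm s \<le> w" using cmod_le[of s] s by (simp add: w_def)
    have n1: "norm (1 - s) \<le> w" using cmod_le[of "1 - s"] s by (simp add: w_def)
    have le: "norm (zR 1 n s) \<le> 64 * w\<^sup>2 * real (Suc n) powr (- (9/8))" for n
    proof -
      have "norm (zR 1 n s) \<le> norm (\<Prod>i<Suc 1. 1 - s - of_nat i) * 2 powr \<bar>Re (1 - s) - real (Suc 1)\<bar>
        * real (Suc n) powr (- Re s - real 1)" by (rule zeta_remainder_bound)
      also have "norm (\<Prod>i<Suc 1. 1 - s - of_nat i) = norm (1 - s) * norm s"
        by (simp add: numeral_2_eq_2 norm_mult)
      also have "norm (1 - s) * norm s * 2 powr \<bar>Re (1 - s) - real (Suc 1)\<bar> * real (Suc n) powr (- Re s - real 1)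
         \<le> w * w * 2 powr 6 * real (Suc n) powr (- (9/8))"
        using s ns n1 w by (intro mult_mono powr_mono) auto
      also have "w * w * 2 powr 6 * real (Suc n) powr (- (9/8)) = 64 * w\<^sup>2 * real (Suc n) powr (- (9/8))"
        using powr_realpow[of 2 6] by (simp add: power2_eq_square)
      finally show ?thesis .
    qed
    have "norm (\<Sum>n. zR 1 n s) \<le> (\<Sum>n. 64 * w\<^sup>2 * real (Suc n) powr (- (9/8)))"
      by (intro norm_suminf_le le summable_mult sB)
    also have "\<dots> = 64 * w\<^sup>2 * B" unfolding B_def using sB by (intro suminf_mult)
    finally have "norm (zeta_reg s) \<le> 1 + 64 * w\<^sup>2 * B"
      unfolding zeta_reg_def using norm_triangle_ineq4[of 1 "\<Sum>n. zR 1 n s"] by simp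
    also have "\<dots> \<le> w\<^sup>2 + 64 * w\<^sup>2 * B" using w by (simp add: one_le_power)
    finally show ?thesis by (simp add: algebra_simps w_def)
  qed
  then show ?thesis using B0 by (intro exI[of _ "1 + 64 * B"]) auto
qed

lemma zeta_reg_nonzero_Re_gt_1: "zeta_reg s \<noteq> 0" if "Re s > 1"
proof -
  have "s \<noteq> 1" using that by auto
  then show ?thesis using that zeta_reg_eq[of s] zeta_nonzero_Re_gt_1[of s] by simp
qed

lemma zeta_reg_log_deriv:
  assumes s: "Re s > 1"
  shows "deriv zeta_reg s / zeta_reg s = 1 / (s - 1) - mangoldt_series s"
proof -
  have s1: "s - 1 \<noteq> 0" using s by auto
  have "((\<lambda>s. (s - 1) * zeta s) has_field_derivative (s - 1) * (- mangoldt_series s * zeta s) + 1 * zeta s) (at s)"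
    by (intro DERIV_mult' zeta_deriv_mangoldt[OF s]) (auto intro!: derivative_eq_intros)
  then have "(zeta_reg has_field_derivative (s - 1) * (- mangoldt_series s * zeta s) + 1 * zeta s) (at s)"
    by (rule has_field_derivative_transform_within_open[OF _ open_halfspace_Re_gt[of 1]])
       (use s in \<open>auto intro!: zeta_reg_eq[symmetric]\<close>)
  then have "deriv zeta_reg s = (s - 1) * (- mangoldt_series s * zeta s) + 1 * zeta s" by (rule DERIV_imp_deriv)
  moreover have "zeta_reg s = (s - 1) * zeta s" using zeta_reg_eq[of s] s s1 by auto
  ultimately have "deriv zeta_reg s / zeta_reg s = ((s - 1) * (- mangoldt_series s * zeta s) + 1 * zeta s) / ((s - 1) * zeta s)"
    by metis
  also have "\<dots> = 1 / (s - 1) - mangoldt_series s"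
    using s1 zeta_nonzero_Re_gt_1[OF s] by (simp add: divide_simps) (simp add: algebra_simps)
  finally show ?thesis .
qed

section \<open>Zeros near a point of the critical strip\<close>

text \<open>Since 3 > e this is at least 1 everywhere, so that additive constants can be absorbed
  into multiples of it.\<close>

definition ell :: "real \<Rightarrow> real" where "ell t = ln (3 + \<bar>t\<bar>)"

lemma ell_ge_1: "ell t \<ge> 1"
proof -
  have "exp 1 \<le> 3 + \<bar>t\<bar>" using exp_le by linarith
  then show ?thesis unfolding ell_def by (subst ln_ge_iff) auto
qed

abbreviation (input) zeta_reg_logderiv :: "complex \<Rightarrow> complex" where
  "zeta_reg_logderiv z \<equiv> deriv zeta_reg z / zeta_reg z"

text \<open>The radius lies between 3/2, the distance from 2 + it to the critical line, and 15/8,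
  for which the disc still stays in Re s >= 1/8.\<close>

definition zeta_zeros_near :: "real \<Rightarrow> complex set" where
  "zeta_zeros_near t = {z \<in> cball (Complex 2 t) (7/4). zeta_reg z = 0}"

definition zmult :: "complex \<Rightarrow> nat" where
  "zmult \<rho> = nat (zorder zeta_reg \<rho>)"

abbreviation (input) zeros_expansion :: "real \<Rightarrow> complex \<Rightarrow> complex" where
  "zeros_expansion t z \<equiv> \<Sum>\<rho>\<in>zeta_zeros_near t. of_nat (zmult \<rho>) / (z - \<rho>)"

text \<open>Landau's expansion about 2 + it with radii 3/2 < 7/4 < 15/8. Polynomial growth of
  \<open>zeta_reg\<close> against its lower bound at the centre makes ln M a multiple of
  \<open>ell t\<close>. The inner disc touches the critical line exactly at height t, so it contains
  every point 1/2 + b + it with 0 < b <= 3/2.\<close>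

lemma zeta_reg_local_expansion:
  "\<exists>C>0. \<forall>t. finite (zeta_zeros_near t) \<and> (\<Sum>\<rho>\<in>zeta_zeros_near t. real (zmult \<rho>)) \<le> C * ell t \<and>
     (\<forall>z\<in>cball (Complex 2 t) (3/2). zeta_reg z \<noteq> 0 \<longrightarrow>
        norm (zeta_reg_logderiv z - zeros_expansion t z) \<le> C * ell t)"
proof -
  obtain C0 where C0: "C0 > 0" "\<And>s. 1/8 \<le> Re s \<Longrightarrow> Re s \<le> 4 \<Longrightarrow> norm (zeta_reg s) \<le> C0 * (4 + \<bar>Im s\<bar>)\<^sup>2"
    using zeta_reg_bound by blast
  define K1 where "K1 = 1 / ln ((15/8) / (7/4) :: real)"
  define K2 where "K2 = 16 * (7/4) / (7/4 - 3/2)\<^sup>2 + (7/4) / ((15/8)\<^sup>2 - 7/4 * (3/2)) / ln ((15/8) / (7/4) :: real)"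
  define A where "A = ln (3 * C0 + 1) + 4"
  have A: "A > 0" using C0 by (simp add: A_def add_nonneg_pos)
  have K: "K1 > 0" "K2 > 0" unfolding K1_def K2_def
    by (auto intro!: add_pos_pos divide_pos_pos simp: power2_eq_square)
  define C where "C = (K1 + K2) * A"
  have C: "C > 0" "K1 * A \<le> C" "K2 * A \<le> C" using A K by (auto simp: C_def algebra_simps add_pos_pos)
  show ?thesis
  proof (rule exI[of _ C], intro conjI allI C)
    fix t :: real
    define s where "s = Complex 2 t"
    \<comment> \<open>The 3 is the inverse of the lower bound 1/3 at the centre, and 8 exceeds 4 +
      15/8, which accounts for the imaginary parts on the circle. The added 1 ensures M > 1.\<close>
    define M where "M = (3 * C0 + 1) * (8 + \<bar>t\<bar>)\<^sup>2"
    have M1: "M > 1"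
    proof -
      have "1 * 1 < (3 * C0 + 1) * (8 + \<bar>t\<bar>)\<^sup>2" using C0(1) by (intro mult_strict_mono one_less_power) auto
      then show ?thesis by (simp add: M_def)
    qed
    have lnM: "ln M \<le> A * ell t"
    proof -
      have "8 + \<bar>t\<bar> \<le> (3 + \<bar>t\<bar>)\<^sup>2" by (simp add: power2_eq_square algebra_simps)
      then have "ln (8 + \<bar>t\<bar>) \<le> ln ((3 + \<bar>t\<bar>)\<^sup>2)" by (subst ln_le_cancel_iff) auto
      also have "\<dots> = 2 * ell t" unfolding ell_def by (subst ln_realpow) auto
      finally have 1: "ln (8 + \<bar>t\<bar>) \<le> 2 * ell t" .
      have "ln M = ln (3 * C0 + 1) + 2 * ln (8 + \<bar>t\<bar>)"
        using C0 by (simp add: M_def ln_mult ln_realpow)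
      also have "\<dots> \<le> ln (3 * C0 + 1) * ell t + 4 * ell t"
        using 1 ell_ge_1[of t] C0 by (intro add_mono) (auto simp: mult_le_cancel_left1)
      finally show ?thesis by (simp add: A_def algebra_simps)
    qed
    have fs: "norm (zeta_reg s) \<ge> 1/3"
    proof -
      have "zeta_reg s = (s - 1) * zeta s" by (rule zeta_reg_eq) (auto simp: s_def complex_eq_iff)
      moreover have "norm (s - 1) \<ge> 1" using abs_Re_le_cmod[of "s - 1"] by (simp add: s_def)
      moreover have "norm (zeta s) \<ge> 1/3" by (rule norm_zeta_Re_2_ge) (simp add: s_def)
      ultimately show ?thesis using mult_mono[of 1 "norm (s - 1)" "1/3" "norm (zeta s)"] by (simp add: norm_mult)
    qed
    have coord: "\<bar>Re z - 2\<bar> \<le> e" "\<bar>Im z - t\<bar> \<le> e" if "z \<in> cball s e" for z e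
      using that abs_Re_le_cmod[of "z - s"] abs_Im_le_cmod[of "z - s"]
      by (auto simp: dist_norm norm_minus_commute s_def)
    have bd: "norm (zeta_reg z) \<le> M * norm (zeta_reg s)" if "z \<in> sphere s (15/8)" for z
    proof -
      have zc: "z \<in> cball s (15/8)" using that by auto
      note c = coord[OF zc]
      have "norm (zeta_reg z) \<le> C0 * (4 + \<bar>Im z\<bar>)\<^sup>2" by (intro C0; use c(1) in linarith)
      also have "\<dots> \<le> C0 * (8 + \<bar>t\<bar>)\<^sup>2" using c(2) C0(1) by (intro mult_left_mono power_mono; linarith)
      also have "\<dots> \<le> M * (1/3)" by (simp add: M_def algebra_simps)
      also have "\<dots> \<le> M * norm (zeta_reg s)" using fs M1 by (intro mult_left_mono) auto
      finally show ?thesis .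
    qed
    have sub: "cball s (15/8) \<subseteq> {s. Re s > 0}"
    proof
      fix z assume "z \<in> cball s (15/8)"
      then show "z \<in> {s. Re s > 0}" using coord(1)[of z "15/8"] unfolding mem_Collect_eq by linarith
    qed
    note L = Landau_log_deriv[OF zeta_reg_holomorphic open_halfspace_Re_gt convex_connected[OF convex_halfspace_Re_gt]
        sub, of M "3/2" "7/4", folded zmult_def]
    have nz: "zeta_reg s \<noteq> 0" using fs by auto
    show "finite (zeta_zeros_near t)"
      unfolding zeta_zeros_near_def s_def[symmetric] by (rule L(1)) (use nz bd M1 in auto)
    have "(\<Sum>\<rho>\<in>zeta_zeros_near t. real (zmult \<rho>)) \<le> ln M / ln ((15/8) / (7/4))"
      unfolding zeta_zeros_near_def s_def[symmetric] by (rule L(2)) (use nz bd M1 in auto)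
    also have "\<dots> = K1 * ln M" by (simp add: K1_def)
    also have "\<dots> \<le> K1 * (A * ell t)" using lnM K by (intro mult_left_mono) auto
    also have "\<dots> \<le> C * ell t" using C ell_ge_1[of t] by (simp add: mult_right_mono flip: mult.assoc)
    finally show "(\<Sum>\<rho>\<in>zeta_zeros_near t. real (zmult \<rho>)) \<le> C * ell t" .
    show "\<forall>z\<in>cball (Complex 2 t) (3/2). zeta_reg z \<noteq> 0 \<longrightarrow>
        norm (zeta_reg_logderiv z - zeros_expansion t z) \<le> C * ell t"
    proof (intro ballI impI)
      fix z assume z: "z \<in> cball (Complex 2 t) (3/2)" "zeta_reg z \<noteq> 0"
      have "norm (zeta_reg_logderiv z - zeros_expansion t z) \<le> K2 * ln M"
        unfolding zeta_zeros_near_def s_def[symmetric] K2_def by (rule L(3)) (use nz bd M1 z in \<open>auto simp: s_def\<close>)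
      also have "\<dots> \<le> K2 * (A * ell t)" using lnM K by (intro mult_left_mono) auto
      also have "\<dots> \<le> C * ell t" using C ell_ge_1[of t] by (simp add: mult_right_mono flip: mult.assoc)
      finally show "norm (zeta_reg_logderiv z - zeros_expansion t z) \<le> C * ell t" .
    qed
  qed
qed

lemma zmult_pos:
  assumes "Re \<rho> > 0" "zeta_reg \<rho> = 0"
  shows "zmult \<rho> > 0"
proof -
  have "\<exists>w\<in>{s. Re s > 0}. zeta_reg w \<noteq> 0" using zeta_reg_1 by (intro bexI[of _ 1]) auto
  then have "zorder zeta_reg \<rho> > 0"
    using zorder_exist_zero[OF zeta_reg_holomorphic open_halfspace_Re_gt convex_connected[OF convex_halfspace_Re_gt], of \<rho>]
      assms by auto
  then show ?thesis by (simp add: zmult_def)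
qed

lemma Re_inverse_nonneg: "Re z \<ge> 0 \<Longrightarrow> Re (of_nat m / z) \<ge> 0"
  by (simp add: Re_divide)

lemma zeta_zeros_near_Re: "\<rho> \<in> zeta_zeros_near t \<Longrightarrow> Re \<rho> > 0 \<and> Re \<rho> \<le> 1 \<and> zeta_reg \<rho> = 0"
proof -
  assume \<rho>: "\<rho> \<in> zeta_zeros_near t"
  then have "\<bar>Re \<rho> - 2\<bar> \<le> 7/4"
    using abs_Re_le_cmod[of "\<rho> - Complex 2 t"] by (auto simp: zeta_zeros_near_def dist_norm norm_minus_commute)
  moreover have "\<not> Re \<rho> > 1" using \<rho> zeta_reg_nonzero_Re_gt_1[of \<rho>] by (auto simp: zeta_zeros_near_def)
  ultimately show ?thesis using \<rho> by (auto simp: zeta_zeros_near_def)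
qed

text \<open>Unconditionally all zeros have real part at most 1 < \<sigma>, so each term of the
  expansion has nonnegative real part. Dropping all of them gives the first bound; keeping a zero at
  1 + it gives the second.\<close>

lemma Re_zeta_reg_log_deriv_ge:
  "\<exists>C>0. \<forall>\<sigma> t. 1 < \<sigma> \<longrightarrow> \<sigma> \<le> 2 \<longrightarrow>
     Re (zeta_reg_logderiv (Complex \<sigma> t)) \<ge> - C * ell t \<and>
     (zeta_reg (Complex 1 t) = 0 \<longrightarrow>
       Re (zeta_reg_logderiv (Complex \<sigma> t)) \<ge> 1 / (\<sigma> - 1) - C * ell t)"
proof -
  obtain C where C: "C > 0" "\<And>t. finite (zeta_zeros_near t)"
    "\<And>t z. z \<in> cball (Complex 2 t) (3/2) \<Longrightarrow> zeta_reg z \<noteq> 0 \<Longrightarrow>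
        norm (zeta_reg_logderiv z - zeros_expansion t z) \<le> C * ell t"
    using zeta_reg_local_expansion by blast
  show ?thesis
  proof (rule exI[of _ C], intro conjI allI impI C)
    fix \<sigma> t :: real assume \<sigma>: "1 < \<sigma>" "\<sigma> \<le> 2"
    define z where "z = Complex \<sigma> t"
    define S where "S = (\<Sum>\<rho>\<in>zeta_zeros_near t. Re (of_nat (zmult \<rho>) / (z - \<rho>)))"
    have "norm (Complex 2 t - z) = 2 - \<sigma>" using \<sigma> by (simp add: z_def cmod_def)
    then have zin: "z \<in> cball (Complex 2 t) (3/2)" using \<sigma> by (simp add: dist_norm)
    have nz: "zeta_reg z \<noteq> 0" using \<sigma> by (intro zeta_reg_nonzero_Re_gt_1) (simp add: z_def)
    have ge: "Re (zeta_reg_logderiv z) \<ge> S - C * ell t"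
      using C(3)[OF zin nz] abs_Re_le_cmod[of "zeta_reg_logderiv z - zeros_expansion t z"]
      by (simp add: S_def)
    have pos: "Re (of_nat (zmult \<rho>) / (z - \<rho>)) \<ge> 0" if "\<rho> \<in> zeta_zeros_near t" for \<rho>
      using zeta_zeros_near_Re[OF that] \<sigma> by (intro Re_inverse_nonneg) (simp add: z_def)
    have "S \<ge> 0" unfolding S_def using pos by (rule sum_nonneg)
    then show "Re (zeta_reg_logderiv (Complex \<sigma> t)) \<ge> - C * ell t"
      using ge by (simp add: z_def)
    assume zero: "zeta_reg (Complex 1 t) = 0"
    have mem: "Complex 1 t \<in> zeta_zeros_near t"
      using zero by (simp add: zeta_zeros_near_def dist_norm cmod_def)
    have "1 / (\<sigma> - 1) \<le> real (zmult (Complex 1 t)) / (\<sigma> - 1)"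
      using zmult_pos[OF _ zero] \<sigma> by (intro divide_right_mono) (auto simp: Suc_le_eq simp flip: One_nat_def)
    also have "\<dots> = Re (of_nat (zmult (Complex 1 t)) / (z - Complex 1 t))"
    proof -
      have "z - Complex 1 t = of_real (\<sigma> - 1)" by (simp add: z_def complex_eq_iff)
      then show ?thesis by (simp only: Re_divide_of_real) simp
    qed
    also have "\<dots> \<le> S" unfolding S_def by (rule member_le_sum[OF mem]) (use pos C in auto)
    finally show "Re (zeta_reg_logderiv (Complex \<sigma> t)) \<ge> 1 / (\<sigma> - 1) - C * ell t"
      using ge by (simp add: z_def)
  qed
qed

section \<open>Nonvanishing on the line Re s = 1 and Mertens' upper bound\<close>

lemma Re_mangoldt_series:
  assumes "\<sigma> > 1"
  shows "(\<lambda>n. mangoldt n * real n powr (- \<sigma>) * cos (t * ln (real n))) sums Re (mangoldt_series (Complex \<sigma> t))"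
proof -
  have eq: "Re (mangoldt n * npow n (Complex \<sigma> t)) = mangoldt n * real n powr (- \<sigma>) * cos (t * ln (real n))" for n
  proof (cases "n = 0")
    case False
    then have "(npow n (Complex \<sigma> t) :: complex) = exp (- Complex \<sigma> t * of_real (ln (real n)))"
      by (simp add: powr_def Ln_of_nat)
    then have "Re (npow n (Complex \<sigma> t) :: complex) = real n powr (- \<sigma>) * cos (t * ln (real n))"
      using False by (simp add: Re_exp powr_def)
    moreover have "Re (mangoldt n * w) = mangoldt n * Re w" for w :: complex by simp
    ultimately show ?thesis by simp
  qed simp
  show ?thesis using sums_Re[OF mangoldt_series_sums[of "Complex \<sigma> t"]] assms unfolding eq by simp
qed

text \<open>Termwise this is 3 + 4 cos u + cos 2u = 2 (1 + cos u)^2 with u = t ln n.\<close>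

lemma mangoldt_series_341:
  assumes "\<sigma> > 1"
  shows "3 * Re (mangoldt_series (Complex \<sigma> 0)) + 4 * Re (mangoldt_series (Complex \<sigma> t))
    + Re (mangoldt_series (Complex \<sigma> (2 * t))) \<ge> 0"
proof -
  let ?f = "\<lambda>t n. mangoldt n * real n powr (- \<sigma>) * cos (t * ln (real n))"
  have "(\<lambda>n. 3 * ?f 0 n + 4 * ?f t n + ?f (2 * t) n) sums (3 * Re (mangoldt_series (Complex \<sigma> 0))
      + 4 * Re (mangoldt_series (Complex \<sigma> t)) + Re (mangoldt_series (Complex \<sigma> (2 * t))))"
    by (intro sums_add sums_mult Re_mangoldt_series assms)
  moreover have "3 * ?f 0 n + 4 * ?f t n + ?f (2 * t) n \<ge> 0" for n
  proof -
    define c where "c = cos (t * ln (real n))"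
    have "cos (2 * t * ln (real n)) = 2 * c\<^sup>2 - 1" using cos_double_cos[of "t * ln (real n)"] by (simp add: c_def mult.assoc)
    then have "3 * ?f 0 n + 4 * ?f t n + ?f (2 * t) n = mangoldt n * real n powr (- \<sigma>) * (2 * (1 + c)\<^sup>2)"
      unfolding c_def[symmetric] by (simp add: power2_eq_square) (simp add: algebra_simps)
    also have "\<dots> \<ge> 0" by (intro mult_nonneg_nonneg mangoldt_nonneg) auto
    finally show ?thesis .
  qed
  ultimately show ?thesis by (metis (no_types, lifting) sums_le sums_zero)
qed

text \<open>
  A zero at \<open>1 + it\<close> makes the real part of the von Mangoldt series at \<open>\<sigma> + it\<close> as small as \<open>-1/(\<sigma> - 1) + O(1)\<close>,
  and \<open>3 - 4 < 0\<close>.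
\<close>

lemma zeta_reg_nonzero_Re_1: "zeta_reg (Complex 1 t) \<noteq> 0"
proof
  assume zero: "zeta_reg (Complex 1 t) = 0"
  have t: "t \<noteq> 0" using zero zeta_reg_1 by (auto simp: complex_eq_iff one_complex.code)
  obtain C where C: "C > 0" "\<And>\<sigma> t. 1 < \<sigma> \<Longrightarrow> \<sigma> \<le> 2 \<Longrightarrow>
     Re (zeta_reg_logderiv (Complex \<sigma> t)) \<ge> - C * ell t"
     "\<And>\<sigma> t. 1 < \<sigma> \<Longrightarrow> \<sigma> \<le> 2 \<Longrightarrow> zeta_reg (Complex 1 t) = 0 \<Longrightarrow>
       Re (zeta_reg_logderiv (Complex \<sigma> t)) \<ge> 1 / (\<sigma> - 1) - C * ell t"
    using Re_zeta_reg_log_deriv_ge by blast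
  define K where "K = 3 * (C * ell 0) + 4 * (C * ell t + 1 / \<bar>t\<bar>) + C * ell (2 * t) + 1 / \<bar>2 * t\<bar>"
  have K0: "K \<ge> 0" unfolding K_def using C(1) ell_ge_1
    by (intro add_nonneg_nonneg mult_nonneg_nonneg) (auto intro: order_trans[OF zero_le_one])
  \<comment> \<open>\<open>K\<close> collects every bounded contribution, so the inequality with
    weights 3, 4, 1 will force 1/(\<sigma> - 1) <= K. This choice makes the left side K + 1.\<close>
  define \<sigma> where "\<sigma> = 1 + 1 / (K + 1)"
  have \<sigma>: "1 < \<sigma>" "\<sigma> \<le> 2" using K0 by (auto simp: \<sigma>_def field_simps)
  have D: "Re (mangoldt_series (Complex \<sigma> u)) = Re (1 / (Complex \<sigma> u - 1)) - Re (zeta_reg_logderiv (Complex \<sigma> u))" for u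
    using zeta_reg_log_deriv[of "Complex \<sigma> u"] \<sigma> by simp
  have inv: "Re (1 / (Complex \<sigma> u - 1)) \<le> 1 / \<bar>u\<bar>" if "u \<noteq> 0" for u
  proof -
    have "Re (1 / (Complex \<sigma> u - 1)) \<le> norm (1 / (Complex \<sigma> u - 1))" by (rule complex_Re_le_cmod)
    also have "\<dots> = 1 / norm (Complex \<sigma> u - 1)" by (simp add: norm_divide)
    also have "\<dots> \<le> 1 / \<bar>u\<bar>"
      using abs_Im_le_cmod[of "Complex \<sigma> u - 1"] that by (intro frac_le) auto
    finally show ?thesis .
  qed
  have "Complex \<sigma> 0 - 1 = of_real (\<sigma> - 1)" by (simp add: complex_eq_iff)
  then have "Re (1 / (Complex \<sigma> 0 - 1)) = 1 / (\<sigma> - 1)" by (simp only: Re_divide_of_real) simp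
  then have 1: "Re (mangoldt_series (Complex \<sigma> 0)) \<le> 1 / (\<sigma> - 1) + C * ell 0"
    using D[of 0] C(2)[OF \<sigma>, of 0] by simp
  have 2: "Re (mangoldt_series (Complex \<sigma> t)) \<le> 1 / \<bar>t\<bar> - 1 / (\<sigma> - 1) + C * ell t"
    using D[of t] inv[OF t] C(3)[OF \<sigma> zero] by simp
  have 3: "Re (mangoldt_series (Complex \<sigma> (2 * t))) \<le> 1 / \<bar>2 * t\<bar> + C * ell (2 * t)"
    using D[of "2 * t"] inv[of "2 * t"] t C(2)[OF \<sigma>, of "2 * t"] by simp
  have "1 / (\<sigma> - 1) \<le> K" using mangoldt_series_341[OF \<sigma>(1), of t] 1 2 3 unfolding K_def by (simp only: distrib_left)
  moreover have "1 / (\<sigma> - 1) = K + 1" by (simp add: \<sigma>_def)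
  ultimately show False by simp
qed

text \<open>Rankin's trick at \<sigma> = 1 + 1/L: for n up to e^L the factor n^(-1/L) is at least
  1/e, so the finite sum is at most e times the full series at \<sigma>. That series is at most L +
  O(1), where L is the contribution of the pole.\<close>

lemma Mertens_upper:
  "\<exists>C>0. \<forall>L\<ge>1. (\<Sum>n | real n \<le> exp L. mangoldt n / real n) \<le> C * L"
proof -
  obtain C where C: "C > 0" "\<And>\<sigma> t. 1 < \<sigma> \<Longrightarrow> \<sigma> \<le> 2 \<Longrightarrow>
     Re (zeta_reg_logderiv (Complex \<sigma> t)) \<ge> - C * ell t"
    using Re_zeta_reg_log_deriv_ge by blast
  show ?thesis
  proof (intro exI[of _ "exp 1 * (1 + C * ell 0)"] conjI allI impI)
    have e0: "C * ell 0 \<ge> 0" using C(1) ell_ge_1[of 0] by simp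
    then show "exp 1 * (1 + C * ell 0) > 0" by (auto intro!: mult_pos_pos)
    fix L :: real assume L: "L \<ge> 1"
    define \<sigma> where "\<sigma> = 1 + 1 / L"
    have \<sigma>: "1 < \<sigma>" "\<sigma> \<le> 2" using L by (auto simp: \<sigma>_def)
    define F where "F = {n. real n \<le> exp L}"
    have fin: "finite F"
    proof (rule finite_subset)
      show "F \<subseteq> {..nat \<lceil>exp L\<rceil>}" unfolding F_def by (auto simp: le_nat_iff) linarith
    qed simp
    have "Complex \<sigma> 0 - 1 = of_real (\<sigma> - 1)" by (simp add: complex_eq_iff)
    then have "Re (1 / (Complex \<sigma> 0 - 1)) = 1 / (\<sigma> - 1)" by (simp only: Re_divide_of_real) simp
    then have up: "Re (mangoldt_series (Complex \<sigma> 0)) \<le> L + C * ell 0"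
      using zeta_reg_log_deriv[of "Complex \<sigma> 0"] C(2)[OF \<sigma>, of 0] \<sigma> by (simp add: \<sigma>_def)
    have s: "(\<lambda>n. mangoldt n * real n powr (- \<sigma>)) sums Re (mangoldt_series (Complex \<sigma> 0))"
      using Re_mangoldt_series[OF \<sigma>(1), of 0] by simp
    have "(\<Sum>n\<in>F. mangoldt n * real n powr (- \<sigma>)) \<le> Re (mangoldt_series (Complex \<sigma> 0))"
      unfolding sums_unique[OF s] by (rule sum_le_suminf) (use s fin in \<open>auto simp: sums_iff mangoldt_nonneg\<close>)
    moreover have "(\<Sum>n\<in>F. exp (-1) * (mangoldt n / real n)) \<le> (\<Sum>n\<in>F. mangoldt n * real n powr (- \<sigma>))"
    proof (rule sum_mono)
      fix n assume n: "n \<in> F"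
      show "exp (-1) * (mangoldt n / real n) \<le> mangoldt n * real n powr (- \<sigma>)"
      proof (cases "n = 0")
        case False
        then have "ln (real n) \<le> L" using n ln_le_cancel_iff[of "real n" "exp L"] by (simp add: F_def)
        then have "- \<sigma> * ln (real n) \<ge> - 1 - ln (real n)"
          using L by (simp add: \<sigma>_def field_simps)
        then have "exp (- 1 - ln (real n)) \<le> real n powr (- \<sigma>)" using False by (simp add: powr_def)
        moreover have "exp (- 1 - ln (real n)) = exp (-1) / real n" using False by (simp add: exp_diff)
        ultimately have "mangoldt n * (exp (-1) / real n) \<le> mangoldt n * real n powr (- \<sigma>)"
          by (intro mult_left_mono mangoldt_nonneg) simp
        then show ?thesis by (simp add: mult.commute)
      qed simp
    qed
    ultimately have "exp (-1) * (\<Sum>n\<in>F. mangoldt n / real n) \<le> L + C * ell 0"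
      using up by (simp add: sum_distrib_left)
    then have "(\<Sum>n\<in>F. mangoldt n / real n) \<le> exp 1 * (L + C * ell 0)"
      by (simp add: exp_minus field_simps)
    also have "\<dots> \<le> exp 1 * ((1 + C * ell 0) * L)"
      using e0 L mult_left_mono[of 1 L "C * ell 0"] by (intro mult_left_mono) (auto simp: algebra_simps)
    finally show "(\<Sum>n | real n \<le> exp L. mangoldt n / real n) \<le> exp 1 * (1 + C * ell 0) * L"
      by (simp add: F_def mult.assoc)
  qed
qed

section \<open>Ordinates and the logarithmic derivative under the Riemann hypothesis\<close>

lemma RH_zeta_reg_zero:
  assumes RH: riemann_hypothesis and s: "Re s > 0" "zeta_reg s = 0"
  shows "Re s = 1/2"
proof -
  have "\<not> Re s > 1" using zeta_reg_nonzero_Re_gt_1[of s] s by auto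
  moreover have "Re s \<noteq> 1" using zeta_reg_nonzero_Re_1[of "Im s"] s by (metis complex_surj)
  ultimately have "Re s < 1" by simp
  moreover from this have "s \<noteq> 1" by auto
  ultimately have "s \<in> nontrivial_zeta_zeros"
    using s zeta_reg_eq[of s] by (auto simp: nontrivial_zeta_zeros_def)
  then show ?thesis using RH by (simp add: riemann_hypothesis_def)
qed

lemma zeta_ordinates_iff: "\<gamma> \<in> zeta_ordinates \<longleftrightarrow> zeta_reg (Complex (1/2) \<gamma>) = 0"
proof -
  have "Complex (1/2) \<gamma> \<noteq> 1" by (simp add: complex_eq_iff)
  then show ?thesis using zeta_reg_eq[of "Complex (1/2) \<gamma>"]
    by (auto simp: zeta_ordinates_def nontrivial_zeta_zeros_def)
qed

text \<open>The factor s - 1 that separates \<open>zeta_reg\<close> from \<open>zeta\<close> does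
  not vanish on the critical line, so it does not change the order.\<close>

lemma ordinate_multiplicity_eq_zmult: "ordinate_multiplicity \<gamma> = zmult (Complex (1/2) \<gamma>)"
proof -
  define z where "z = Complex (1/2) \<gamma>"
  have hol: "zeta holomorphic_on - {1}"
    using zeta_continuation_zeta unfolding zeta_continuation_def by auto
  have z: "z \<in> - {1}" by (auto simp: z_def complex_eq_iff)
  have "\<exists>w\<in>- {1}. zeta w \<noteq> 0"
    using norm_zeta_Re_2_ge[of 2] by (intro bexI[of _ 2]) auto
  note zo = zorder_exist_zero[OF hol open_Compl[OF closed_singleton] _ z this]
  have zo: "(if zeta z = 0 then zorder zeta z > 0 else zorder zeta z = 0) \<and>
      (\<exists>r. r > 0 \<and> cball z r \<subseteq> - {1} \<and> zor_poly zeta z holomorphic_on cball z r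
         \<and> (\<forall>w\<in>cball z r. zeta w = zor_poly zeta z w * (w - z) ^ nat (zorder zeta z) \<and> zor_poly zeta z w \<noteq> 0))"
    by (rule zo) (simp add: connected_punctured_universe)
  define n g where "n = zorder zeta z" and "g = zor_poly zeta z"
  have n: "n = zorder zeta z" "n \<ge> 0" using zo unfolding n_def by (auto split: if_splits)
  obtain r where r: "r > 0" "cball z r \<subseteq> - {1}" "g holomorphic_on cball z r"
      and g: "\<And>w. w \<in> cball z r \<Longrightarrow> zeta w = g w * (w - z) ^ nat n \<and> g w \<noteq> 0"
    using conjunct2[OF zo] unfolding n_def g_def by blast
  \<comment> \<open>Radius 1/4 about a point of the critical line stays inside Re w > 0, where
    \<open>zeta_reg_eq\<close> is available.\<close>
  define e where "e = min r (1/4)"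
  have "zorder zeta_reg z = n"
  proof (rule zorder_eqI[of "ball z e" z "\<lambda>w. (w - 1) * g w"])
    show "z \<in> ball z e" using r by (simp add: e_def)
    show "(\<lambda>w. (w - 1) * g w) holomorphic_on ball z e"
      by (intro holomorphic_intros holomorphic_on_subset[OF r(3)]) (auto simp: e_def)
    show "(z - 1) * g z \<noteq> 0" using z g[of z] r by auto
    fix w assume w: "w \<in> ball z e" "w \<noteq> z"
    have "\<bar>Re (w - z)\<bar> < 1/4"
      using w abs_Re_le_cmod[of "w - z"] by (auto simp: e_def dist_norm norm_minus_commute)
    then have "Re w > 0" unfolding z_def minus_complex.sel complex.sel by linarith
    moreover have wc: "w \<in> cball z r" using w by (auto simp: e_def)
    moreover have "w \<noteq> 1" using wc r by auto
    ultimately show "zeta_reg w = (w - 1) * g w * (w - z) powi n"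
      using g[OF wc] n zeta_reg_eq[of w] by (simp add: power_int_def)
  qed simp
  then show ?thesis using n by (simp add: ordinate_multiplicity_def zmult_def z_def)
qed

abbreviation (input) omult :: "real \<Rightarrow> real" where
  "omult \<gamma> \<equiv> real (ordinate_multiplicity \<gamma>)"

abbreviation (input) Poisson :: "real \<Rightarrow> real \<Rightarrow> real" where
  "Poisson b u \<equiv> b / (b\<^sup>2 + u\<^sup>2)"

text \<open>The width 3/4 is 1/2 plus the distance 1/4 by which t may later be shifted; by
  Pythagoras such zeros still lie in the disc of radius 7/4 about 2 + it.\<close>

definition ordinates_near :: "real \<Rightarrow> real set" where
  "ordinates_near t = {\<gamma> \<in> zeta_ordinates. \<bar>\<gamma> - t\<bar> \<le> 3/4}"

lemma ordinates_near_zeros: "Complex (1/2) ` ordinates_near t \<subseteq> zeta_zeros_near t"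
proof
  fix \<rho> assume "\<rho> \<in> Complex (1/2) ` ordinates_near t"
  then obtain \<gamma> where \<gamma>: "\<rho> = Complex (1/2) \<gamma>" "\<gamma> \<in> zeta_ordinates" "\<bar>\<gamma> - t\<bar> \<le> 3/4"
    by (auto simp: ordinates_near_def)
  have "(norm (Complex 2 t - \<rho>))\<^sup>2 = (3/2)\<^sup>2 + (\<gamma> - t)\<^sup>2"
    by (simp add: \<gamma> cmod_power2 power2_commute)
  also have "(\<gamma> - t)\<^sup>2 \<le> (3/4)\<^sup>2" using \<gamma>(3) by (simp add: abs_le_square_iff[symmetric])
  finally have "(norm (Complex 2 t - \<rho>))\<^sup>2 \<le> (7/4)\<^sup>2" by (simp add: power2_eq_square)
  then have "norm (Complex 2 t - \<rho>) \<le> 7/4" by (rule power2_le_imp_le) simp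
  then show "\<rho> \<in> zeta_zeros_near t"
    using \<gamma> zeta_ordinates_iff[of \<gamma>] by (simp add: zeta_zeros_near_def dist_norm)
qed

lemma inj_Complex: "inj_on (Complex x) A"
  by (auto simp: inj_on_def)

text \<open>With all zeros at real part 1/2, the real part of 1/(z - \<rho>) at z = 1/2 + b + it is
  exactly a Poisson kernel of width b. Zeros of the disc outside \<open>ordinates_near\<close> are
  dropped by positivity. The upper bound, which grows like 1/b, is meant only for justifying the
  shift of the line.\<close>

lemma RH_log_deriv_bounds:
  assumes RH: riemann_hypothesis
  shows "\<exists>C>0. \<forall>t. finite (ordinates_near t) \<and>
    (\<Sum>\<gamma>\<in>ordinates_near t. omult \<gamma>) \<le> C * ell t \<and>
    (\<forall>b. 0 < b \<longrightarrow> b \<le> 3/2 \<longrightarrow>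
      Re (zeta_reg_logderiv (Complex (1/2 + b) t)) \<ge>
        (\<Sum>\<gamma>\<in>ordinates_near t. omult \<gamma> * Poisson b (t - \<gamma>)) - C * ell t \<and>
      norm (zeta_reg_logderiv (Complex (1/2 + b) t)) \<le> C * ell t * (1 + 1 / b))"
proof -
  obtain C where C: "C > 0" "\<And>t. finite (zeta_zeros_near t)"
    "\<And>t. (\<Sum>\<rho>\<in>zeta_zeros_near t. real (zmult \<rho>)) \<le> C * ell t"
    "\<And>t z. z \<in> cball (Complex 2 t) (3/2) \<Longrightarrow> zeta_reg z \<noteq> 0 \<Longrightarrow>
        norm (zeta_reg_logderiv z - zeros_expansion t z) \<le> C * ell t"
    using zeta_reg_local_expansion by blast
  show ?thesis
  proof (rule exI[of _ C], intro conjI allI impI C(1))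
    fix t :: real
    show fin: "finite (ordinates_near t)"
      using finite_subset[OF ordinates_near_zeros C(2)] inj_Complex by (rule finite_imageD)
    have "(\<Sum>\<gamma>\<in>ordinates_near t. omult \<gamma>) = (\<Sum>\<rho>\<in>Complex (1/2) ` ordinates_near t. real (zmult \<rho>))"
      by (simp add: sum.reindex[OF inj_Complex] ordinate_multiplicity_eq_zmult)
    also have "\<dots> \<le> (\<Sum>\<rho>\<in>zeta_zeros_near t. real (zmult \<rho>))"
      by (rule sum_mono2[OF C(2) ordinates_near_zeros]) simp
    finally show "(\<Sum>\<gamma>\<in>ordinates_near t. omult \<gamma>) \<le> C * ell t"
      using C(3)[of t] by simp
    fix b :: real assume b: "0 < b" "b \<le> 3/2"
    define z where "z = Complex (1/2 + b) t"
    define S where "S = zeros_expansion t z"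
    have "norm (Complex 2 t - z) = 3/2 - b" using b by (simp add: z_def cmod_def)
    then have zin: "z \<in> cball (Complex 2 t) (3/2)" using b by (simp add: dist_norm)
    have nz: "zeta_reg z \<noteq> 0" using RH_zeta_reg_zero[OF RH, of z] b by (auto simp: z_def)
    have le: "norm (zeta_reg_logderiv z - S) \<le> C * ell t"
      unfolding S_def by (rule C(4)[OF zin nz])
    have Rho: "Re \<rho> = 1/2" if "\<rho> \<in> zeta_zeros_near t" for \<rho>
      using zeta_zeros_near_Re[OF that] RH_zeta_reg_zero[OF RH, of \<rho>] by simp
    have Reterm: "Re (of_nat m / (z - \<rho>)) = real m * Poisson b (t - Im \<rho>)" if "Re \<rho> = 1/2" for \<rho> m
    proof -
      have "z - \<rho> = Complex b (t - Im \<rho>)" using that by (simp add: z_def complex_eq_iff)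
      then show ?thesis by (simp add: Re_divide)
    qed
    have "(\<Sum>\<gamma>\<in>ordinates_near t. omult \<gamma> * Poisson b (t - \<gamma>))
        = (\<Sum>\<rho>\<in>Complex (1/2) ` ordinates_near t. Re (of_nat (zmult \<rho>) / (z - \<rho>)))"
      by (simp add: sum.reindex[OF inj_Complex] ordinate_multiplicity_eq_zmult Reterm del: of_nat_eq_0_iff)
    also have "\<dots> \<le> (\<Sum>\<rho>\<in>zeta_zeros_near t. Re (of_nat (zmult \<rho>) / (z - \<rho>)))"
      by (rule sum_mono2[OF C(2) ordinates_near_zeros]) (use Rho b in \<open>auto simp: Reterm\<close>)
    also have "\<dots> = Re S" by (simp add: S_def)
    also have "\<dots> \<le> Re (zeta_reg_logderiv z) + C * ell t"
      using le abs_Re_le_cmod[of "zeta_reg_logderiv z - S"] by (simp add: abs_le_iff)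
    finally show "Re (zeta_reg_logderiv (Complex (1/2 + b) t)) \<ge>
        (\<Sum>\<gamma>\<in>ordinates_near t. omult \<gamma> * Poisson b (t - \<gamma>)) - C * ell t"
      unfolding z_def by linarith
    have "norm S \<le> (\<Sum>\<rho>\<in>zeta_zeros_near t. real (zmult \<rho>) * (1 / b))"
      unfolding S_def
    proof (rule sum_norm_le)
      fix \<rho> assume "\<rho> \<in> zeta_zeros_near t"
      then have "norm (z - \<rho>) \<ge> b"
        using Rho[of \<rho>] abs_Re_le_cmod[of "z - \<rho>"] b by (simp add: z_def)
      then have "real (zmult \<rho>) / norm (z - \<rho>) \<le> real (zmult \<rho>) / b" using b by (intro frac_le) auto
      then show "norm (of_nat (zmult \<rho>) / (z - \<rho>)) \<le> real (zmult \<rho>) * (1 / b)" by (simp add: norm_divide)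
    qed
    also have "\<dots> = (\<Sum>\<rho>\<in>zeta_zeros_near t. real (zmult \<rho>)) * (1 / b)" by (simp only: sum_distrib_right)
    also have "\<dots> \<le> C * ell t * (1 / b)" using C(3)[of t] b by (intro mult_right_mono) auto
    finally have "norm (zeta_reg_logderiv z) \<le> C * ell t * (1 / b) + C * ell t"
      using le norm_triangle_ineq2[of "zeta_reg_logderiv z" S] by linarith
    then show "norm (zeta_reg_logderiv (Complex (1/2 + b) t)) \<le> C * ell t * (1 + 1 / b)"
      by (simp add: z_def algebra_simps)
  qed
qed

section \<open>Moving a vertical line of integration\<close>

lemma Cauchy_kernel_integral:
  fixes L :: real assumes L: "L > 0"
  shows "integrable lborel (\<lambda>v. 1 / (1 + (L * v)\<^sup>2))" "(LINT v|lborel. 1 / (1 + (L * v)\<^sup>2)) = pi / L"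
proof -
  let ?f = "\<lambda>v. 1 / (1 + (L * v)\<^sup>2)" and ?F = "\<lambda>v. arctan (L * v) / L"
  have d: "DERIV ?F v :> ?f v" for v
    using L by (auto intro!: derivative_eq_intros simp: inverse_eq_divide)
  have c: "isCont ?f v" for v
    by (intro continuous_intros) (auto simp: add_nonneg_eq_0_iff)
  have lim: "((\<lambda>v. arctan (L * v) / L) \<longlongrightarrow> (pi/2) / L) at_top" "((\<lambda>v. arctan (L * v) / L) \<longlongrightarrow> (- (pi/2)) / L) at_bot"
    using L by (real_asymp simp: field_simps)+
  have lim': "((?F \<circ> real_of_ereal) \<longlongrightarrow> (pi/2) / L) (at_left \<infinity>)" "((?F \<circ> real_of_ereal) \<longlongrightarrow> (- (pi/2)) / L) (at_right (-\<infinity>))"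
    unfolding ereal_tendsto_simps by (rule lim)+
  note FTC = interval_integral_FTC_nonneg[of "-\<infinity>" \<infinity> ?F ?f, OF _ d c _ lim'(2,1)]
  have *: "set_integrable lborel (einterval (-\<infinity>) \<infinity>) ?f" "(LBINT v=-\<infinity>..\<infinity>. ?f v) = (pi/2) / L - (- (pi/2)) / L"
    by (rule FTC; simp)+
  have e: "einterval (-\<infinity>) \<infinity> = UNIV" by (auto simp: einterval_def)
  show "integrable lborel ?f" using *(1) by (simp add: e set_integrable_def)
  show "(LINT v|lborel. ?f v) = pi / L"
    using *(2) by (simp add: interval_lebesgue_integral_def e set_lebesgue_integral_def)
qed

lemma integrable_vertical_line:
  fixes g :: "real \<Rightarrow> complex"
  assumes c: "continuous_on UNIV g" and L: "L > 0" and bd: "\<And>v. norm (g v) \<le> A / (1 + (L * v)\<^sup>2)"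
  shows "integrable lborel g" "norm (LINT v|lborel. g v) \<le> A * (pi / L)"
proof -
  have i: "integrable lborel (\<lambda>v. A * (1 / (1 + (L * v)\<^sup>2)))"
    by (intro integrable_mult_right Cauchy_kernel_integral L)
  have m: "g \<in> borel_measurable lborel" using borel_measurable_continuous_onI[OF c] by simp
  show ig: "integrable lborel g"
    by (rule Bochner_Integration.integrable_bound[OF i m])
       (intro AE_I2, unfold real_norm_def, rule order_trans[OF _ abs_ge_self], use bd in simp)
  have "norm (LINT v|lborel. g v) \<le> (LINT v|lborel. norm (g v))" by (rule integral_norm_bound)
  also have "\<dots> \<le> (LINT v|lborel. A * (1 / (1 + (L * v)\<^sup>2)))"
    by (rule integral_mono) (use ig i bd in auto)
  also have "\<dots> = A * (pi / L)"
    using Cauchy_kernel_integral(2)[OF L] by (simp only: integral_mult_right_zero)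
  finally show "norm (LINT v|lborel. g v) \<le> A * (pi / L)" .
qed

lemma vertical_line_shift:
  fixes f :: "complex \<Rightarrow> complex"
  assumes f: "f holomorphic_on S" "open S" "convex S" and ab: "a \<le> b" and L: "L > 0"
    and sub: "\<And>w. a \<le> Re w \<Longrightarrow> Re w \<le> b \<Longrightarrow> w \<in> S"
    and bd: "\<And>w. a \<le> Re w \<Longrightarrow> Re w \<le> b \<Longrightarrow> norm (f w) \<le> A / (1 + (L * Im w)\<^sup>2)"
  shows "(LINT v|lborel. f (Complex a v)) = (LINT v|lborel. f (Complex b v))"
proof -
  (* both integrals are limits of increments of F, and these differ by increments over horizontal segments *)
  obtain F where F: "\<And>w. w \<in> S \<Longrightarrow> (F has_field_derivative f w) (at w)"
    using holomorphic_convex_primitive'[OF f(3,2,1)] at_within_open[OF _ f(2)] by metis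
  have cf: "continuous_on S f" by (rule holomorphic_on_imp_continuous_on[OF f(1)])
  have Cx: "Complex x v = of_real x + \<i> * of_real v" for x v by (simp add: complex_eq_iff)
  have cont: "continuous_on UNIV (\<lambda>v. f (Complex x v))" if "a \<le> x" "x \<le> b" for x
    by (rule continuous_on_compose2[OF cf]) (use that sub in \<open>auto simp: Cx intro!: continuous_intros\<close>)
  have lim: "(\<lambda>n. F (Complex x (real n)) / \<i> - F (Complex x (- real n)) / \<i>) \<longlonglongrightarrow> (LINT v|lborel. f (Complex x v))"
    if x: "a \<le> x" "x \<le> b" for x
  proof -
    let ?g = "\<lambda>v. f (Complex x v)"
    have ig: "integrable lborel ?g"
      by (rule integrable_vertical_line(1)[OF cont[OF x] L]) (use bd[of "Complex x _"] x in auto)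
    have "(\<lambda>n. LINT v|lborel. indicator {- real n..real n} v *\<^sub>R ?g v) \<longlonglongrightarrow> (LINT v|lborel. ?g v)"
    proof (rule integral_dominated_convergence[where w = "\<lambda>v. norm (?g v)"])
      show "AE v in lborel. (\<lambda>n. indicator {- real n..real n} v *\<^sub>R ?g v) \<longlonglongrightarrow> ?g v"
      proof (rule AE_I2)
        fix v :: real
        have "eventually (\<lambda>n. indicator {- real n..real n} v *\<^sub>R ?g v = ?g v) sequentially"
          using eventually_ge_at_top[of "nat \<lceil>\<bar>v\<bar>\<rceil>"]
        proof eventually_elim
          case (elim n)
          then have "\<bar>v\<bar> \<le> real n" by linarith
          then show ?case by (simp add: abs_le_iff)
        qed
        then show "(\<lambda>n. indicator {- real n..real n} v *\<^sub>R ?g v) \<longlonglongrightarrow> ?g v" by (rule tendsto_eventually)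
      qed
      show "?g \<in> borel_measurable lborel" using ig by auto
      show "(\<lambda>v. indicator {- real n..real n} v *\<^sub>R ?g v) \<in> borel_measurable lborel" for n
        using ig by (intro borel_measurable_scaleR) auto
      show "integrable lborel (\<lambda>v. norm (?g v))" using ig by auto
      show "AE v in lborel. norm (indicator {- real n..real n} v *\<^sub>R ?g v) \<le> norm (?g v)" for n
        by (auto simp: indicator_def)
    qed
    moreover have "(LINT v|lborel. indicator {- real n..real n} v *\<^sub>R ?g v)
        = F (Complex x (real n)) / \<i> - F (Complex x (- real n)) / \<i>" for n
    proof (rule integral_FTC_atLeastAtMost)
      show "continuous_on {- real n..real n} ?g" by (rule continuous_on_subset[OF cont[OF x]]) auto
      fix v :: real
      have "Complex x v \<in> S" using sub[of "Complex x v"] x by simp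
      then have FD: "(F has_field_derivative f (Complex x v)) (at (of_real x + \<i> * of_real v))"
        using F by (simp add: Cx)
      have "((\<lambda>z. F (of_real x + \<i> * z) / \<i>) has_field_derivative f (Complex x v) * \<i> / \<i>) (at (of_real v))"
        by (rule DERIV_cdivide, rule DERIV_chain2[where f = F and g = "\<lambda>z. of_real x + \<i> * z", OF FD])
           (auto intro!: derivative_eq_intros)
      then have "((\<lambda>z. F (of_real x + \<i> * z) / \<i>) has_field_derivative f (Complex x v)) (at (of_real v))"
        by (simp only: nonzero_mult_div_cancel_right[OF complex_i_not_zero])
      then have "((\<lambda>v. F (of_real x + \<i> * of_real v) / \<i>) has_vector_derivative f (Complex x v)) (at v within {- real n..real n})"
        by (rule has_vector_derivative_real_field)
      then show "((\<lambda>v. F (Complex x v) / \<i>) has_vector_derivative f (Complex x v)) (at v within {- real n..real n})"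
        by (simp add: Cx)
    qed simp
    ultimately show ?thesis by simp
  qed
  have A0: "A \<ge> 0" using order_trans[OF norm_ge_zero bd[of "of_real a"]] ab by simp
  have diff: "norm (F (Complex a v) - F (Complex b v)) \<le> A / (1 + (L * v)\<^sup>2) * (b - a)" for v
  proof -
    let ?T = "closed_segment (Complex a v) (Complex b v)"
    have T: "a \<le> Re w" "Re w \<le> b" "Im w = v" if w: "w \<in> ?T" for w
    proof -
      obtain u where u: "0 \<le> u" "u \<le> 1" "w = (1 - u) *\<^sub>R Complex a v + u *\<^sub>R Complex b v"
        using w by (auto simp: closed_segment_def)
      have R: "Re w = a + u * (b - a)" and I: "Im w = v" by (simp_all add: u algebra_simps)
      have "0 \<le> u * (b - a)" "u * (b - a) \<le> 1 * (b - a)" using u ab by (intro mult_nonneg_nonneg mult_right_mono; simp)+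
      then show "a \<le> Re w" "Re w \<le> b" "Im w = v" using R I by auto
    qed
    have "norm (F (Complex a v) - F (Complex b v)) \<le> A / (1 + (L * v)\<^sup>2) * norm (Complex a v - Complex b v)"
    proof (rule field_differentiable_bound[of ?T F f])
      show "(F has_field_derivative f w) (at w within ?T)" if "w \<in> ?T" for w
        using F[OF sub] T[OF that] by (auto intro: has_field_derivative_at_within)
      show "norm (f w) \<le> A / (1 + (L * v)\<^sup>2)" if "w \<in> ?T" for w
        using bd[of w] T[OF that] by simp
    qed auto
    also have "norm (Complex a v - Complex b v) = b - a" using ab by (simp add: cmod_def)
    finally show ?thesis .
  qed
  have z: "(\<lambda>n. A / (1 + (L * x n)\<^sup>2) * (b - a)) \<longlonglongrightarrow> 0" if "x = (\<lambda>n. real n) \<or> x = (\<lambda>n. - real n)" for x :: "nat \<Rightarrow> real"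
    using that L by (elim disjE) (simp_all, real_asymp+)
  have "(\<lambda>n. (F (Complex a (real n)) - F (Complex b (real n))) / \<i> - (F (Complex a (- real n)) - F (Complex b (- real n))) / \<i>) \<longlonglongrightarrow> 0 / \<i> - 0 / \<i>"
    by (intro tendsto_intros Lim_null_comparison[OF always_eventually[OF allI[OF diff]] z]) auto
  moreover have "(\<lambda>n. (F (Complex a (real n)) - F (Complex b (real n))) / \<i> - (F (Complex a (- real n)) - F (Complex b (- real n))) / \<i>)
     \<longlonglongrightarrow> (LINT v|lborel. f (Complex a v)) - (LINT v|lborel. f (Complex b v))"
    using tendsto_diff[OF lim[of a] lim[of b]] ab by (simp add: diff_divide_distrib algebra_simps)
  ultimately show ?thesis using LIMSEQ_unique by fastforce
qed

text \<open>
  This is \<open>(2 sinh(L w / 4) / w)^4\<close>: entire, nonnegative on the imaginary axis, and of exponential type \<open>L\<close>.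
\<close>

definition bump_kernel :: "real \<Rightarrow> complex \<Rightarrow> complex" where
  "bump_kernel L w = (if w = 0 then of_real (L/2)
     else (exp (of_real (L/4) * w) - exp (- of_real (L/4) * w)) / w) ^ 4"

lemma bump_kernel_holomorphic: "bump_kernel L holomorphic_on UNIV"
proof -
  let ?f = "\<lambda>w. exp (of_real (L/4) * w) - exp (- of_real (L/4) * w) :: complex"
  have d: "deriv ?f 0 = of_real (L/2)"
    by (rule DERIV_imp_deriv) (auto intro!: derivative_eq_intros)
  have "(\<lambda>w. if w = 0 then deriv ?f 0 else (?f w - ?f 0) / (w - 0)) holomorphic_on UNIV"
    by (rule pole_lemma) (auto intro!: holomorphic_intros)
  then have "(\<lambda>w. (if w = 0 then of_real (L/2) else ?f w / w) ^ 4) holomorphic_on UNIV"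
    unfolding d by (intro holomorphic_on_power) (simp cong: if_cong)
  then show ?thesis unfolding bump_kernel_def[abs_def] .
qed

text \<open>Two bounds for the base \<open>q\<close> of the fourth power: the mean value theorem
  gives L/2 times exp(L Re w / 4), which is good for small w, and the trivial estimate of the
  numerator gives 2 exp(L Re w / 4) / |Im w|. Adding their squares treats both ranges at once, and
  one more squaring gives 64 = 8^2.\<close>

lemma bump_kernel_norm_le:
  assumes L: "L > 0" and w: "Re w \<ge> 0"
  shows "norm (bump_kernel L w) \<le> exp (L * Re w) * (64 * L ^ 4 / (1 + (L * Im w)\<^sup>2)\<^sup>2)"
proof -
  define a where "a = L/4"
  define x where "x = Re w"
  let ?f = "\<lambda>w. exp (of_real a * w) - exp (- of_real a * w) :: complex"
  define q where "q = (if w = 0 then of_real (L/2) else ?f w / w)"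
  have a: "a > 0" using L by (simp add: a_def)
  have e1: "norm (exp (of_real a * z) :: complex) \<le> exp (a * x)" "norm (exp (- of_real a * z) :: complex) \<le> exp (a * x)"
    if "0 \<le> Re z" "Re z \<le> x" for z
  proof -
    have "a * Re z \<le> a * x" "0 \<le> a * Re z" using that a by (auto intro!: mult_left_mono)
    then show "norm (exp (of_real a * z) :: complex) \<le> exp (a * x)" "norm (exp (- of_real a * z) :: complex) \<le> exp (a * x)"
      by auto
  qed
  have "norm (?f w - ?f 0) \<le> (2 * a * exp (a * x)) * norm (w - 0)"
  proof (rule field_differentiable_bound[of "{z. 0 \<le> Re z} \<inter> {z. Re z \<le> x}" ?f
        "\<lambda>z. of_real a * exp (of_real a * z) + of_real a * exp (- of_real a * z)"])
    show "convex ({z. 0 \<le> Re z} \<inter> {z. Re z \<le> x})"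
      by (intro convex_Int convex_halfspace_Re_ge convex_halfspace_Re_le)
    show "(?f has_field_derivative of_real a * exp (of_real a * z) + of_real a * exp (- of_real a * z)) (at z within ({z. 0 \<le> Re z} \<inter> {z. Re z \<le> x}))" for z
      by (auto intro!: derivative_eq_intros simp: algebra_simps)
    fix z assume z: "z \<in> {z. 0 \<le> Re z} \<inter> {z. Re z \<le> x}"
    have "norm (of_real a * exp (of_real a * z) + of_real a * exp (- of_real a * z) :: complex)
      \<le> norm (of_real a * exp (of_real a * z) :: complex) + norm (of_real a * exp (- of_real a * z) :: complex)"
      by (rule norm_triangle_ineq)
    also have "\<dots> = a * norm (exp (of_real a * z) :: complex) + a * norm (exp (- of_real a * z) :: complex)"
      using a by (simp only: norm_mult norm_of_real abs_of_pos)
    also have "\<dots> \<le> a * exp (a * x) + a * exp (a * x)"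
      using e1[of z] z a by (intro add_mono mult_left_mono) auto
    finally show "norm (of_real a * exp (of_real a * z) + of_real a * exp (- of_real a * z) :: complex) \<le> 2 * a * exp (a * x)" by simp
  qed (use w in \<open>auto simp: x_def\<close>)
  then have b1: "norm (?f w) \<le> L/2 * exp (a * x) * norm w" by (simp add: a_def)
  have b2: "norm (?f w) \<le> 2 * exp (a * x)"
  proof -
    have "norm (exp (of_real a * w)) + norm (exp (- of_real a * w)) \<le> exp (a * x) + exp (a * x)"
      using w by (intro add_mono e1) (auto simp: x_def)
    then show ?thesis using norm_triangle_ineq4[of "exp (of_real a * w)" "exp (- of_real a * w)"] by linarith
  qed
  have ax: "exp (a * x) \<ge> 1" using a w by (simp add: x_def)
  have q1: "norm q \<le> L/2 * exp (a * x)"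
  proof (cases "w = 0")
    case True
    then show ?thesis using L by (simp add: q_def x_def)
  next
    case False
    then show ?thesis using b1 by (simp add: q_def norm_divide field_simps)
  qed
  have q2: "norm q * \<bar>Im w\<bar> \<le> 2 * exp (a * x)"
  proof (cases "w = 0")
    case False
    then have "norm q * norm w = norm (?f w)" by (simp add: q_def norm_divide)
    moreover have "norm q * \<bar>Im w\<bar> \<le> norm q * norm w" by (intro mult_left_mono abs_Im_le_cmod) simp
    ultimately show ?thesis using b2 by linarith
  qed simp
  have "(norm q)\<^sup>2 * (1 + (L * Im w)\<^sup>2) = (norm q)\<^sup>2 + L\<^sup>2 * (norm q * \<bar>Im w\<bar>)\<^sup>2"
    by (simp add: power_mult_distrib algebra_simps)
  also have "\<dots> \<le> (L/2 * exp (a * x))\<^sup>2 + L\<^sup>2 * (2 * exp (a * x))\<^sup>2"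
    using q1 q2 by (intro add_mono mult_left_mono power_mono) auto
  also have "\<dots> = (L\<^sup>2 / 4 + 4 * L\<^sup>2) * exp (2 * a * x)"
    by (simp add: power_mult_distrib exp_double[symmetric] algebra_simps power2_eq_square exp_add[symmetric])
  also have "\<dots> \<le> (8 * L\<^sup>2) * exp (2 * a * x)"
    using zero_le_power2[of L] by (intro mult_right_mono) auto
  finally have "(norm q)\<^sup>2 \<le> 8 * L\<^sup>2 * exp (2 * a * x) / (1 + (L * Im w)\<^sup>2)"
    by (subst pos_le_divide_eq) (auto simp: add_pos_nonneg)
  then have "((norm q)\<^sup>2)\<^sup>2 \<le> (8 * L\<^sup>2 * exp (2 * a * x) / (1 + (L * Im w)\<^sup>2))\<^sup>2"
    by (rule power_mono) simp
  also have "\<dots> = exp (L * x) * (64 * L ^ 4 / (1 + (L * Im w)\<^sup>2)\<^sup>2)"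
  proof -
    have "exp (2 * a * x) ^ 2 = exp (L * x)" by (simp add: a_def exp_double[symmetric])
    then show ?thesis by (simp add: power_divide power_mult_distrib)
  qed
  also have "((norm q)\<^sup>2)\<^sup>2 = norm (bump_kernel L w)"
    by (simp add: bump_kernel_def q_def a_def norm_power)
  finally show ?thesis by (simp add: x_def)
qed

lemma bump_kernel_imaginary:
  "bump_kernel L (Complex 0 v) = of_real ((if v = 0 then L/2 else 2 * sin (L/4 * v) / v) ^ 4)"
proof (cases "v = 0")
  case True
  then show ?thesis by (simp add: bump_kernel_def complex_eq_iff[of _ 0])
next
  case False
  have w: "Complex 0 v = \<i> * of_real v" by (simp add: complex_eq_iff)
  have "exp (of_real (L/4) * (\<i> * of_real v)) - exp (- of_real (L/4) * (\<i> * of_real v)) = 2 * \<i> * of_real (sin (L/4 * v))"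
    by (simp add: complex_eq_iff Re_exp Im_exp)
  then have "(exp (of_real (L/4) * (\<i> * of_real v)) - exp (- of_real (L/4) * (\<i> * of_real v))) / (\<i> * of_real v)
     = of_real (2 * sin (L/4 * v) / v)" using False by (simp add: field_simps)
  then show ?thesis using False unfolding bump_kernel_def w by simp
qed

lemma sin_ge_half:
  fixes y :: real assumes "0 \<le> y" "y \<le> 1"
  shows "sin y \<ge> y / 2"
proof -
  have "(\<lambda>y. sin y - y/2) 0 \<le> (\<lambda>y. sin y - y/2) y"
  proof (rule DERIV_nonneg_imp_nondecreasing[OF assms(1)])
    fix u :: real assume u: "0 \<le> u" "u \<le> y"
    have "cos (pi/3) \<le> cos u" using u assms pi_gt3 by (intro cos_monotone_0_pi_le) auto
    then show "\<exists>z. DERIV (\<lambda>y. sin y - y/2) u :> z \<and> 0 \<le> z"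
      by (intro exI[of _ "cos u - 1/2"]) (auto intro!: derivative_eq_intros simp: cos_60)
  qed
  then show ?thesis by simp
qed

lemma bump_kernel_imaginary_ge:
  assumes L: "L > 0" and v: "\<bar>v\<bar> \<le> 1 / L"
  shows "Re (bump_kernel L (Complex 0 v)) \<ge> L ^ 4 / 256"
proof -
  define r where "r = (if v = 0 then L/2 else 2 * sin (L/4 * v) / v)"
  have "r \<ge> L/4"
  proof (cases "v = 0")
    case False
    define y where "y = L/4 * \<bar>v\<bar>"
    have y: "0 \<le> y" "y \<le> 1" using L v by (auto simp: y_def field_simps)
    have "2 * sin (L/4 * v) / v = 2 * sin y / \<bar>v\<bar>"
      by (cases "v \<ge> 0") (auto simp: y_def)
    also have "\<dots> \<ge> 2 * (y / 2) / \<bar>v\<bar>" using sin_ge_half[OF y] by (intro divide_right_mono) auto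
    finally show ?thesis using False by (simp add: r_def y_def)
  qed (use L in \<open>simp add: r_def\<close>)
  then have "(L/4) ^ 4 \<le> r ^ 4" using L by (intro power_mono) auto
  then show ?thesis unfolding bump_kernel_imaginary r_def[symmetric] by (simp add: power_divide)
qed

lemma ell_add_le_ln: "ell (t + v) \<le> ell t + ln (1 + \<bar>v\<bar>)"
proof -
  have "0 \<le> \<bar>t\<bar> * \<bar>v\<bar>" by simp
  then have "3 + \<bar>t + v\<bar> \<le> 3 + \<bar>t\<bar> + 3 * \<bar>v\<bar> + \<bar>t\<bar> * \<bar>v\<bar>"
    using abs_triangle_ineq[of t v] abs_ge_zero[of v] by linarith
  also have "\<dots> = (3 + \<bar>t\<bar>) * (1 + \<bar>v\<bar>)" by (simp add: algebra_simps)
  finally have "ell (t + v) \<le> ln ((3 + \<bar>t\<bar>) * (1 + \<bar>v\<bar>))" unfolding ell_def by (intro ln_mono) auto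
  also have "\<dots> = ell t + ln (1 + \<bar>v\<bar>)" unfolding ell_def by (rule ln_mult_pos) (auto intro: add_pos_nonneg)
  finally show ?thesis .
qed

lemma ell_add_le: "ell (t + v) \<le> ell t * (1 + \<bar>v\<bar>)"
  using ell_add_le_ln[of t v] ln_add_one_self_le_self[of "\<bar>v\<bar>"] ell_ge_1[of t] mult_right_mono[of 1 "ell t" "\<bar>v\<bar>"]
  by (simp add: algebra_simps)

text \<open>The weight 1 + |v| arises from \<open>ell_add_le\<close> and from the pole term. The
  fourth power in \<open>bump_kernel\<close> is there to absorb it and still leave an integrable
  majorant.\<close>

lemma kernel_weight_le:
  fixes L :: real assumes L: "L \<ge> 1"
  shows "(1 + \<bar>v\<bar>) * (64 * L ^ 4 / (1 + (L * v)\<^sup>2)\<^sup>2) \<le> 128 * L ^ 4 / (1 + (L * v)\<^sup>2)"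
proof -
  define y where "y = \<bar>L * v\<bar>"
  have "\<bar>v\<bar> \<le> y" unfolding y_def abs_mult using L mult_right_mono[of 1 "\<bar>L\<bar>" "\<bar>v\<bar>"] by simp
  moreover have "y \<le> 1 + y\<^sup>2" using sum_squares_bound[of y 1] zero_le_power2[of y]
    by (smt (verit) mult_cancel_left2 one_power2 power2_eq_square)
  ultimately have "\<bar>v\<bar> \<le> 1 + y\<^sup>2" by (rule order_trans)
  then have "1 + \<bar>v\<bar> \<le> 2 * (1 + y\<^sup>2)" using zero_le_power2[of y] unfolding distrib_left by linarith
  then have h: "1 + \<bar>v\<bar> \<le> 2 * (1 + (L * v)\<^sup>2)" by (simp add: y_def)
  have p: "1 + (L * v)\<^sup>2 > 0" by (simp add: add_pos_nonneg)
  have "(1 + \<bar>v\<bar>) * (64 * L ^ 4 / (1 + (L * v)\<^sup>2)\<^sup>2) \<le> 2 * (1 + (L * v)\<^sup>2) * (64 * L ^ 4 / (1 + (L * v)\<^sup>2)\<^sup>2)"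
    using h L by (intro mult_right_mono) auto
  also have "\<dots> = 128 * L ^ 4 / (1 + (L * v)\<^sup>2)"
  proof -
    have "2 * P * (64 * L ^ 4 / P\<^sup>2) = 128 * L ^ 4 / P" if "P > 0" for P :: real
      using that by (simp add: power2_eq_square)
    then show ?thesis using p by blast
  qed
  finally show ?thesis .
qed

text \<open>As n^(-iv) = exp(- i v ln n), this is the Fourier transform at ln n of the kernel
  restricted to the imaginary axis.\<close>

definition bump_transform :: "real \<Rightarrow> nat \<Rightarrow> complex" where
  "bump_transform L n = (LINT v|lborel. npow n (Complex 0 v) * bump_kernel L (Complex 0 v))"

lemma nat_powr_kernel_norm:
  assumes L: "L > 0" and n: "n \<ge> 1" and w: "Re w \<ge> 0"
  shows "norm (npow n w * bump_kernel L w)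
     \<le> real n powr (- Re w) * exp (L * Re w) * (64 * L ^ 4) / (1 + (L * Im w)\<^sup>2)"
proof -
  define p where "p = 1 + (L * Im w)\<^sup>2"
  have p: "p \<ge> 1" by (simp add: p_def)
  have "64 * L ^ 4 / p\<^sup>2 \<le> 64 * L ^ 4 / p"
    using p L self_le_power[of p 2] by (intro divide_left_mono) auto
  then have "norm (bump_kernel L w) \<le> exp (L * Re w) * (64 * L ^ 4 / p)"
    by (intro order_trans[OF bump_kernel_norm_le[OF L w]] mult_left_mono) (simp_all add: p_def)
  then have "real n powr (- Re w) * norm (bump_kernel L w) \<le> real n powr (- Re w) * (exp (L * Re w) * (64 * L ^ 4 / p))"
    by (intro mult_left_mono) auto
  then show ?thesis by (simp add: norm_mult norm_nat_powr p_def)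
qed

lemma nat_powr_kernel_holomorphic: "n \<ge> 1 \<Longrightarrow> (\<lambda>w. npow n w * bump_kernel L w) holomorphic_on UNIV"
  by (intro holomorphic_on_mult bump_kernel_holomorphic) (auto intro!: holomorphic_intros)

lemma continuous_on_vertical:
  assumes "f holomorphic_on S" "\<And>v. Complex c v \<in> S"
  shows "continuous_on UNIV (\<lambda>v. f (Complex c v))"
proof -
  have Cx: "Complex c v = of_real c + \<i> * of_real v" for v by (simp add: complex_eq_iff)
  show ?thesis
    by (rule continuous_on_compose2[OF holomorphic_on_imp_continuous_on[OF assms(1)]])
       (use assms(2) in \<open>auto simp: Cx intro!: continuous_intros\<close>)
qed

lemma bump_transform_shift:
  assumes L: "L > 0" and n: "n \<ge> 1" and c: "c \<ge> 0"
  shows "(LINT v|lborel. npow n (Complex c v) * bump_kernel L (Complex c v)) = bump_transform L n"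
  unfolding bump_transform_def
proof (rule vertical_line_shift[OF nat_powr_kernel_holomorphic[OF n] open_UNIV convex_UNIV c L, symmetric])
  fix w assume w: "0 \<le> Re w" "Re w \<le> c"
  have "norm (npow n w * bump_kernel L w)
     \<le> real n powr (- Re w) * exp (L * Re w) * (64 * L ^ 4) / (1 + (L * Im w)\<^sup>2)"
    by (rule nat_powr_kernel_norm[OF L n w(1)])
  also have "\<dots> \<le> 1 * exp (L * c) * (64 * L ^ 4) / (1 + (L * Im w)\<^sup>2)"
    using powr_mono[of "- Re w" 0 "real n"] n w L by (intro divide_right_mono mult_mono) auto
  finally show "norm (npow n w * bump_kernel L w) \<le> 1 * exp (L * c) * (64 * L ^ 4) / (1 + (L * Im w)\<^sup>2)" .
qed auto

text \<open>The transform does not depend on the line, so c is free: c = 0 gives the bound for the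
  coefficients of the Dirichlet polynomial, and arbitrarily large c gives the truncation at
  e^L.\<close>

lemma norm_bump_transform_le:
  assumes L: "L > 0" and n: "n \<ge> 1" and c: "c \<ge> 0"
  shows "norm (bump_transform L n) \<le> (exp L / real n) powr c * (64 * pi * L ^ 3)"
proof -
  have "norm (LINT v|lborel. npow n (Complex c v) * bump_kernel L (Complex c v))
      \<le> real n powr (- c) * exp (L * c) * (64 * L ^ 4) * (pi / L)"
    by (rule integrable_vertical_line(2)[OF continuous_on_vertical[OF nat_powr_kernel_holomorphic[OF n]] L])
       (use nat_powr_kernel_norm[OF L n, of "Complex c _"] c in auto)
  also have "\<dots> = (exp L / real n) powr c * (64 * pi * L ^ 3)"
    using L n by (simp add: powr_divide powr_minus exp_powr_real field_simps power4_eq_xxxx power3_eq_cube)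
  finally show ?thesis by (simp only: bump_transform_shift[OF assms])
qed

text \<open>Moving the line of integration to \<open>+\<infinity>\<close>, where \<open>n\<close> beats the exponential type of the kernel.\<close>

lemma bump_transform_eq_0:
  assumes L: "L > 0" and n: "real n > exp L"
  shows "bump_transform L n = 0"
proof -
  have n1: "n \<ge> 1" using n exp_gt_zero[of L] by (cases n) auto
  define q where "q = exp L / real n"
  have q: "0 < q" "q < 1" using n n1 by (auto simp: q_def)
  have le: "norm (bump_transform L n) \<le> q ^ k * (64 * pi * L ^ 3)" for k
    using norm_bump_transform_le[OF L n1, of "real k"] q by (simp add: q_def powr_realpow)
  have "(\<lambda>k. q ^ k * (64 * pi * L ^ 3)) \<longlonglongrightarrow> 0 * (64 * pi * L ^ 3)"
    using q by (intro tendsto_intros LIMSEQ_power_zero) auto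
  then have "norm (bump_transform L n) \<le> 0"
    using le by (intro LIMSEQ_le_const) auto
  then show ?thesis by simp
qed

lemma finite_nat_le_real: "finite {n. real n \<le> x}"
proof (rule finite_subset)
  show "{n. real n \<le> x} \<subseteq> {..nat \<lceil>x\<rceil>}" by (auto simp: le_nat_iff) linarith
qed simp

text \<open>On the line Re s + c > 1 the series converges absolutely and may be integrated term by
  term. Each term is entire in w, so it alone is moved back to the imaginary axis, and the result
  makes sense although s itself may lie to the left of Re s = 1.\<close>

lemma mangoldt_kernel_integral:
  assumes L: "L > 0" and c: "c \<ge> 0" and s: "Re s + c > 1"
  shows "(LINT v|lborel. mangoldt_series (s + Complex c v) * bump_kernel L (Complex c v))
     = (\<Sum>n | real n \<le> exp L. mangoldt n * npow n s * bump_transform L n)"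
proof -
  define f where "f = (\<lambda>n v. mangoldt n * npow n (s + Complex c v) * bump_kernel L (Complex c v))"
  define \<sigma> where "\<sigma> = Re s + c"
  define B where "B = exp (L * c) * (64 * L ^ 4)"
  have B: "B \<ge> 0" using L by (simp add: B_def)
  have feq: "f n v = mangoldt n * npow n s * (npow n (Complex c v) * bump_kernel L (Complex c v))" for n v
  proof -
    have "- (s + Complex c v) = - s + - Complex c v" by simp
    then show ?thesis unfolding f_def by (simp only: powr_add mult.assoc)
  qed
  have kb: "norm (bump_kernel L (Complex c v)) \<le> B / (1 + (L * v)\<^sup>2)" for v
    using nat_powr_kernel_norm[OF L, of 1 "Complex c v"] c by (simp add: B_def)
  have fb: "norm (f n v) \<le> mangoldt n * real n powr (- \<sigma>) * (B / (1 + (L * v)\<^sup>2))" for n v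
  proof -
    have "norm (f n v) = mangoldt n * real n powr (- \<sigma>) * norm (bump_kernel L (Complex c v))"
      unfolding f_def norm_mult norm_nat_powr by (simp add: \<sigma>_def)
    also have "\<dots> \<le> mangoldt n * real n powr (- \<sigma>) * (B / (1 + (L * v)\<^sup>2))"
      by (intro mult_left_mono kb mult_nonneg_nonneg mangoldt_nonneg) simp
    finally show ?thesis .
  qed
  have ck: "continuous_on UNIV (\<lambda>v. bump_kernel L (Complex c v))"
    by (rule continuous_on_vertical[OF bump_kernel_holomorphic]) simp
  have fc: "continuous_on UNIV (f n)" for n
  proof (cases "n \<ge> 1")
    case True
    show ?thesis unfolding feq[abs_def]
      by (intro continuous_intros continuous_on_vertical[OF nat_powr_kernel_holomorphic[OF True, of L]]) simp
  next
    case False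
    then have "f n = (\<lambda>_. 0)" by (simp add: f_def fun_eq_iff)
    then show ?thesis by simp
  qed
  have fi: "integrable lborel (f n)" for n
    by (rule integrable_vertical_line(1)[OF fc L, of _ "mangoldt n * real n powr (- \<sigma>) * B"]) (use fb in simp)
  have sm: "summable (\<lambda>n. mangoldt n * real n powr (- \<sigma>))" using s by (intro summable_mangoldt_powr) (simp add: \<sigma>_def)
  have "(\<lambda>n. LINT v|lborel. f n v) sums (LINT v|lborel. (\<Sum>n. f n v))"
  proof (rule sums_integral[OF fi])
    show "AE v in lborel. summable (\<lambda>n. norm (f n v))"
    proof (rule AE_I2)
      fix v
      show "summable (\<lambda>n. norm (f n v))"
        by (rule summable_comparison_test'[OF summable_mult2[OF sm, of "B / (1 + (L * v)\<^sup>2)"], of 0]) (use fb in simp)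
    qed
    show "summable (\<lambda>n. LINT v|lborel. norm (f n v))"
    proof (rule summable_comparison_test'[OF summable_mult2[OF sm, of "B * (pi / L)"], of 0])
      fix n :: nat
      have "(LINT v|lborel. norm (f n v)) \<le> (LINT v|lborel. mangoldt n * real n powr (- \<sigma>) * B * (1 / (1 + (L * v)\<^sup>2)))"
        by (rule integral_mono[OF integrable_norm[OF fi] integrable_mult_right[OF Cauchy_kernel_integral(1)[OF L]]])
           (use fb in simp)
      also have "\<dots> = mangoldt n * real n powr (- \<sigma>) * B * (pi / L)"
        using Cauchy_kernel_integral(2)[OF L] by (simp only: integral_mult_right_zero)
      finally show "norm (LINT v|lborel. norm (f n v)) \<le> mangoldt n * real n powr (- \<sigma>) * (B * (pi / L))"
        by (simp add: mult.assoc)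
    qed
  qed
  moreover have "(\<Sum>n. f n v) = mangoldt_series (s + Complex c v) * bump_kernel L (Complex c v)" for v
    using sums_mult2[OF mangoldt_series_sums[of "s + Complex c v"], of "bump_kernel L (Complex c v)"] s
    by (simp add: f_def sums_iff)
  moreover have "(LINT v|lborel. f n v) = mangoldt n * npow n s * bump_transform L n" for n
  proof (cases "n \<ge> 1")
    case True
    show ?thesis unfolding feq by (simp only: integral_mult_right_zero bump_transform_shift[OF L True c])
  next
    case False
    then have "n = 0" by simp
    then show ?thesis by (simp add: f_def)
  qed
  ultimately have "(LINT v|lborel. mangoldt_series (s + Complex c v) * bump_kernel L (Complex c v))
      = (\<Sum>n. mangoldt n * npow n s * bump_transform L n)"
    by (simp add: sums_iff)
  also have "\<dots> = (\<Sum>n | real n \<le> exp L. mangoldt n * npow n s * bump_transform L n)"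
    by (rule suminf_finite) (use finite_nat_le_real bump_transform_eq_0[OF L] in auto)
  finally show ?thesis .
qed

section \<open>A pointwise bound for nearby zeros by a Dirichlet polynomial\<close>

definition ordinates_half :: "real \<Rightarrow> real set" where
  "ordinates_half t = {\<gamma> \<in> zeta_ordinates. \<bar>\<gamma> - t\<bar> \<le> 1/2}"

abbreviation (input) zero_sum :: "real \<Rightarrow> real \<Rightarrow> real" where
  "zero_sum b t \<equiv> \<Sum>\<gamma>\<in>ordinates_half t. omult \<gamma> * Poisson b (t - \<gamma>)"

abbreviation (input) mangoldt_poly :: "nat set \<Rightarrow> (nat \<Rightarrow> complex) \<Rightarrow> real \<Rightarrow> complex" where
  "mangoldt_poly A d t \<equiv> \<Sum>n\<in>A. mangoldt n * npow n (Complex (1/2) t) * d n"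

lemma ordinates_half_near: "\<bar>v\<bar> \<le> 1/4 \<Longrightarrow> ordinates_half t \<subseteq> ordinates_near (t + v)"
  unfolding ordinates_half_def ordinates_near_def by (intro subsetI CollectI conjI) (blast, unfold mem_Collect_eq, linarith)

text \<open>A shift by at most the width b costs a Poisson kernel at most a factor 3. This turns an
  average over heights t + v with |v| <= b into a bound at t itself.\<close>

lemma Poisson_kernel_shift_ge:
  fixes b u v :: real assumes b: "b > 0" and v: "\<bar>v\<bar> \<le> b"
  shows "b / (b\<^sup>2 + (u + v)\<^sup>2) \<ge> 1/3 * (b / (b\<^sup>2 + u\<^sup>2))"
proof -
  have "v\<^sup>2 \<le> b\<^sup>2" using v b by (simp add: abs_le_square_iff[symmetric])
  moreover have "(u + v)\<^sup>2 \<le> 2 * u\<^sup>2 + 2 * v\<^sup>2"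
    using zero_le_power2[of "u - v"] by (simp add: power2_eq_square algebra_simps)
  ultimately have "b\<^sup>2 + (u + v)\<^sup>2 \<le> 3 * (b\<^sup>2 + u\<^sup>2)" using zero_le_power2[of u] unfolding distrib_left by linarith
  moreover have "b\<^sup>2 + (u + v)\<^sup>2 > 0" using b by (simp add: add_pos_nonneg)
  ultimately have "b / (3 * (b\<^sup>2 + u\<^sup>2)) \<le> b / (b\<^sup>2 + (u + v)\<^sup>2)" using b by (intro frac_le) auto
  then show ?thesis by simp
qed

text \<open>A Peetre-type inequality: the pole term keeps its decay in t, at the price of a weight 1
  + |v| that the kernel absorbs.\<close>

lemma norm_Complex_1_ge: "1 / norm (Complex 1 (t + v)) \<le> 2 * (1 + \<bar>v\<bar>) / (1 + \<bar>t\<bar>)"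
proof -
  have "\<bar>t + v\<bar> \<le> norm (Complex 1 (t + v))" "1 \<le> norm (Complex 1 (t + v))"
    using abs_Im_le_cmod[of "Complex 1 (t + v)"] abs_Re_le_cmod[of "Complex 1 (t + v)"] by auto
  then have 1: "1 + \<bar>t + v\<bar> \<le> 2 * norm (Complex 1 (t + v))" by linarith
  have "1 + \<bar>t\<bar> \<le> 1 + \<bar>t + v\<bar> + \<bar>v\<bar> + \<bar>t + v\<bar> * \<bar>v\<bar>"
  proof -
    have "0 \<le> \<bar>t + v\<bar> * \<bar>v\<bar>" by simp
    then show ?thesis using abs_triangle_ineq4[of "t + v" v] by linarith
  qed
  also have "\<dots> = (1 + \<bar>t + v\<bar>) * (1 + \<bar>v\<bar>)" by (simp add: algebra_simps)
  also have "\<dots> \<le> 2 * norm (Complex 1 (t + v)) * (1 + \<bar>v\<bar>)" using 1 by (intro mult_right_mono) auto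
  finally have "(1 + \<bar>t\<bar>) * 1 \<le> 2 * (1 + \<bar>v\<bar>) * norm (Complex 1 (t + v))" by (simp add: algebra_simps)
  moreover have "norm (Complex 1 (t + v)) > 0" "1 + \<bar>t\<bar> > 0"
    by (auto simp: complex_eq_iff add_pos_nonneg)
  moreover have "1 / N \<le> V / T" if "T * 1 \<le> V * N" "N > 0" "T > 0" for N T V :: real
    using that by (simp add: field_simps)
  ultimately show ?thesis by blast
qed

text \<open>The coefficients \<open>d\<close> are fixed before t, as a moment over t requires, and
  their bound is independent of L. The condition L >= 4 means b <= 1/4, so that shifting the height
  by at most b keeps \<open>ordinates_half t\<close> inside the window of
  \<open>ordinates_near\<close>.\<close>

theorem zero_sum_le_Dirichlet_polynomial:
  assumes RH: riemann_hypothesis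
  shows "\<exists>C>0. \<forall>L\<ge>4. \<exists>d :: nat \<Rightarrow> complex. (\<forall>n. norm (d n) \<le> C) \<and>
    (\<forall>t. zero_sum (1/L) t
      \<le> C * (ell t + exp (3/2 * L) / (1 + \<bar>t\<bar>))
        + norm (mangoldt_poly {n. real n \<le> exp L} d t))"
proof -
  obtain C0 where C0: "C0 > 0" and fin: "\<And>t. finite (ordinates_near t)"
    and lower: "\<And>t b. 0 < b \<Longrightarrow> b \<le> 3/2 \<Longrightarrow>
      Re (zeta_reg_logderiv (Complex (1/2 + b) t)) \<ge>
        (\<Sum>\<gamma>\<in>ordinates_near t. omult \<gamma> * Poisson b (t - \<gamma>)) - C0 * ell t"
    and upper: "\<And>t b. 0 < b \<Longrightarrow> b \<le> 3/2 \<Longrightarrow>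
      norm (zeta_reg_logderiv (Complex (1/2 + b) t)) \<le> C0 * ell t * (1 + 1 / b)"
    using RH_log_deriv_bounds[OF RH] by blast
  define C where "C = 384 * 256 * pi * (C0 + 1)"
  have C: "C > 0" "384 * 128 * pi * C0 \<le> C" "384 * 256 * pi \<le> C" "384 * 64 * pi \<le> C"
    using C0 by (auto simp: C_def algebra_simps intro!: add_pos_pos)
  show ?thesis
  proof (rule exI[of _ C], intro conjI allI impI C(1))
    fix L :: real assume L4: "L \<ge> 4"
    define b where "b = 1 / L"
    \<comment> \<open>The shift ends at Re (s + w) = 2, where the Dirichlet series is available and
      up to which the bound \<open>upper\<close> is valid.\<close>
    define c where "c = 3/2 - b"
    have L: "L > 0" "L \<ge> 1" using L4 by auto
    have b: "0 < b" "b \<le> 1/4" using L4 by (auto simp: b_def field_simps)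
    have c: "c \<ge> 0" "c \<le> 3/2" using b by (auto simp: c_def)
    define d where "d = (\<lambda>n::nat. if n = 0 then 0 else of_nat n powr (- of_real b) * bump_transform L n * of_real (384 / L ^ 3))"
    have db: "norm (d n) \<le> C" for n
    proof (cases "n = 0")
      case False
      have n1: "n \<ge> 1" using False by simp
      have "norm (d n) = real n powr (- b) * norm (bump_transform L n) * (384 / L ^ 3)"
        using False L by (simp add: d_def norm_mult norm_nat_powr norm_divide norm_power)
      also have "\<dots> \<le> 1 * (64 * pi * L ^ 3) * (384 / L ^ 3)"
        using norm_bump_transform_le[OF L(1) n1, of 0] powr_mono[of "- b" 0 "real n"] n1 b L
        by (intro mult_mono) auto
      also have "\<dots> = 384 * 64 * pi" using L by simp
      finally show ?thesis using C(4) by linarith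
    qed (use C in \<open>simp add: d_def\<close>)
    have "zero_sum b t
      \<le> C * (ell t + exp (3/2 * L) / (1 + \<bar>t\<bar>))
        + norm (mangoldt_poly {n. real n \<le> exp L} d t)" for t
    proof -
      define s where "s = Complex (1/2 + b) t"
      define g where "g = (\<lambda>z. zeta_reg_logderiv z)"
      define f where "f = (\<lambda>w. g (s + w) * bump_kernel L w)"
      define H where "H = {w. Re w > - b}"
      define S where "S = zero_sum b t"
      define D where "D = (mangoldt_poly {n. real n \<le> exp L} d t)"
      have sw: "s + w = Complex (1/2 + (b + Re w)) (t + Im w)" for w by (simp add: s_def complex_eq_iff)
      have gh: "g holomorphic_on {z. Re z > 1/2}"
        unfolding g_def
      proof (rule holomorphic_on_divide)
        show h: "zeta_reg holomorphic_on {z. Re z > 1/2}"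
          by (rule holomorphic_on_subset[OF zeta_reg_holomorphic]) auto
        show "deriv zeta_reg holomorphic_on {z. Re z > 1/2}"
          by (rule holomorphic_deriv[OF h open_halfspace_Re_gt])
        show "zeta_reg z \<noteq> 0" if "z \<in> {z. Re z > 1/2}" for z
          using RH_zeta_reg_zero[OF RH, of z] that by auto
      qed
      have fh: "f holomorphic_on H"
      proof -
        have "(g \<circ> (\<lambda>w. s + w)) holomorphic_on H"
          by (rule holomorphic_on_compose_gen[OF _ gh]) (auto intro!: holomorphic_intros simp: H_def s_def)
        then show ?thesis unfolding f_def o_def
          by (intro holomorphic_on_mult holomorphic_on_subset[OF bump_kernel_holomorphic]) auto
      qed
      have kw: "norm (bump_kernel L w) * (1 + \<bar>Im w\<bar>) \<le> exp (L * Re w) * (128 * L ^ 4 / (1 + (L * Im w)\<^sup>2))" if "Re w \<ge> 0" for w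
      proof -
        have "norm (bump_kernel L w) * (1 + \<bar>Im w\<bar>) \<le> exp (L * Re w) * (64 * L ^ 4 / (1 + (L * Im w)\<^sup>2)\<^sup>2) * (1 + \<bar>Im w\<bar>)"
          by (intro mult_right_mono bump_kernel_norm_le L that) auto
        also have "\<dots> = exp (L * Re w) * ((1 + \<bar>Im w\<bar>) * (64 * L ^ 4 / (1 + (L * Im w)\<^sup>2)\<^sup>2))" by (simp only: mult_ac)
        also have "\<dots> \<le> exp (L * Re w) * (128 * L ^ 4 / (1 + (L * Im w)\<^sup>2))"
          by (intro mult_left_mono kernel_weight_le L) auto
        finally show ?thesis .
      qed
      \<comment> \<open>A crude majorant, of use for integrability and for the vanishing of the
        horizontal segments only.\<close>
      define A where "A = C0 * ell t * (1 + L) * exp (L * c) * (128 * L ^ 4)"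
      have l0: "ell t > 0" using ell_ge_1[of t] by simp
      have fb: "norm (f w) \<le> A / (1 + (L * Im w)\<^sup>2)" if w: "0 \<le> Re w" "Re w \<le> c" for w
      proof -
        have "norm (g (s + w)) \<le> C0 * ell (t + Im w) * (1 + 1 / (b + Re w))"
          unfolding sw g_def by (rule upper) (use b w in \<open>auto simp: c_def\<close>)
        also have "\<dots> \<le> C0 * (ell t * (1 + \<bar>Im w\<bar>)) * (1 + L)"
        proof (intro mult_mono)
          have "1 / (b + Re w) \<le> 1 / b" using b w by (intro frac_le) auto
          then show "1 + 1 / (b + Re w) \<le> 1 + L" by (simp add: b_def)
        qed (use C0 ell_add_le l0 b w order_trans[OF zero_le_one ell_ge_1] in auto)
        finally have "norm (f w) \<le> C0 * (ell t * (1 + \<bar>Im w\<bar>)) * (1 + L) * norm (bump_kernel L w)"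
          unfolding f_def norm_mult by (rule mult_right_mono) simp
        also have "\<dots> = C0 * ell t * (1 + L) * (norm (bump_kernel L w) * (1 + \<bar>Im w\<bar>))" by (simp only: mult_ac)
        also have "\<dots> \<le> C0 * ell t * (1 + L) * (exp (L * c) * (128 * L ^ 4 / (1 + (L * Im w)\<^sup>2)))"
        proof (intro mult_left_mono)
          have "exp (L * Re w) * (128 * L ^ 4 / (1 + (L * Im w)\<^sup>2)) \<le> exp (L * c) * (128 * L ^ 4 / (1 + (L * Im w)\<^sup>2))"
            using w L by (intro mult_right_mono) auto
          then show "norm (bump_kernel L w) * (1 + \<bar>Im w\<bar>) \<le> exp (L * c) * (128 * L ^ 4 / (1 + (L * Im w)\<^sup>2))"
            using kw[OF w(1)] by linarith
        qed (use C0 l0 L in auto)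
        finally show ?thesis by (simp add: A_def)
      qed
      have inH: "w \<in> H" if "0 \<le> Re w" for w using that b by (simp add: H_def)
      have shift: "(LINT v|lborel. f (Complex 0 v)) = (LINT v|lborel. f (Complex c v))"
        by (rule vertical_line_shift[OF fh _ _ c(1) L(1)])
           (use fb inH in \<open>auto simp: H_def open_halfspace_Re_gt convex_halfspace_Re_gt\<close>)
      have int0: "integrable lborel (\<lambda>v. f (Complex 0 v))"
        by (rule integrable_vertical_line(1)[OF continuous_on_vertical[OF fh] L(1), of _ A])
           (use fb[of "Complex 0 _"] c inH in auto)
      have intc: "integrable lborel (\<lambda>v. f (Complex c v))"
        by (rule integrable_vertical_line(1)[OF continuous_on_vertical[OF fh] L(1), of _ A])
           (use fb[of "Complex c _"] c inH in auto)
      define E where "E = C0 * ell t * (128 * L ^ 4)"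
      \<comment> \<open>For |v| <= b the kernel is at least L^4 / 256 and the Poisson sum at height
        t + v at least S / 3, whence 768. For |v| > b the nonnegative product of the two is
        discarded. Integration over an interval of length 2/L then yields L^3 / 384.\<close>
      have low: "Re (f (Complex 0 v)) \<ge> L ^ 4 / 768 * S * indicator {- b..b} v - E * (1 / (1 + (L * v)\<^sup>2))" for v
      proof -
        define k where "k = Re (bump_kernel L (Complex 0 v))"
        have k: "bump_kernel L (Complex 0 v) = of_real k" "k \<ge> 0"
          unfolding k_def bump_kernel_imaginary by auto
        define N where "N = (\<Sum>\<gamma>\<in>ordinates_near (t + v). omult \<gamma> * Poisson b (t + v - \<gamma>))"
        have "Re (g (s + Complex 0 v)) \<ge> N - C0 * ell (t + v)"
          using lower[of b "t + v"] b unfolding sw g_def N_def by simp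
        then have "Re (f (Complex 0 v)) \<ge> (N - C0 * ell (t + v)) * k"
          unfolding f_def k(1) using k(2) by (simp add: mult_right_mono)
        moreover have "C0 * ell (t + v) * k \<le> E * (1 / (1 + (L * v)\<^sup>2))"
        proof -
          have "C0 * ell (t + v) * k \<le> C0 * (ell t * (1 + \<bar>v\<bar>)) * k"
            using C0 k ell_add_le by (intro mult_right_mono mult_left_mono) auto
          also have "\<dots> = C0 * ell t * (k * (1 + \<bar>v\<bar>))" by (simp only: mult_ac)
          also have "k * (1 + \<bar>v\<bar>) \<le> 128 * L ^ 4 / (1 + (L * v)\<^sup>2)"
            using kw[of "Complex 0 v"] k by simp
          finally show ?thesis using C0 l0 by (simp add: E_def mult_left_mono)
        qed
        moreover have "L ^ 4 / 768 * S * indicator {- b..b} v \<le> N * k"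
        proof (cases "v \<in> {- b..b}")
          case True
          then have v: "\<bar>v\<bar> \<le> b" by auto
          have "1/3 * S \<le> (\<Sum>\<gamma>\<in>ordinates_half t. omult \<gamma> * Poisson b (t + v - \<gamma>))"
            unfolding S_def sum_distrib_left
          proof (rule sum_mono)
            fix \<gamma>
            have "1/3 * Poisson b (t - \<gamma>) \<le> b / (b\<^sup>2 + ((t - \<gamma>) + v)\<^sup>2)"
              by (rule Poisson_kernel_shift_ge[OF b(1) v])
            then have "omult \<gamma> * (1/3 * Poisson b (t - \<gamma>)) \<le> omult \<gamma> * Poisson b ((t - \<gamma>) + v)"
              by (rule mult_left_mono) simp
            then show "1/3 * (omult \<gamma> * Poisson b (t - \<gamma>)) \<le> omult \<gamma> * Poisson b (t + v - \<gamma>)"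
              by (simp add: algebra_simps)
          qed
          also have "\<dots> \<le> N" unfolding N_def
            by (rule sum_mono2[OF fin ordinates_half_near]) (use v b in auto)
          finally have SN: "1/3 * S \<le> N" .
          have k4: "L ^ 4 / 256 \<le> k" unfolding k_def
            by (rule bump_kernel_imaginary_ge) (use L v in \<open>auto simp: b_def\<close>)
          have S0: "S \<ge> 0" unfolding S_def using b by (intro sum_nonneg) auto
          have "1/3 * S * (L ^ 4 / 256) \<le> N * k"
            using SN k4 S0 L k by (intro mult_mono) auto
          then show ?thesis using True by (simp add: mult_ac)
        next
          case False
          have "N \<ge> 0" unfolding N_def using b by (intro sum_nonneg) auto
          then show ?thesis using False k by simp
        qed
        ultimately show ?thesis by (simp add: left_diff_distrib)
      qed
      have i1: "integrable lborel (\<lambda>v. L ^ 4 / 768 * S * indicator {- b..b} v)"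
        using b by (intro integrable_mult_right integrable_real_indicator) auto
      have i2: "integrable lborel (\<lambda>v. E * (1 / (1 + (L * v)\<^sup>2)))"
        by (intro integrable_mult_right Cauchy_kernel_integral L)
      have "L ^ 3 / 384 * S - E * (pi / L) = (LINT v|lborel. L ^ 4 / 768 * S * indicator {- b..b} v - E * (1 / (1 + (L * v)\<^sup>2)))"
      proof -
        have "(LINT v|lborel. L ^ 4 / 768 * S * indicator {- b..b} v - E * (1 / (1 + (L * v)\<^sup>2)))
          = (LINT v|lborel. L ^ 4 / 768 * S * indicator {- b..b} v) - (LINT v|lborel. E * (1 / (1 + (L * v)\<^sup>2)))"
          by (rule Bochner_Integration.integral_diff[OF i1 i2])
        also have "(LINT v|lborel. E * (1 / (1 + (L * v)\<^sup>2))) = E * (pi / L)"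
          using Cauchy_kernel_integral(2)[OF L(1)] by (simp only: integral_mult_right_zero)
        also have "(LINT v|lborel. L ^ 4 / 768 * S * indicator {- b..b} v) = L ^ 4 / 768 * S * (2 * b)"
          using b by (simp only: integral_mult_right_zero) simp
        also have "\<dots> = L ^ 3 / 384 * S" using L by (simp add: b_def power4_eq_xxxx power3_eq_cube)
        finally show ?thesis by simp
      qed
      also have "\<dots> \<le> (LINT v|lborel. Re (f (Complex 0 v)))"
        by (rule integral_mono[OF Bochner_Integration.integrable_diff[OF i1 i2] integrable_Re[OF int0] low])
      also have "\<dots> = Re (LINT v|lborel. f (Complex c v))"
        using int0 by (simp add: shift[symmetric])
      also have "\<dots> \<le> norm (LINT v|lborel. f (Complex c v))" by (rule complex_Re_le_cmod)
      also have "\<dots> \<le> 256 * pi * L ^ 3 * exp (3/2 * L) / (1 + \<bar>t\<bar>) + L ^ 3 / 384 * norm D"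
      proof -
        have sc: "s + Complex c v = Complex 2 (t + v)" for v by (simp add: s_def c_def complex_eq_iff)
        let ?J = "LINT v|lborel. mangoldt_series (s + Complex c v) * bump_kernel L (Complex c v)"
        \<comment> \<open>The contribution of 1/(s - 1) in \<open>zeta_reg_log_deriv\<close>. It is
          the source of the error e^(3L/2) / (1 + |t|), where 3/2 bounds the length c of the
          shift.\<close>
        define p where "p = (\<lambda>w. 1 / (s + w - 1) * bump_kernel L w)"
        have fp: "f (Complex c v) = p (Complex c v) - mangoldt_series (s + Complex c v) * bump_kernel L (Complex c v)" for v
          unfolding f_def g_def p_def using zeta_reg_log_deriv[of "s + Complex c v"] sc[of v] by (simp add: left_diff_distrib)
        have pb: "norm (p (Complex c v)) \<le> 2 / (1 + \<bar>t\<bar>) * exp (3/2 * L) * (128 * L ^ 4) / (1 + (L * v)\<^sup>2)" for v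
        proof -
          have s1: "s + Complex c v - 1 = Complex 1 (t + v)" by (simp add: sc complex_eq_iff)
          have "norm (p (Complex c v)) = 1 / norm (Complex 1 (t + v)) * norm (bump_kernel L (Complex c v))"
            unfolding p_def s1 by (simp add: norm_mult norm_divide)
          also have "\<dots> \<le> 2 * (1 + \<bar>v\<bar>) / (1 + \<bar>t\<bar>) * norm (bump_kernel L (Complex c v))"
            by (intro mult_right_mono norm_Complex_1_ge) simp
          also have "\<dots> = 2 / (1 + \<bar>t\<bar>) * (norm (bump_kernel L (Complex c v)) * (1 + \<bar>v\<bar>))" by simp
          also have "\<dots> \<le> 2 / (1 + \<bar>t\<bar>) * (exp (3/2 * L) * (128 * L ^ 4 / (1 + (L * v)\<^sup>2)))"
          proof (intro mult_left_mono)
            have "exp (L * c) * (128 * L ^ 4 / (1 + (L * v)\<^sup>2)) \<le> exp (3/2 * L) * (128 * L ^ 4 / (1 + (L * v)\<^sup>2))"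
              using c L by (intro mult_right_mono) auto
            then show "norm (bump_kernel L (Complex c v)) * (1 + \<bar>v\<bar>) \<le> exp (3/2 * L) * (128 * L ^ 4 / (1 + (L * v)\<^sup>2))"
              using kw[of "Complex c v"] c by simp
          qed simp
          finally show ?thesis by simp
        qed
        have pc: "continuous_on UNIV (\<lambda>v. p (Complex c v))"
        proof (rule continuous_on_vertical)
          show "p holomorphic_on {w. Re w > 1/2 - b}" unfolding p_def
            by (intro holomorphic_on_mult holomorphic_on_subset[OF bump_kernel_holomorphic] holomorphic_intros)
               (auto simp: s_def complex_eq_iff)
          show "Complex c v \<in> {w. Re w > 1/2 - b}" for v by (simp add: c_def)
        qed
        note pI = integrable_vertical_line[OF pc L(1) pb]
        have "(LINT v|lborel. f (Complex c v)) = (LINT v|lborel. p (Complex c v))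
            - ?J"
        proof -
          have "integrable lborel (\<lambda>v. p (Complex c v) - f (Complex c v))"
            by (rule Bochner_Integration.integrable_diff[OF pI(1) intc])
          then have "integrable lborel (\<lambda>v. mangoldt_series (s + Complex c v) * bump_kernel L (Complex c v))"
            by (simp add: fp)
          then show ?thesis unfolding fp using pI(1) by (rule Bochner_Integration.integral_diff[rotated])
        qed
        then have "norm (LINT v|lborel. f (Complex c v)) \<le> norm (LINT v|lborel. p (Complex c v))
            + norm ?J"
          by (simp add: norm_triangle_ineq4)
        moreover have "norm (LINT v|lborel. p (Complex c v)) \<le> 256 * pi * L ^ 3 * exp (3/2 * L) / (1 + \<bar>t\<bar>)"
          using pI(2) L by (simp add: power4_eq_xxxx power3_eq_cube field_simps)
        moreover have "?J = of_real (L ^ 3 / 384) * D"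
        proof -
          have "?J
             = (\<Sum>n | real n \<le> exp L. mangoldt n * npow n s * bump_transform L n)"
            by (rule mangoldt_kernel_integral[OF L(1) c(1)]) (simp add: s_def c_def)
          also have "\<dots> = of_real (L ^ 3 / 384) * D"
            unfolding D_def sum_distrib_left
          proof (rule sum.cong)
            fix n :: nat
            show "mangoldt n * npow n s * bump_transform L n
               = of_real (L ^ 3 / 384) * (mangoldt n * npow n (Complex (1/2) t) * d n)"
            proof (cases "n = 0")
              case False
              have "- s = - Complex (1/2) t + - of_real b" by (simp add: s_def complex_eq_iff)
              then have "npow n s = npow n (Complex (1/2) t) * (of_nat n powr (- of_real b) :: complex)"
                by (simp only: powr_add)
              then show ?thesis using False L by (simp add: d_def)
            qed simp
          qed simp
          finally show ?thesis .
        qed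
        then have "norm ?J = L ^ 3 / 384 * norm D"
          using L by (simp only: norm_mult norm_of_real) simp
        ultimately show ?thesis by linarith
      qed
      finally have "L ^ 3 / 384 * S \<le> E * (pi / L) + 256 * pi * L ^ 3 * exp (3/2 * L) / (1 + \<bar>t\<bar>) + L ^ 3 / 384 * norm D"
        by linarith
      then have "384 / L ^ 3 * (L ^ 3 / 384 * S) \<le> 384 / L ^ 3 * (E * (pi / L) + 256 * pi * L ^ 3 * exp (3/2 * L) / (1 + \<bar>t\<bar>) + L ^ 3 / 384 * norm D)"
        using L by (intro mult_left_mono) auto
      also have "384 / L ^ 3 * (E * (pi / L) + 256 * pi * L ^ 3 * exp (3/2 * L) / (1 + \<bar>t\<bar>) + L ^ 3 / 384 * norm D)
         = 384 * 128 * pi * C0 * ell t + 384 * 256 * pi * (exp (3/2 * L) / (1 + \<bar>t\<bar>)) + norm D"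
      proof -
        have "384 / L ^ 3 * (E * (pi / L)) = 384 * 128 * pi * C0 * ell t"
          using L by (simp add: E_def power4_eq_xxxx power3_eq_cube)
        moreover have "384 / L ^ 3 * (256 * pi * L ^ 3 * exp (3/2 * L) / (1 + \<bar>t\<bar>)) = 384 * 256 * pi * (exp (3/2 * L) / (1 + \<bar>t\<bar>))"
          using L by simp
        moreover have "384 / L ^ 3 * (L ^ 3 / 384 * norm D) = norm D" using L by simp
        ultimately show ?thesis by (simp only: distrib_left)
      qed
      also have "\<dots> \<le> C * ell t + C * (exp (3/2 * L) / (1 + \<bar>t\<bar>)) + norm D"
        using C l0 by (intro add_mono mult_right_mono) auto
      also have "384 / L ^ 3 * (L ^ 3 / 384 * S) = S" using L by simp
      finally show ?thesis unfolding S_def D_def distrib_left .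
    qed
    then show "\<exists>d :: nat \<Rightarrow> complex. (\<forall>n. norm (d n) \<le> C) \<and>
      (\<forall>t. zero_sum (1/L) t
      \<le> C * (ell t + exp (3/2 * L) / (1 + \<bar>t\<bar>))
        + norm (mangoldt_poly {n. real n \<le> exp L} d t))"
      using db unfolding b_def by blast
  qed
qed

section \<open>Moments of Dirichlet polynomials over primes\<close>

text \<open>Ordered lists keep the expansion free of multinomial coefficients; these return later as
  the number of orderings in \<open>card_mset_eq_le\<close>.\<close>

lemma sum_power_lists:
  fixes f :: "'a \<Rightarrow> 'b :: comm_semiring_1"
  assumes "finite P"
  shows "(\<Sum>p\<in>P. f p) ^ k = (\<Sum>ps | set ps \<subseteq> P \<and> length ps = k. prod_list (map f ps))"
proof (induction k)
  case 0
  have "{ps. set ps \<subseteq> P \<and> length ps = 0} = {[]}" by auto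
  then show ?case by simp
next
  case (Suc k)
  have inj: "inj_on (\<lambda>(xs, n). n # xs) ({xs. set xs \<subseteq> P \<and> length xs = k} \<times> P)" by (auto simp: inj_on_def)
  have "(\<Sum>ps | set ps \<subseteq> P \<and> length ps = Suc k. prod_list (map f ps))
     = (\<Sum>(xs, n)\<in>{xs. set xs \<subseteq> P \<and> length xs = k} \<times> P. f n * prod_list (map f xs))"
    unfolding lists_length_Suc_eq by (subst sum.reindex[OF inj]) (simp add: case_prod_unfold)
  also have "\<dots> = (\<Sum>xs | set xs \<subseteq> P \<and> length xs = k. \<Sum>n\<in>P. f n * prod_list (map f xs))"
    by (rule sum.cartesian_product[symmetric])
  also have "\<dots> = (\<Sum>p\<in>P. f p) * (\<Sum>xs | set xs \<subseteq> P \<and> length xs = k. prod_list (map f xs))"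
    by (simp add: sum_distrib_left sum_distrib_right mult.commute)
  finally show ?case using Suc by simp
qed

lemma norm_prod_list_map: "norm (prod_list (map f ps)) = prod_list (map (\<lambda>p. norm (f p :: complex)) ps)"
  by (induction ps) (auto simp: norm_mult)

lemma prod_list_map_mult: "prod_list (map (\<lambda>p. f p * g p :: 'a :: comm_monoid_mult) ps) = prod_list (map f ps) * prod_list (map g ps)"
  by (induction ps) (auto simp: mult_ac)

lemma prod_list_nat_powr:
  "prod_list (map (\<lambda>p. of_nat p powr z :: complex) ps) = of_nat (prod_list ps) powr z"
proof (induction ps)
  case (Cons p ps)
  have "(of_nat (p * prod_list ps) :: complex) powr z = of_nat p powr z * of_nat (prod_list ps) powr z"
    using powr_times_real[of "of_nat p" "of_nat (prod_list ps)" z] by simp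
  then show ?case using Cons by simp
qed simp

lemma prod_list_pos_primes: "\<forall>p\<in>set ps. prime (p::nat) \<Longrightarrow> prod_list ps > 0"
  by (induction ps) (auto simp: prime_gt_0_nat)

lemma prod_list_le_power:
  assumes "\<And>p. p \<in> set ps \<Longrightarrow> real p \<le> y"
  shows "real (prod_list ps) \<le> y ^ length ps"
  using assms
proof (induction ps)
  case (Cons p ps)
  have "real p * real (prod_list ps) \<le> y * y ^ length ps"
    using Cons by (intro mult_mono) (auto intro: order_trans[OF of_nat_0_le_iff])
  then show ?case by simp
qed simp

lemma prod_list_primes_eq_imp_mset_eq:
  fixes ps qs :: "nat list"
  assumes "\<forall>p\<in>set ps. prime p" "\<forall>p\<in>set qs. prime p" "prod_list ps = prod_list qs"
  shows "mset ps = mset qs"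
proof -
  have "prime_factorization (prod_mset (mset xs)) = mset xs" if "\<forall>p\<in>set xs. prime p" for xs :: "nat list"
    using that by (intro prime_factorization_prod_mset_primes) auto
  then show ?thesis using assms by (metis prod_mset_prod_list)
qed

lemma card_mset_eq_le: "card {qs. mset qs = mset ps} \<le> fact (length ps)"
proof -
  have "(\<Prod>x\<in>set_mset (mset ps). fact (count (mset ps) x) :: nat) \<ge> 1"
    by (intro prod_ge_1) (simp add: fact_ge_1)
  then have "card (permutations_of_multiset (mset ps)) * 1 \<le> card (permutations_of_multiset (mset ps)) * (\<Prod>x\<in>set_mset (mset ps). fact (count (mset ps) x))"
    by (intro mult_left_mono) auto
  also have "\<dots> = fact (length ps)" using card_permutations_of_multiset_aux[of "mset ps"] by simp
  finally show ?thesis by (simp add: permutations_of_multiset_def)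
qed

lemma nat_powr_imaginary_product:
  assumes "m > 0" "n > 0"
  shows "npow m (Complex 0 t) * cnj (npow n (Complex 0 t)) = cis (t * (ln (real n) - ln (real m)))"
proof -
  have e: "npow k (Complex 0 t) = cis (- t * ln (real k))" if "k > 0" for k :: nat
  proof -
    have "npow k (Complex 0 t) = exp (- Complex 0 t * of_real (ln (real k)))"
      using that by (simp add: powr_def Ln_of_nat)
    also have "- Complex 0 t * of_real (ln (real k)) = \<i> * of_real (- t * ln (real k))"
      by (simp add: complex_eq_iff)
    also have "exp \<dots> = cis (- t * ln (real k))" by (rule cis_conv_exp[symmetric])
    finally show ?thesis .
  qed
  show ?thesis using assms by (simp add: e cis_cnj cis_mult algebra_simps)
qed

lemma integral_cis_bound:
  assumes T: "T \<ge> 0"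
  shows "norm (integral {T..2*T} (\<lambda>t. cis (t * \<delta>))) \<le> T"
    "\<delta> \<noteq> 0 \<Longrightarrow> norm (integral {T..2*T} (\<lambda>t. cis (t * \<delta>))) \<le> 2 / \<bar>\<delta>\<bar>"
proof -
  let ?I = "integral {T..2*T} (\<lambda>t. cis (t * \<delta>))" and ?e = "\<i> * of_real \<delta>"
  have c: "continuous_on {T..2*T} (\<lambda>t. cis (t * \<delta>))" by (intro continuous_intros)
  have "norm (?I) \<le> 1 * (2 * T - T)"
    by (rule integral_bound) (use T c in auto)
  then show "norm (?I) \<le> T" by simp
  assume \<delta>: "\<delta> \<noteq> 0"
  have "((\<lambda>t. cis (t * \<delta>)) has_integral (cis (2 * T * \<delta>) / ?e - cis (T * \<delta>) / ?e)) {T..2*T}"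
  proof (rule fundamental_theorem_of_calculus)
    fix t assume "t \<in> {T..2*T}"
    have "((\<lambda>z. exp (\<i> * of_real \<delta> * z) / ?e) has_field_derivative exp (\<i> * of_real \<delta> * of_real t)) (at (of_real t))"
      using \<delta> by (auto intro!: derivative_eq_intros)
    then have "((\<lambda>t. exp (\<i> * of_real \<delta> * of_real t) / ?e) has_vector_derivative exp (\<i> * of_real \<delta> * of_real t)) (at t within {T..2*T})"
      by (rule has_vector_derivative_real_field)
    moreover have "exp (\<i> * of_real \<delta> * of_real t) = cis (t * \<delta>)" for t
      by (simp add: cis_conv_exp mult_ac)
    ultimately show "((\<lambda>t. cis (t * \<delta>) / ?e) has_vector_derivative cis (t * \<delta>)) (at t within {T..2*T})"
      by simp
  qed (use T in simp)
  then have "?I = cis (2 * T * \<delta>) / ?e - cis (T * \<delta>) / ?e"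
    by (rule integral_unique)
  then have "norm (?I) \<le> norm (cis (2 * T * \<delta>) / ?e) + norm (cis (T * \<delta>) / ?e)"
    by (simp only: norm_triangle_ineq4)
  also have "\<dots> = 2 / \<bar>\<delta>\<bar>" by (simp add: norm_divide norm_mult)
  finally show "norm (?I) \<le> 2 / \<bar>\<delta>\<bar>" .
qed

text \<open>For integers j < k one has ln (k/j) >= 1 - j/k >= 1/k.\<close>

lemma ln_nat_diff_ge:
  fixes m n :: nat assumes "m > 0" "n > 0" "m \<noteq> n" "real m \<le> Y" "real n \<le> Y"
  shows "1 / \<bar>ln (real n) - ln (real m)\<bar> \<le> Y"
proof -
  have *: "1 / Y \<le> ln (real k) - ln (real j)" if "j < k" "j > 0" "real k \<le> Y" for j k :: nat
  proof -
    have "ln (real j / real k) \<le> real j / real k - 1" using that by (intro ln_le_minus_one) auto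
    then have "1 - real j / real k \<le> ln (real k) - ln (real j)" using that by (simp add: ln_div)
    moreover have "1 / Y \<le> 1 / real k" using that by (intro frac_le) auto
    moreover have "1 / real k \<le> 1 - real j / real k"
      using that by (simp add: field_simps)
    ultimately show ?thesis by linarith
  qed
  have Y: "Y > 0" using assms by linarith
  have "1 / Y \<le> \<bar>ln (real n) - ln (real m)\<bar>"
    using *[of m n] *[of n m] assms by (cases "m < n") auto
  moreover have "\<bar>ln (real n) - ln (real m)\<bar> > 0" using assms by simp
  ultimately show ?thesis using Y by (simp add: field_simps)
qed

text \<open>The 2k-th power is a double sum over lists of k primes. A pair with equal products
  contributes at most T, and a list has at most k! such partners, all with coefficient of the same
  modulus. For other pairs the frequencies differ by at least y^(-k), so the oscillating integral is
  at most 2 y^k; this is simply summed over all pairs.\<close>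

lemma moment_prime_polynomial:
  fixes a :: "nat \<Rightarrow> complex" and P :: "nat set"
  assumes P: "finite P" "\<And>p. p \<in> P \<Longrightarrow> prime p" "\<And>p. p \<in> P \<Longrightarrow> real p \<le> y" and T: "T \<ge> 0"
  shows "integral {T..2*T} (\<lambda>t. norm (\<Sum>p\<in>P. a p * npow p (Complex 0 t)) ^ (2 * k))
    \<le> T * fact k * (\<Sum>p\<in>P. (norm (a p))\<^sup>2) ^ k + 2 * y ^ k * (\<Sum>p\<in>P. norm (a p)) ^ (2 * k)"
proof -
  let ?n = "\<lambda>t. norm (\<Sum>p\<in>P. a p * npow p (Complex 0 t)) ^ (2 * k)"
  define LP where "LP = {ps. set ps \<subseteq> P \<and> length ps = k}"
  have finLP: "finite LP" unfolding LP_def by (rule finite_lists_length_eq[OF P(1)])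
  define A where "A = (\<lambda>ps. prod_list (map a ps))"
  have nA: "norm (A ps) = prod_list (map (\<lambda>p. norm (a p)) ps)" for ps by (simp add: A_def norm_prod_list_map)
  define N where "N = (prod_list :: nat list \<Rightarrow> nat)"
  have Npos: "N ps > 0" if "ps \<in> LP" for ps
    unfolding N_def by (rule prod_list_pos_primes) (use that P in \<open>auto simp: LP_def\<close>)
  have Nle: "real (N ps) \<le> y ^ k" if "ps \<in> LP" for ps
    using prod_list_le_power[of ps y] that P by (auto simp: LP_def N_def)
  define \<delta> where "\<delta> = (\<lambda>ps qs. ln (real (N qs)) - ln (real (N ps)))"
  let ?diag = "\<lambda>ps qs. if N qs = N ps then T * (norm (A ps) * norm (A qs)) else 0"
  let ?I = "\<lambda>ps qs. integral {T..2*T} (\<lambda>t. cis (t * \<delta> ps qs))"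
  let ?c = "\<lambda>t. complex_of_real (?n t)"
  have expand: "complex_of_real (?n t)
     = (\<Sum>ps\<in>LP. \<Sum>qs\<in>LP. A ps * cnj (A qs) * cis (t * \<delta> ps qs))" for t
  proof -
    define D where "D = (\<Sum>p\<in>P. a p * npow p (Complex 0 t))"
    have Dk: "D ^ k = (\<Sum>ps\<in>LP. A ps * npow (N ps) (Complex 0 t))"
      unfolding D_def LP_def A_def N_def by (subst sum_power_lists[OF P(1)]) (simp add: prod_list_map_mult prod_list_nat_powr)
    have "of_real (norm D ^ (2 * k)) = (of_real (norm D) ^ 2 :: complex) ^ k" by (simp add: power_mult)
    also have "\<dots> = (D * cnj D) ^ k" by (simp only: complex_norm_square[symmetric] of_real_power)
    also have "\<dots> = D ^ k * cnj (D ^ k)" by (simp add: power_mult_distrib)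
    also have "\<dots> = (\<Sum>ps\<in>LP. \<Sum>qs\<in>LP. A ps * npow (N ps) (Complex 0 t) * (cnj (A qs) * cnj (npow (N qs) (Complex 0 t))))"
      unfolding Dk by (simp only: cnj_sum complex_cnj_mult sum_product)
    also have "\<dots> = (\<Sum>ps\<in>LP. \<Sum>qs\<in>LP. A ps * cnj (A qs) * cis (t * \<delta> ps qs))"
    proof (intro sum.cong refl)
      fix ps qs assume "ps \<in> LP" "qs \<in> LP"
      then have "npow (N ps) (Complex 0 t) * cnj (npow (N qs) (Complex 0 t)) = cis (t * \<delta> ps qs)"
        unfolding \<delta>_def using Npos by (intro nat_powr_imaginary_product) auto
      moreover have "A ps * npow (N ps) (Complex 0 t) * (cnj (A qs) * cnj (npow (N qs) (Complex 0 t)))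
         = A ps * cnj (A qs) * (npow (N ps) (Complex 0 t) * cnj (npow (N qs) (Complex 0 t)))"
        by (simp only: mult_ac)
      ultimately show "A ps * npow (N ps) (Complex 0 t) * (cnj (A qs) * cnj (npow (N qs) (Complex 0 t)))
         = A ps * cnj (A qs) * cis (t * \<delta> ps qs)" by simp
    qed
    finally show ?thesis unfolding D_def .
  qed
  have ic: "(\<lambda>t. A ps * cnj (A qs) * cis (t * \<delta> ps qs)) integrable_on {T..2*T}" for ps qs
    by (intro integrable_continuous_interval continuous_intros)
  define I where "I = integral {T..2*T} (\<lambda>t. ?n t)"
  have "of_real I = integral {T..2*T} ?c"
  proof -
    have "(\<lambda>t. \<Sum>ps\<in>LP. \<Sum>qs\<in>LP. A ps * cnj (A qs) * cis (t * \<delta> ps qs)) integrable_on {T..2*T}"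
      by (intro integrable_sum finLP ic)
    then have ie: "?c integrable_on {T..2*T}"
      by (simp only: expand)
    have "?n integrable_on {T..2*T}"
      using integrable_linear[OF ie bounded_linear_Re] by (simp add: o_def)
    then show ?thesis unfolding I_def
      by (intro integral_unique[symmetric] has_integral_of_real integrable_integral)
  qed
  also have "\<dots> = (\<Sum>ps\<in>LP. \<Sum>qs\<in>LP. A ps * cnj (A qs) * ?I ps qs)"
    unfolding expand by (simp add: integral_sum finLP integrable_sum ic del: mult.assoc)
  finally have Ieq: "of_real I = (\<Sum>ps\<in>LP. \<Sum>qs\<in>LP. A ps * cnj (A qs) * ?I ps qs)" .
  have y0: "y ^ k \<ge> 0" if "ps \<in> LP" for ps using Nle[OF that] of_nat_0_le_iff order_trans by blast
  have termbd: "norm (A ps * cnj (A qs) * ?I ps qs)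
     \<le> ?diag ps qs + 2 * y ^ k * (norm (A ps) * norm (A qs))"
    if pq: "ps \<in> LP" "qs \<in> LP" for ps qs
  proof -
    have "norm (?I ps qs) \<le> (if N qs = N ps then T else 0) + 2 * y ^ k"
    proof (cases "N qs = N ps")
      case True
      then show ?thesis using integral_cis_bound(1)[OF T, of "\<delta> ps qs"] y0[OF pq(1)] by simp
    next
      case False
      then have "\<delta> ps qs \<noteq> 0" unfolding \<delta>_def using Npos[OF pq(1)] Npos[OF pq(2)] by simp
      then have "norm (?I ps qs) \<le> 2 * (1 / \<bar>\<delta> ps qs\<bar>)"
        using integral_cis_bound(2)[OF T, of "\<delta> ps qs"] by simp
      also have "1 / \<bar>\<delta> ps qs\<bar> \<le> y ^ k"
        unfolding \<delta>_def by (rule ln_nat_diff_ge) (use pq Npos Nle False in auto)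
      finally show ?thesis using False by simp
    qed
    then have "norm (A ps) * norm (A qs) * norm (?I ps qs)
        \<le> norm (A ps) * norm (A qs) * ((if N qs = N ps then T else 0) + 2 * y ^ k)"
      by (intro mult_left_mono) auto
    then show ?thesis by (simp add: norm_mult algebra_simps split: if_splits)
  qed
  have "I \<le> norm (of_real I :: complex)" by simp
  also have "\<dots> \<le> (\<Sum>ps\<in>LP. \<Sum>qs\<in>LP. ?diag ps qs + 2 * y ^ k * (norm (A ps) * norm (A qs)))"
    unfolding Ieq by (intro sum_norm_le termbd)
  also have "\<dots> = (\<Sum>ps\<in>LP. \<Sum>qs\<in>LP. ?diag ps qs) + 2 * y ^ k * (\<Sum>ps\<in>LP. norm (A ps))\<^sup>2"
    unfolding power2_eq_square sum_product by (simp only: sum.distrib sum_distrib_left)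
  also have "(\<Sum>ps\<in>LP. norm (A ps))\<^sup>2 = (\<Sum>p\<in>P. norm (a p)) ^ (2 * k)"
    using sum_power_lists[OF P(1), of "\<lambda>p. norm (a p)" k] by (simp add: LP_def nA power_mult mult.commute)
  also have "(\<Sum>ps\<in>LP. \<Sum>qs\<in>LP. ?diag ps qs) \<le> (\<Sum>ps\<in>LP. T * fact k * (norm (A ps))\<^sup>2)"
  proof (rule sum_mono)
    fix ps assume ps: "ps \<in> LP"
    have eq: "mset qs = mset ps" if "qs \<in> LP" "N qs = N ps" for qs
      by (rule prod_list_primes_eq_imp_mset_eq) (use that ps P in \<open>auto simp: LP_def N_def\<close>)
    \<comment> \<open>By commutativity the coefficient depends on the multiset of primes only, so
      the diagonal terms are squares.\<close>
    have Aeq: "norm (A qs) = norm (A ps)" if "mset qs = mset ps" for qs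
    proof -
      have "A xs = prod_mset (image_mset a (mset xs))" for xs by (simp add: A_def prod_mset_prod_list flip: mset_map)
      then show ?thesis using that by simp
    qed
    have "(\<Sum>qs\<in>LP. ?diag ps qs) = (\<Sum>qs\<in>{qs \<in> LP. N qs = N ps}. T * (norm (A ps) * norm (A qs)))"
      using finLP by (simp add: sum.inter_filter)
    also have "\<dots> = (\<Sum>qs\<in>{qs \<in> LP. N qs = N ps}. T * (norm (A ps))\<^sup>2)"
    proof (rule sum.cong)
      fix qs assume "qs \<in> {qs \<in> LP. N qs = N ps}"
      then have "norm (A qs) = norm (A ps)" using eq[of qs] Aeq[of qs] by blast
      then show "T * (norm (A ps) * norm (A qs)) = T * (norm (A ps))\<^sup>2" by (simp add: power2_eq_square)
    qed simp
    also have "\<dots> = real (card {qs \<in> LP. N qs = N ps}) * (T * (norm (A ps))\<^sup>2)" by simp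
    also have "\<dots> \<le> fact k * (T * (norm (A ps))\<^sup>2)"
    proof (intro mult_right_mono)
      have "finite {qs. mset qs = mset ps}"
        using finite_permutations_of_multiset[of "mset ps"] by (simp add: permutations_of_multiset_def)
      then have "card {qs \<in> LP. N qs = N ps} \<le> card {qs. mset qs = mset ps}"
        by (rule card_mono) (use eq in auto)
      also have "\<dots> \<le> fact (length ps)" by (rule card_mset_eq_le)
      also have "length ps = k" using ps by (simp add: LP_def)
      finally have "real (card {qs \<in> LP. N qs = N ps}) \<le> real (fact k)" by (simp only: of_nat_le_iff)
      then show "real (card {qs \<in> LP. N qs = N ps}) \<le> fact k" by simp
    qed (use T in auto)
    finally show "(\<Sum>qs\<in>LP. ?diag ps qs) \<le> T * fact k * (norm (A ps))\<^sup>2"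
      by (simp add: mult_ac)
  qed
  also have "(\<Sum>ps\<in>LP. T * fact k * (norm (A ps))\<^sup>2) = T * fact k * (\<Sum>p\<in>P. (norm (a p))\<^sup>2) ^ k"
  proof -
    have "(norm (A ps))\<^sup>2 = prod_list (map (\<lambda>p. (norm (a p))\<^sup>2) ps)" for ps
      unfolding nA by (induction ps) (auto simp: power_mult_distrib)
    then show ?thesis using sum_power_lists[OF P(1), of "\<lambda>p. (norm (a p))\<^sup>2" k]
      by (simp add: LP_def sum_distrib_left)
  qed
  finally show ?thesis by (simp add: I_def)
qed

section \<open>Prime powers and distant zeros\<close>

text \<open>The threshold 3/4 admits q = p^(-1/2) for every prime p, as 1/2 <= 9/16, and 4 is 1/(1 -
  3/4).\<close>

lemma geometric_tail_le:
  fixes q :: real assumes "0 \<le> q" "q \<le> 3/4"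
  shows "(\<Sum>r=2..R. q ^ r) \<le> 4 * q\<^sup>2"
proof -
  have *: "(1 - q) * (\<Sum>r=2..R. q ^ r) \<le> q\<^sup>2 - q ^ Suc R" if "R \<ge> 1" for R
    using that
  proof (induction R rule: dec_induct)
    case (step n)
    then show ?case by (simp add: algebra_simps)
  qed (simp add: power2_eq_square)
  have "(1 - q) * (\<Sum>r=2..R. q ^ r) \<le> q\<^sup>2"
    using *[of R] zero_le_power[OF assms(1), of "Suc R"] by (cases "R \<ge> 1") (linarith, simp)
  moreover have "(1/4) * (\<Sum>r=2..R. q ^ r) \<le> (1 - q) * (\<Sum>r=2..R. q ^ r)"
    using assms by (intro mult_right_mono sum_nonneg) auto
  ultimately show ?thesis by linarith
qed

text \<open>Only the powers p^r with r >= 2 carry weight, and for fixed p they sum to at most 4 ln p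
  / p. This leaves the sum of \<open>Mertens_upper\<close>.\<close>

lemma sum_nonprime_mangoldt_le:
  "\<exists>C>0. \<forall>L\<ge>1. (\<Sum>n | real n \<le> exp L \<and> \<not> prime n. mangoldt n * real n powr (- 1/2)) \<le> C * L"
proof -
  obtain C where C: "C > 0" "\<And>L. L \<ge> 1 \<Longrightarrow> (\<Sum>n | real n \<le> exp L. mangoldt n / real n) \<le> C * L"
    using Mertens_upper by blast
  show ?thesis
  proof (intro exI[of _ "4 * C"] conjI allI impI)
    show "4 * C > 0" using C by simp
    fix L :: real assume L: "L \<ge> 1"
    define F where "F = {n. real n \<le> exp L}"
    have finF: "finite F" unfolding F_def by (rule finite_nat_le_real)
    define Pr where "Pr = {p \<in> F. prime p}"
    \<comment> \<open>Exponents that occur satisfy r < 2^r <= p^r <= exp L, so this crude range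
      contains them all.\<close>
    define R where "R = nat \<lceil>exp L\<rceil>"
    let ?g = "\<lambda>n. mangoldt n * real n powr (- 1/2)"
    have "(\<Sum>n | real n \<le> exp L \<and> \<not> prime n. ?g n) = (\<Sum>n\<in>{n \<in> F. \<not> prime n \<and> primepow n}. ?g n)"
      by (rule sum.mono_neutral_right) (use finF in \<open>auto simp: F_def mangoldt_def\<close>)
    also have "\<dots> \<le> (\<Sum>n\<in>(\<lambda>(p, r). p ^ r) ` (Pr \<times> {2..R}). ?g n)"
    proof (rule sum_mono2)
      show "finite ((\<lambda>(p, r). p ^ r) ` (Pr \<times> {2..R}))" using finF by (auto simp: Pr_def)
      show "{n \<in> F. \<not> prime n \<and> primepow n} \<subseteq> (\<lambda>(p, r). p ^ r) ` (Pr \<times> {2..R})"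
      proof
        fix n assume n: "n \<in> {n \<in> F. \<not> prime n \<and> primepow n}"
        then obtain p r where pr: "prime p" "r > 0" "n = p ^ r" by (auto simp: primepow_def)
        have "r \<noteq> 1" using n pr by auto
        then have r2: "r \<ge> 2" using pr by simp
        have p2: "p \<ge> 2" using pr(1) by (rule prime_ge_2_nat)
        have "p ^ 1 \<le> p ^ r" using p2 r2 by (intro power_increasing) auto
        then have "p \<in> F" using n pr by (auto simp: F_def intro: order_trans[OF of_nat_mono])
        moreover have "r \<le> R"
        proof -
          have "r < 2 ^ r" by (rule less_exp)
          also have "(2::nat) ^ r \<le> p ^ r" using p2 by (rule power_mono) simp
          finally have "real r < exp L" using n pr by (auto simp: F_def intro: less_le_trans[OF of_nat_less_iff[THEN iffD2]])
          then show ?thesis by (simp add: R_def) linarith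
        qed
        ultimately show "n \<in> (\<lambda>(p, r). p ^ r) ` (Pr \<times> {2..R})"
          using pr r2 by (intro image_eqI[of _ _ "(p, r)"]) (auto simp: Pr_def)
      qed
    qed (auto simp: mangoldt_nonneg)
    \<comment> \<open>For nonnegative terms, passing from the image to its parameters can only
      enlarge the sum, so injectivity of (p, r) to p^r need not be discussed.\<close>
    also have "\<dots> \<le> (\<Sum>x\<in>Pr \<times> {2..R}. ?g ((\<lambda>(p, r). p ^ r) x))"
      using sum_image_le[of "Pr \<times> {2..R}" ?g "\<lambda>(p, r). p ^ r"] finF by (auto simp: Pr_def mangoldt_nonneg o_def)
    also have "\<dots> = (\<Sum>p\<in>Pr. \<Sum>r=2..R. ?g (p ^ r))"
      by (simp add: sum.cartesian_product case_prod_unfold)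
    also have "\<dots> \<le> (\<Sum>p\<in>Pr. 4 * (mangoldt p / real p))"
    proof (rule sum_mono)
      fix p assume "p \<in> Pr"
      then have p: "prime p" "p \<ge> 2" using prime_ge_2_nat by (auto simp: Pr_def)
      define q where "q = real p powr (- 1/2)"
      have q2: "q\<^sup>2 = 1 / real p"
        using p by (simp add: q_def power2_eq_square powr_add[symmetric] powr_minus_divide)
      have q: "0 \<le> q" "q \<le> 3/4"
      proof -
        have "1 / real p \<le> 1 / 2" using p by (intro frac_le) auto
        then have "q\<^sup>2 \<le> (3/4)\<^sup>2" unfolding q2 by (simp add: power2_eq_square)
        then show "q \<le> 3/4" by (rule power2_le_imp_le) simp
      qed (simp add: q_def)
      have "(\<Sum>r=2..R. ?g (p ^ r)) = (\<Sum>r=2..R. ln (real p) * q ^ r)"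
      proof (rule sum.cong)
        fix r assume "r \<in> {2..R}"
        then have "mangoldt (p ^ r) = ln (real p)" using p by (simp add: mangoldt_primepow)
        moreover have "real (p ^ r) powr (- 1/2) = q ^ r"
          using p by (simp add: q_def powr_realpow[symmetric] powr_powr mult.commute)
        ultimately show "?g (p ^ r) = ln (real p) * q ^ r" by simp
      qed simp
      also have "\<dots> = ln (real p) * (\<Sum>r=2..R. q ^ r)" by (simp add: sum_distrib_left)
      also have "\<dots> \<le> ln (real p) * (4 * q\<^sup>2)"
        using p by (intro mult_left_mono geometric_tail_le q) auto
      also have "\<dots> = 4 * (mangoldt p / real p)" using p by (simp add: q2)
      finally show "(\<Sum>r=2..R. ?g (p ^ r)) \<le> 4 * (mangoldt p / real p)" .
    qed
    also have "\<dots> \<le> (\<Sum>p\<in>F. 4 * (mangoldt p / real p))"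
      by (rule sum_mono2) (use finF in \<open>auto simp: Pr_def mangoldt_nonneg\<close>)
    also have "\<dots> = 4 * (\<Sum>p\<in>F. mangoldt p / real p)" by (simp add: sum_distrib_left)
    also have "\<dots> \<le> 4 * (C * L)" using C(2)[OF L] by (simp add: F_def)
    finally show "(\<Sum>n | real n \<le> exp L \<and> \<not> prime n. ?g n) \<le> 4 * C * L" by simp
  qed
qed

text \<open>The linear growth of \<open>ell_add_le\<close> against 1/v^2 would leave a divergent
  harmonic sum. Growth like a square root, from ln u = 2 ln (sqrt u) <= 2 (sqrt u - 1), leaves the
  summable exponent -3/2.\<close>

lemma ell_add_le_sqrt: "ell (t + v) \<le> 2 * ell t * sqrt (1 + \<bar>v\<bar>)"
proof -
  have "ell (t + v) \<le> ell t + ln (1 + \<bar>v\<bar>)" by (rule ell_add_le_ln)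
  also have "ln (1 + \<bar>v\<bar>) \<le> 2 * (sqrt (1 + \<bar>v\<bar>) - 1)"
  proof -
    have "ln (sqrt (1 + \<bar>v\<bar>)) \<le> sqrt (1 + \<bar>v\<bar>) - 1" by (intro ln_le_minus_one) (simp add: add_pos_nonneg)
    then show ?thesis by (simp add: ln_sqrt add_pos_nonneg)
  qed
  also have "\<dots> \<le> ell t * (2 * (sqrt (1 + \<bar>v\<bar>) - 1))"
    using ell_ge_1[of t] mult_right_mono[of 1 "ell t" "2 * (sqrt (1 + \<bar>v\<bar>) - 1)"] by simp
  finally have "ell (t + v) \<le> ell t + ell t * (2 * (sqrt (1 + \<bar>v\<bar>) - 1))" by simp
  also have "\<dots> \<le> 2 * ell t * sqrt (1 + \<bar>v\<bar>)" using ell_ge_1[of t] by (simp add: algebra_simps)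
  finally show ?thesis .
qed

text \<open>The points j + 1/2 are the midpoints of the unit cells. The reflection of j to - j - 1
  exchanges the two halves, and each is dominated by the same series over positive integers.\<close>

lemma sum_int_powr_bounded:
  "\<exists>B>0. \<forall>J :: int set. finite J \<longrightarrow> (\<Sum>j\<in>J. (1 + \<bar>real_of_int j + 1/2\<bar>) powr (- 3/2)) \<le> B"
proof -
  let ?w = "\<lambda>j. (1 + \<bar>real_of_int j + 1/2\<bar>) powr (- 3/2)"
  define h where "h = (\<lambda>n. real (Suc n) powr (- 3/2))"
  have sh: "summable h" unfolding h_def by (subst summable_Suc_iff) (simp add: summable_real_powr_iff)
  have h0: "h n \<ge> 0" for n by (simp add: h_def)
  have part: "(\<Sum>j\<in>J. ?w j) \<le> suminf h"
    if "finite J" "inj_on f J" "\<And>j. j \<in> J \<Longrightarrow> real (Suc (f j)) \<le> 1 + \<bar>real_of_int j + 1/2\<bar>" for J and f :: "int \<Rightarrow> nat"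
  proof -
    have "(\<Sum>j\<in>J. ?w j) \<le> (\<Sum>j\<in>J. h (f j))"
      unfolding h_def by (intro sum_mono powr_mono2') (use that(3) in auto)
    also have "\<dots> = (\<Sum>n\<in>f ` J. h n)" by (simp add: sum.reindex[OF that(2)])
    also have "\<dots> \<le> suminf h" by (rule sum_le_suminf[OF sh]) (use that h0 in auto)
    finally show ?thesis .
  qed
  have "(\<Sum>j\<in>J. ?w j) \<le> 2 * suminf h + 1" if J: "finite J" for J :: "int set"
  proof -
    have "(\<Sum>j\<in>J. ?w j)
       = (\<Sum>j\<in>{j \<in> J. j \<ge> 0}. ?w j) + (\<Sum>j\<in>{j \<in> J. \<not> j \<ge> 0}. ?w j)"
      using J by (subst sum.union_disjoint[symmetric]) (auto intro!: sum.cong)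
    also have "\<dots> \<le> suminf h + suminf h"
    proof (rule add_mono)
      show "(\<Sum>j\<in>{j \<in> J. j \<ge> 0}. ?w j) \<le> suminf h"
        by (rule part[of _ nat]) (use J in \<open>auto simp: inj_on_def eq_nat_nat_iff of_nat_nat\<close>)
      show "(\<Sum>j\<in>{j \<in> J. \<not> j \<ge> 0}. ?w j) \<le> suminf h"
        by (rule part[of _ "\<lambda>j. nat (- j - 1)"]) (use J in \<open>auto simp: inj_on_def eq_nat_nat_iff of_nat_nat\<close>)
    qed
    finally show ?thesis by simp
  qed
  moreover have "2 * suminf h + 1 > 0" using suminf_nonneg[OF sh h0] by linarith
  ultimately show ?thesis by blast
qed

text \<open>The ordinates are sorted by the unit cell of \<gamma> - t. A cell with midpoint v lies
  in the window of \<open>ordinates_near\<close> at t + v, which bounds the number of its zeros, and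
  outside \<open>ordinates_half\<close> the distance from t is at least (1 + |v|) / 4, also in the
  two cells adjacent to t.\<close>

lemma far_ordinates_sum_le:
  assumes RH: riemann_hypothesis
  shows "\<exists>C>0. \<forall>t F. finite F \<longrightarrow> F \<subseteq> zeta_ordinates - ordinates_half t \<longrightarrow>
     (\<Sum>\<gamma>\<in>F. omult \<gamma> * (1 / (\<gamma> - t)\<^sup>2)) \<le> C * ell t"
proof -
  obtain C0 where C0: "C0 > 0" and fin: "\<And>t. finite (ordinates_near t)"
    and cnt: "\<And>t. (\<Sum>\<gamma>\<in>ordinates_near t. omult \<gamma>) \<le> C0 * ell t"
    using RH_log_deriv_bounds[OF RH] by blast
  obtain B where B: "B > 0" "\<And>J :: int set. finite J \<Longrightarrow> (\<Sum>j\<in>J. (1 + \<bar>real_of_int j + 1/2\<bar>) powr (- 3/2)) \<le> B"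
    using sum_int_powr_bounded by blast
  show ?thesis
  proof (intro exI[of _ "32 * C0 * B"] conjI allI impI)
    show "32 * C0 * B > 0" using C0 B by simp
    fix t F assume F: "finite F" "F \<subseteq> zeta_ordinates - ordinates_half t"
    define j where "j = (\<lambda>\<gamma>. \<lfloor>\<gamma> - t\<rfloor>)"
    let ?F = "\<lambda>i. {\<gamma> \<in> F. j \<gamma> = i}"
    define v where "v = (\<lambda>i :: int. real_of_int i + 1/2)"
    have l0: "ell t \<ge> 0" using ell_ge_1[of t] by simp
    have "(\<Sum>\<gamma>\<in>F. omult \<gamma> * (1 / (\<gamma> - t)\<^sup>2)) = (\<Sum>i\<in>j ` F. \<Sum>\<gamma>\<in>?F i. omult \<gamma> * (1 / (\<gamma> - t)\<^sup>2))"
      by (rule sum.image_gen[OF F(1)])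
    also have "\<dots> \<le> (\<Sum>i\<in>j ` F. 32 * C0 * ell t * (1 + \<bar>v i\<bar>) powr (- 3/2))"
    proof (rule sum_mono)
      fix i assume "i \<in> j ` F"
      have pos: "1 + \<bar>v i\<bar> > 0" by (simp add: add_pos_nonneg)
      have w: "1 / (\<gamma> - t)\<^sup>2 \<le> 16 / (1 + \<bar>v i\<bar>)\<^sup>2" "\<gamma> \<in> ordinates_near (t + v i)" if \<gamma>: "\<gamma> \<in> ?F i" for \<gamma>
      proof -
        have fl: "real_of_int i \<le> \<gamma> - t" "\<gamma> - t < real_of_int i + 1" using \<gamma> unfolding j_def by auto
        have u: "\<bar>\<gamma> - t\<bar> > 1/2" and z: "\<gamma> \<in> zeta_ordinates" using \<gamma> F(2) by (auto simp: ordinates_half_def)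
        have "\<bar>v i\<bar> \<le> \<bar>\<gamma> - t\<bar> + 1/2" using fl unfolding v_def by linarith
        moreover have "1 + a \<le> 4 * c" if "a \<le> c + 1/2" "c > 1/2" for a c :: real using that by linarith
        ultimately have "1 + \<bar>v i\<bar> \<le> 4 * \<bar>\<gamma> - t\<bar>" using u by blast
        then have "(1 + \<bar>v i\<bar>)\<^sup>2 \<le> (4 * \<bar>\<gamma> - t\<bar>)\<^sup>2" using pos by (intro power_mono) auto
        also have "\<dots> = 16 * (\<gamma> - t)\<^sup>2" by (simp add: power_mult_distrib)
        finally have "(1 + \<bar>v i\<bar>)\<^sup>2 \<le> 16 * (\<gamma> - t)\<^sup>2" .
        then show "1 / (\<gamma> - t)\<^sup>2 \<le> 16 / (1 + \<bar>v i\<bar>)\<^sup>2"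
          using pos u by (simp add: divide_simps)
        have "\<bar>\<gamma> - (t + v i)\<bar> \<le> 3/4" using fl unfolding v_def by linarith
        then show "\<gamma> \<in> ordinates_near (t + v i)" using z by (simp add: ordinates_near_def)
      qed
      have "(\<Sum>\<gamma>\<in>?F i. omult \<gamma> * (1 / (\<gamma> - t)\<^sup>2)) \<le> (\<Sum>\<gamma>\<in>?F i. omult \<gamma> * (16 / (1 + \<bar>v i\<bar>)\<^sup>2))"
        by (intro sum_mono mult_left_mono w) auto
      also have "\<dots> = (\<Sum>\<gamma>\<in>?F i. omult \<gamma>) * (16 / (1 + \<bar>v i\<bar>)\<^sup>2)" by (rule sum_distrib_right[symmetric])
      also have "\<dots> \<le> (C0 * (2 * ell t * sqrt (1 + \<bar>v i\<bar>))) * (16 / (1 + \<bar>v i\<bar>)\<^sup>2)"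
      proof (intro mult_right_mono)
        have "(\<Sum>\<gamma>\<in>?F i. omult \<gamma>) \<le> (\<Sum>\<gamma>\<in>ordinates_near (t + v i). omult \<gamma>)"
          by (rule sum_mono2[OF fin]) (use w in auto)
        also have "\<dots> \<le> C0 * ell (t + v i)" by (rule cnt)
        also have "\<dots> \<le> C0 * (2 * ell t * sqrt (1 + \<bar>v i\<bar>))" using C0 by (intro mult_left_mono ell_add_le_sqrt) auto
        finally show "(\<Sum>\<gamma>\<in>?F i. omult \<gamma>) \<le> C0 * (2 * ell t * sqrt (1 + \<bar>v i\<bar>))" .
      qed simp
      also have "\<dots> = 32 * C0 * ell t * (1 + \<bar>v i\<bar>) powr (- 3/2)"
      proof -
        have "(1 + \<bar>v i\<bar>) powr (- 3/2) = sqrt (1 + \<bar>v i\<bar>) / (1 + \<bar>v i\<bar>)\<^sup>2"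
          using powr_diff[of "1 + \<bar>v i\<bar>" "1/2" 2] pos by (simp add: powr_half_sqrt)
        then show ?thesis by simp
      qed
      finally show "(\<Sum>\<gamma>\<in>?F i. omult \<gamma> * (1 / (\<gamma> - t)\<^sup>2)) \<le> 32 * C0 * ell t * (1 + \<bar>v i\<bar>) powr (- 3/2)" .
    qed
    also have "\<dots> = 32 * C0 * ell t * (\<Sum>i\<in>j ` F. (1 + \<bar>v i\<bar>) powr (- 3/2))" by (rule sum_distrib_left[symmetric])
    also have "\<dots> \<le> 32 * C0 * ell t * B" using B(2)[of "j ` F"] F(1) C0 l0 unfolding v_def by (intro mult_left_mono) auto
    finally show "(\<Sum>\<gamma>\<in>F. omult \<gamma> * (1 / (\<gamma> - t)\<^sup>2)) \<le> 32 * C0 * B * ell t" by (simp add: mult_ac)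
  qed
qed

section \<open>The large deviation bound\<close>

lemma ell_le_ln: "T \<ge> 2 \<Longrightarrow> t \<in> {T..2*T} \<Longrightarrow> ell t \<le> 3 * ln T"
proof -
  assume T: "T \<ge> 2" "t \<in> {T..2*T}"
  have "4 * T \<le> T ^ 3"
    using mult_right_mono[of 4 "T * T" T] mult_mono[of 2 T 2 T] T by (simp add: power3_eq_cube)
  then have "3 + \<bar>t\<bar> \<le> T ^ 3" using T by auto
  then have "ell t \<le> ln (T ^ 3)" unfolding ell_def by (intro ln_mono) auto
  also have "\<dots> = 3 * ln T" using T by (simp add: ln_realpow)
  finally show ?thesis .
qed

lemma Markov_interval:
  fixes f :: "real \<Rightarrow> real"
  assumes f: "continuous_on {a..b} f" "\<And>t. t \<in> {a..b} \<Longrightarrow> f t \<ge> 0" and W: "W \<ge> 0"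
  shows "{t \<in> {a..b}. f t \<ge> W} \<in> lmeasurable"
    and "W * measure lebesgue {t \<in> {a..b}. f t \<ge> W} \<le> integral {a..b} f"
proof -
  define E where "E = {t \<in> {a..b}. f t \<ge> W}"
  have "closed ({a..b} \<inter> f -` {W..})" by (intro continuous_closed_preimage f) auto
  moreover have "E = {a..b} \<inter> f -` {W..}" by (auto simp: E_def)
  ultimately have "closed E" by simp
  moreover have "bounded E" by (rule bounded_subset[OF bounded_closed_interval[of a b]]) (auto simp: E_def)
  ultimately have E: "E \<in> lmeasurable" by (intro lmeasurable_compact) (simp add: compact_eq_bounded_closed)
  then show "{t \<in> {a..b}. f t \<ge> W} \<in> lmeasurable" by (simp add: E_def)
  have "(indicat_real E has_integral measure lebesgue E) UNIV"
    using E lmeasurable_iff_indicator_has_integral by blast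
  also have "indicat_real E = (\<lambda>t. if t \<in> {a..b} then indicat_real E t else 0)"
    by (auto simp: E_def indicator_def)
  finally have "(indicat_real E has_integral measure lebesgue E) {a..b}" by (simp only: has_integral_restrict_UNIV)
  then have "((\<lambda>t. W * indicat_real E t) has_integral W * measure lebesgue E) {a..b}" by (rule has_integral_mult_right)
  then have "W * measure lebesgue E \<le> integral {a..b} f"
    by (rule has_integral_le[OF _ integrable_integral[OF integrable_continuous_interval[OF f(1)]]])
       (use f W in \<open>auto simp: E_def indicator_def\<close>)
  then show "W * measure lebesgue {t \<in> {a..b}. f t \<ge> W} \<le> integral {a..b} f" by (simp add: E_def)
qed

text \<open>Beyond distance 1/2 the rescaled kernel is of size (ln T)^(-2) times an inverse square,
  while the inverse squares of the distances sum to O(ln T). The distant part is therefore O(1 / ln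
  T), hence bounded for T >= 2.\<close>

lemma ordinate_sum_le_near:
  assumes RH: riemann_hypothesis
  shows "\<exists>C>0. \<forall>T\<ge>2. \<forall>t\<in>{T..2*T}. ordinate_sum (\<lambda>\<gamma>. Q_kernel (ln T / (2*pi) * (\<gamma> - t)))
    \<le> ennreal ((\<Sum>\<gamma>\<in>ordinates_half t. omult \<gamma> * Q_kernel (ln T / (2*pi) * (\<gamma> - t))) + C)"
proof -
  obtain C where C: "C > 0" "\<And>t F. finite F \<Longrightarrow> F \<subseteq> zeta_ordinates - ordinates_half t \<Longrightarrow>
     (\<Sum>\<gamma>\<in>F. omult \<gamma> * (1 / (\<gamma> - t)\<^sup>2)) \<le> C * ell t"
    using far_ordinates_sum_le[OF RH] by blast
  obtain C0 where fin: "\<And>t. finite (ordinates_near t)"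
    using RH_log_deriv_bounds[OF RH] by blast
  have finh: "finite (ordinates_half t)" for t
    using finite_subset[OF ordinates_half_near[of 0 t] fin] by simp
  define K where "K = (2*pi)\<^sup>2 * (3 * C) / ln 2"
  show ?thesis
  proof (intro exI[of _ K] conjI allI impI ballI)
    show "K > 0" using C by (simp add: K_def)
    fix T t :: real assume T: "T \<ge> 2" and t: "t \<in> {T..2*T}"
    define \<Lambda> where "\<Lambda> = ln T / (2*pi)"
    have lnT: "ln T \<ge> ln 2" "ln T > 0" using T by auto
    have \<Lambda>: "\<Lambda> > 0" using lnT by (simp add: \<Lambda>_def)
    let ?q = "\<lambda>\<gamma>. Q_kernel (\<Lambda> * (\<gamma> - t))"
    let ?S = "\<Sum>\<gamma>\<in>ordinates_half t. omult \<gamma> * ?q \<gamma>"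
    have q0: "?q \<gamma> \<ge> 0" for \<gamma> by (simp add: Q_kernel_def)
    have le: "(\<Sum>\<gamma>\<in>F. omult \<gamma> * ?q \<gamma>) \<le> ?S + K"
      if F: "finite F" "F \<subseteq> zeta_ordinates" for F
    proof -
      have "(\<Sum>\<gamma>\<in>F. omult \<gamma> * ?q \<gamma>) = (\<Sum>\<gamma>\<in>F \<inter> ordinates_half t. omult \<gamma> * ?q \<gamma>) + (\<Sum>\<gamma>\<in>F - ordinates_half t. omult \<gamma> * ?q \<gamma>)"
        by (rule sum.Int_Diff[OF F(1)])
      also have "(\<Sum>\<gamma>\<in>F \<inter> ordinates_half t. omult \<gamma> * ?q \<gamma>) \<le> ?S"
        by (rule sum_mono2[OF finh]) (use q0 in auto)
      also have "(\<Sum>\<gamma>\<in>F - ordinates_half t. omult \<gamma> * ?q \<gamma>) \<le> (\<Sum>\<gamma>\<in>F - ordinates_half t. 1 / \<Lambda>\<^sup>2 * (omult \<gamma> * (1 / (\<gamma> - t)\<^sup>2)))"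
      proof (rule sum_mono)
        fix \<gamma> assume "\<gamma> \<in> F - ordinates_half t"
        then have "\<gamma> \<noteq> t" using F by (auto simp: ordinates_half_def)
        then have "?q \<gamma> \<le> 1 / (\<Lambda> * (\<gamma> - t))\<^sup>2"
          unfolding Q_kernel_def using \<Lambda> by (intro divide_left_mono) (auto intro!: mult_pos_pos add_pos_nonneg)
        also have "\<dots> = 1 / \<Lambda>\<^sup>2 * (1 / (\<gamma> - t)\<^sup>2)" by (simp add: power_mult_distrib)
        finally have "omult \<gamma> * ?q \<gamma> \<le> omult \<gamma> * (1 / \<Lambda>\<^sup>2 * (1 / (\<gamma> - t)\<^sup>2))" by (rule mult_left_mono) simp
        then show "omult \<gamma> * ?q \<gamma> \<le> 1 / \<Lambda>\<^sup>2 * (omult \<gamma> * (1 / (\<gamma> - t)\<^sup>2))" by (simp add: mult_ac)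
      qed
      also have "\<dots> = 1 / \<Lambda>\<^sup>2 * (\<Sum>\<gamma>\<in>F - ordinates_half t. omult \<gamma> * (1 / (\<gamma> - t)\<^sup>2))" by (rule sum_distrib_left[symmetric])
      also have "\<dots> \<le> 1 / \<Lambda>\<^sup>2 * (C * ell t)"
        by (intro mult_left_mono C(2)) (use F in auto)
      also have "\<dots> \<le> 1 / \<Lambda>\<^sup>2 * (C * (3 * ln T))"
        using C(1) ell_le_ln[OF T t] by (intro mult_left_mono) auto
      also have "\<dots> = (2*pi)\<^sup>2 * (3 * C) / ln T"
        using lnT by (simp add: \<Lambda>_def power_divide power_mult_distrib power2_eq_square)
      also have "\<dots> \<le> K" unfolding K_def using lnT C(1) by (intro divide_left_mono) auto
      finally show ?thesis by simp
    qed
    have "ordinate_sum ?q = (SUP F\<in>{F. finite F \<and> F \<subseteq> zeta_ordinates}. \<Sum>\<gamma>\<in>F. of_nat (ordinate_multiplicity \<gamma>) * ennreal (?q \<gamma>))"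
      unfolding ordinate_sum_def by (rule nonneg_infsum_complete) simp
    also have "\<dots> \<le> ennreal (?S + K)"
    proof (rule SUP_least)
      fix F assume F: "F \<in> {F. finite F \<and> F \<subseteq> zeta_ordinates}"
      have "(\<Sum>\<gamma>\<in>F. of_nat (ordinate_multiplicity \<gamma>) * ennreal (?q \<gamma>)) = (\<Sum>\<gamma>\<in>F. ennreal (omult \<gamma> * ?q \<gamma>))"
        using q0 by (simp add: ennreal_mult ennreal_of_nat_eq_real_of_nat)
      also have "\<dots> = ennreal (\<Sum>\<gamma>\<in>F. omult \<gamma> * ?q \<gamma>)" using q0 by (intro sum_ennreal) simp
      also have "\<dots> \<le> ennreal (?S + K)"
        using le F by (intro ennreal_leI) auto
      finally show "(\<Sum>\<gamma>\<in>F. of_nat (ordinate_multiplicity \<gamma>) * ennreal (?q \<gamma>)) \<le> ennreal (?S + K)" .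
    qed
    finally show "ordinate_sum (\<lambda>\<gamma>. Q_kernel (ln T / (2*pi) * (\<gamma> - t)))
    \<le> ennreal ((\<Sum>\<gamma>\<in>ordinates_half t. omult \<gamma> * Q_kernel (ln T / (2*pi) * (\<gamma> - t))) + K)"
      by (simp only: \<Lambda>_def)
  qed
qed

text \<open>A Poisson kernel of width 1/L is L / (1 + L^2 u^2). Since L <= l it is wider than the
  given kernel; the factor 1/L normalises its height, and (2 pi)^2 makes up for the scaling by 2
  pi.\<close>

lemma Q_kernel_le_Poisson:
  assumes L: "0 < L" "L \<le> l"
  shows "Q_kernel (l / (2*pi) * u) \<le> (2*pi)\<^sup>2 / L * Poisson (1/L) u"
proof -
  define P where "P = (2*pi)\<^sup>2"
  have P: "P \<ge> 1" unfolding P_def using pi_ge_two by (intro one_le_power) simp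
  have l2: "L\<^sup>2 * u\<^sup>2 \<le> l\<^sup>2 * u\<^sup>2" using L by (intro mult_right_mono power_mono) auto
  have "1 + L\<^sup>2 * u\<^sup>2 \<le> P * (1 + (l / (2*pi) * u)\<^sup>2)"
  proof -
    have "(l / (2*pi) * u)\<^sup>2 = l\<^sup>2 * u\<^sup>2 / P" by (simp add: P_def power_mult_distrib power_divide)
    then have "P * (1 + (l / (2*pi) * u)\<^sup>2) = P + l\<^sup>2 * u\<^sup>2" using P by (simp add: distrib_left)
    then show ?thesis using P l2 by linarith
  qed
  moreover have "1 + L\<^sup>2 * u\<^sup>2 > 0" by (simp add: add_pos_nonneg)
  moreover have "1 + (l / (2*pi) * u)\<^sup>2 > 0" by (simp add: add_pos_nonneg)
  moreover have "1 / Y \<le> P / X" if "X \<le> P * Y" "X > 0" "Y > 0" for X Y :: real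
    using that by (simp add: field_simps)
  ultimately have "Q_kernel (l / (2*pi) * u) \<le> P / (1 + L\<^sup>2 * u\<^sup>2)" unfolding Q_kernel_def by blast
  also have "\<dots> = P / L * Poisson (1/L) u"
  proof -
    have "(1/L)\<^sup>2 + u\<^sup>2 = (1 + L\<^sup>2 * u\<^sup>2) / L\<^sup>2" using L by (simp add: field_simps power2_eq_square)
    then show ?thesis using L by (simp add: power2_eq_square)
  qed
  finally show ?thesis by (simp add: P_def)
qed

text \<open>Markov's inequality for the 2k-th moment, with k left free. Both coefficient sums reduce
  to the sum of ln p / p: one factor ln p is at most L in the square sum, and p^(-1/2) is at most
  e^(L/2) / p in the absolute sum.\<close>

lemma prime_polynomial_deviation:
  fixes d :: "nat \<Rightarrow> complex"
  assumes Mertens: "(\<Sum>n | real n \<le> exp L. mangoldt n / real n) \<le> C2 * L"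
    and L: "L \<ge> 1" and C1: "C1 > 0" and T: "T \<ge> 0" and V: "V \<ge> 0" and d: "\<And>n. norm (d n) \<le> C1"
  defines "E \<equiv> {t \<in> {T..2*T}. norm (mangoldt_poly {p. real p \<le> exp L \<and> prime p} d t) \<ge> V}"
  shows "E \<in> lmeasurable"
    and "V ^ (2*k) * measure lebesgue E
      \<le> T * fact k * (C1\<^sup>2 * C2 * L\<^sup>2) ^ k + 2 * exp (2 * L * real k) * (C1 * C2 * L) ^ (2*k)"
proof -
  define P where "P = {p. real p \<le> exp L \<and> prime p}"
  have finP: "finite P" unfolding P_def by (rule finite_subset[OF _ finite_nat_le_real[of "exp L"]]) auto
  define a where "a = (\<lambda>p. of_real (ln (real p) * real p powr (- 1/2)) * d p)"
  define D where "D = (\<lambda>t. \<Sum>p\<in>P. a p * npow p (Complex 0 t))"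
  have Deq: "mangoldt_poly P d t = D t" for t
    unfolding D_def
  proof (rule sum.cong)
    fix p assume "p \<in> P"
    then have p: "prime p" "p > 0" by (auto simp: P_def prime_gt_0_nat)
    have "- Complex (1/2) t = of_real (- 1/2) + - Complex 0 t" by (simp add: complex_eq_iff)
    then have "npow p (Complex (1/2) t) = of_nat p powr of_real (- 1/2) * (npow p (Complex 0 t) :: complex)"
      by (simp only: powr_add)
    also have "(of_nat p powr of_real (- 1/2) :: complex) = of_real (real p powr (- 1/2))"
      using powr_of_real[of "real p" "- 1/2"] by simp
    finally show "mangoldt p * npow p (Complex (1/2) t) * d p = a p * npow p (Complex 0 t)"
      using p by (simp add: a_def)
  qed simp
  have pL: "0 < p" "ln (real p) \<ge> 0" "ln (real p) \<le> L" "real p \<le> exp L" if "p \<in> P" for p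
  proof -
    have p: "p > 0" "real p \<le> exp L" using that by (auto simp: P_def prime_gt_0_nat)
    then show "0 < p" "ln (real p) \<ge> 0" "real p \<le> exp L" by auto
    have "ln (real p) \<le> ln (exp L)" using p by (intro ln_mono) auto
    then show "ln (real p) \<le> L" by simp
  qed
  have na: "norm (a p) \<le> C1 * (ln (real p) * real p powr (- 1/2))" if "p \<in> P" for p
  proof -
    have "norm (a p) = ln (real p) * real p powr (- 1/2) * norm (d p)"
      using pL[OF that] unfolding a_def norm_mult norm_of_real by simp
    also have "\<dots> \<le> ln (real p) * real p powr (- 1/2) * C1" using pL[OF that] d by (intro mult_left_mono) auto
    finally show ?thesis by (simp add: mult_ac)
  qed
  have M: "(\<Sum>p\<in>P. ln (real p) / real p) \<le> C2 * L"
  proof -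
    have "(\<Sum>p\<in>P. ln (real p) / real p) = (\<Sum>p\<in>P. mangoldt p / real p)" by (rule sum.cong) (auto simp: P_def)
    also have "\<dots> \<le> (\<Sum>n | real n \<le> exp L. mangoldt n / real n)"
      by (rule sum_mono2[OF finite_nat_le_real]) (auto simp: P_def mangoldt_nonneg)
    finally show ?thesis using Mertens by linarith
  qed
  have s2: "(\<Sum>p\<in>P. (norm (a p))\<^sup>2) \<le> C1\<^sup>2 * C2 * L\<^sup>2"
  proof -
    have "(\<Sum>p\<in>P. (norm (a p))\<^sup>2) \<le> (\<Sum>p\<in>P. C1\<^sup>2 * L * (ln (real p) / real p))"
    proof (rule sum_mono)
      fix p assume p: "p \<in> P"
      have "(norm (a p))\<^sup>2 \<le> (C1 * (ln (real p) * real p powr (- 1/2)))\<^sup>2" by (intro power_mono na p) simp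
      also have "\<dots> = C1\<^sup>2 * (ln (real p) * (ln (real p) / real p))"
      proof -
        have h: "(real p powr (- 1/2))\<^sup>2 = 1 / real p"
          using pL[OF p] by (simp add: power2_eq_square powr_add[symmetric] powr_minus_divide)
        show ?thesis unfolding power_mult_distrib h by (simp add: power2_eq_square)
      qed
      also have "\<dots> \<le> C1\<^sup>2 * (L * (ln (real p) / real p))"
        using pL[OF p] by (intro mult_left_mono mult_right_mono) auto
      finally show "(norm (a p))\<^sup>2 \<le> C1\<^sup>2 * L * (ln (real p) / real p)" by (simp add: mult.assoc)
    qed
    also have "\<dots> = C1\<^sup>2 * L * (\<Sum>p\<in>P. ln (real p) / real p)" by (rule sum_distrib_left[symmetric])
    also have "\<dots> \<le> C1\<^sup>2 * L * (C2 * L)" using M L by (intro mult_left_mono) auto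
    finally show ?thesis by (simp add: power2_eq_square mult_ac)
  qed
  have s1: "(\<Sum>p\<in>P. norm (a p)) \<le> C1 * C2 * L * exp (L/2)"
  proof -
    have "(\<Sum>p\<in>P. norm (a p)) \<le> (\<Sum>p\<in>P. C1 * exp (L/2) * (ln (real p) / real p))"
    proof (rule sum_mono)
      fix p assume p: "p \<in> P"
      have "real p powr (- 1/2) = real p powr (1/2) / real p"
        using powr_diff[of "real p" "1/2" 1] pL[OF p] by simp
      also have "\<dots> \<le> exp (L/2) / real p"
      proof (intro divide_right_mono)
        have "real p powr (1/2) \<le> exp L powr (1/2)" using pL[OF p] by (intro powr_mono2) auto
        then show "real p powr (1/2) \<le> exp (L/2)" by (simp add: exp_powr_real)
      qed simp
      finally have "C1 * (ln (real p) * real p powr (- 1/2)) \<le> C1 * (ln (real p) * (exp (L/2) / real p))"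
        using C1 pL[OF p] by (intro mult_left_mono) auto
      then show "norm (a p) \<le> C1 * exp (L/2) * (ln (real p) / real p)" using na[OF p] by (simp add: mult_ac)
    qed
    also have "\<dots> = C1 * exp (L/2) * (\<Sum>p\<in>P. ln (real p) / real p)" by (rule sum_distrib_left[symmetric])
    also have "\<dots> \<le> C1 * exp (L/2) * (C2 * L)" using M C1 by (intro mult_left_mono) auto
    finally show ?thesis by (simp add: mult_ac)
  qed
  have "integral {T..2*T} (\<lambda>t. norm (D t) ^ (2*k)) \<le> T * fact k * (\<Sum>p\<in>P. (norm (a p))\<^sup>2) ^ k + 2 * exp L ^ k * (\<Sum>p\<in>P. norm (a p)) ^ (2*k)"
    unfolding D_def by (rule moment_prime_polynomial[OF finP _ _ T]) (auto simp: P_def)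
  also have "\<dots> \<le> T * fact k * (C1\<^sup>2 * C2 * L\<^sup>2) ^ k + 2 * exp L ^ k * (C1 * C2 * L * exp (L/2)) ^ (2*k)"
    by (intro add_mono mult_left_mono power_mono s1 s2 sum_nonneg) (use T in auto)
  \<comment> \<open>One half of the exponent 2 L k comes from the spacing of the frequencies, the
    other half from the size of the coefficients.\<close>
  also have "exp L ^ k * (C1 * C2 * L * exp (L/2)) ^ (2*k) = exp (2 * L * real k) * (C1 * C2 * L) ^ (2*k)"
    by (simp add: power_mult_distrib exp_of_nat_mult[symmetric] exp_add[symmetric] algebra_simps)
  then have "2 * exp L ^ k * (C1 * C2 * L * exp (L/2)) ^ (2*k) = 2 * exp (2 * L * real k) * (C1 * C2 * L) ^ (2*k)"
    by simp
  finally have I: "integral {T..2*T} (\<lambda>t. norm (D t) ^ (2*k)) \<le> T * fact k * (C1\<^sup>2 * C2 * L\<^sup>2) ^ k + 2 * exp (2 * L * real k) * (C1 * C2 * L) ^ (2*k)" .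
  have cD: "continuous_on A D" for A
  proof -
    have Cx: "Complex 0 t = \<i> * of_real t" for t by (simp add: complex_eq_iff)
    have "continuous_on A (\<lambda>t. npow p (Complex 0 t) :: complex)" if "p \<in> P" for p
      unfolding Cx powr_def using pL(1)[OF that] by (auto intro!: continuous_intros)
    then show ?thesis unfolding D_def by (intro continuous_on_sum continuous_on_mult continuous_on_const) auto
  qed
  have E: "E = {t \<in> {T..2*T}. norm (D t) \<ge> V}" unfolding E_def P_def[symmetric] Deq ..
  show E1: "E \<in> lmeasurable" unfolding E
    by (rule Markov_interval(1)) (use V in \<open>auto intro!: continuous_intros cD\<close>)
  have M2: "{t \<in> {T..2*T}. norm (D t) ^ (2*k) \<ge> V ^ (2*k)} \<in> lmeasurable"
      "V ^ (2*k) * measure lebesgue {t \<in> {T..2*T}. norm (D t) ^ (2*k) \<ge> V ^ (2*k)} \<le> integral {T..2*T} (\<lambda>t. norm (D t) ^ (2*k))"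
    by (rule Markov_interval; use V in \<open>auto intro!: continuous_intros cD\<close>)+
  have "measure lebesgue E \<le> measure lebesgue {t \<in> {T..2*T}. norm (D t) ^ (2*k) \<ge> V ^ (2*k)}"
    by (rule measure_mono_fmeasurable) (use E1 M2(1) V in \<open>auto simp: E intro: power_mono fmeasurableD\<close>)
  then have "V ^ (2*k) * measure lebesgue E \<le> V ^ (2*k) * measure lebesgue {t \<in> {T..2*T}. norm (D t) ^ (2*k) \<ge> V ^ (2*k)}"
    using V by (intro mult_left_mono) auto
  then show "V ^ (2*k) * measure lebesgue E
      \<le> T * fact k * (C1\<^sup>2 * C2 * L\<^sup>2) ^ k + 2 * exp (2 * L * real k) * (C1 * C2 * L) ^ (2*k)"
    using M2(2) I by linarith
qed

lemma fact_le_power_real: "real k \<le> x \<Longrightarrow> fact k \<le> x ^ k"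
proof -
  assume "real k \<le> x"
  have "(fact k :: real) \<le> real (k ^ k)" by (rule fact_le_power)
  also have "\<dots> \<le> x ^ k" using \<open>real k \<le> x\<close> by (simp add: power_mono)
  finally show ?thesis .
qed

theorem theorem1p1:
  assumes riemann_hypothesis
  shows "\<exists>C::real. \<exists>K::real. C > 0 \<and> K > 0 \<and>
    (\<forall>x::real. \<forall>T::real. x \<ge> 2 \<longrightarrow> T \<ge> 2 \<longrightarrow>
      1 / T * measure lebesgue
        {t \<in> {T..2 * T}.
           ordinate_sum (\<lambda>\<gamma>. Q_kernel (ln T / (2 * pi) * (\<gamma> - t))) \<ge> ennreal x}
      \<le> K * exp (- C * x * ln x))"
proof -
  let ?X = "\<lambda>T t. ordinate_sum (\<lambda>\<gamma>. Q_kernel (ln T / (2 * pi) * (\<gamma> - t)))"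
  define near where "near = (\<lambda>T t. \<Sum>\<gamma>\<in>ordinates_half t. omult \<gamma> * Q_kernel (ln T / (2 * pi) * (\<gamma> - t)))"
  obtain C4 where C4: "C4 > 0" "\<And>T t. T \<ge> 2 \<Longrightarrow> t \<in> {T..2*T} \<Longrightarrow> ?X T t \<le> ennreal (near T t + C4)"
    using ordinate_sum_le_near[OF assms] unfolding near_def by blast
  obtain C0 where C0: "C0 > 0" "\<And>t. finite (ordinates_near t)" "\<And>t. (\<Sum>\<gamma>\<in>ordinates_near t. omult \<gamma>) \<le> C0 * ell t"
    using RH_log_deriv_bounds[OF assms] by blast
  obtain C1 where C1: "C1 > 0" "\<And>L. L \<ge> 4 \<Longrightarrow> \<exists>d :: nat \<Rightarrow> complex. (\<forall>n. norm (d n) \<le> C1) \<and>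
    (\<forall>t. zero_sum (1/L) t
      \<le> C1 * (ell t + exp (3/2 * L) / (1 + \<bar>t\<bar>))
        + norm (mangoldt_poly {n. real n \<le> exp L} d t))"
    using zero_sum_le_Dirichlet_polynomial[OF assms] by blast
  obtain C2 where C2: "C2 > 0" "\<And>L. L \<ge> 1 \<Longrightarrow> (\<Sum>n | real n \<le> exp L. mangoldt n / real n) \<le> C2 * L"
    using Mertens_upper by blast
  obtain C8 where C8: "C8 > 0" "\<And>L. L \<ge> 1 \<Longrightarrow> (\<Sum>n | real n \<le> exp L \<and> \<not> prime n. mangoldt n * real n powr (- 1/2)) \<le> C8 * L"
    using sum_nonprime_mangoldt_le by blast
  define P where "P = (2*pi)\<^sup>2"
  have P: "P > 0" by (simp add: P_def)
  \<comment> \<open>The first summand keeps the error 5 C1 ln T below half of the lower bound x L /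
    (2 P) for the Poisson sum. The second settles the case L < 4: there 24 C0 ln T < 4 x, so the
    near zeros contribute less than x/2.\<close>
  define K0 where "K0 = 20 * C1 * P + 24 * C0 + 1"
  have K0: "K0 \<ge> 1" "20 * C1 * P \<le> K0" "24 * C0 \<le> K0" using C1 C0 P by (auto simp: K0_def)
  \<comment> \<open>One constant for both terms of the moment bound: C1^2 C2 from the diagonal, (C1
    C2)^2 from the remaining pairs.\<close>
  define B where "B = C1\<^sup>2 * C2 + (C1 * C2)\<^sup>2 + 1"
  have B: "B \<ge> 1" "C1\<^sup>2 * C2 \<le> B" "(C1 * C2)\<^sup>2 \<le> B" using C1 C2(1) by (auto simp: B_def)
  \<comment> \<open>Chosen to give x B L^2 = V^2 (M / x) for the threshold V below.\<close>
  define M where "M = (8 * P)\<^sup>2 * B"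
  have M: "M > 0" using P B by (simp add: M_def)
  \<comment> \<open>In turn: distant zeros take at most half of x; the moment order k is at least x
    / (4 K0), and 3/2 L <= ln T; the prime powers stay within their share of the budget; and M / x
    <= x^(-1/2).\<close>
  define x0 where "x0 = 2 + 2 * C4 + 4 * K0 + 8 * P * C1 * C8 + M\<^sup>2"
  have x0: "x0 \<ge> 2" "2 * C4 \<le> x0" "4 * K0 \<le> x0" "8 * P * C1 * C8 \<le> x0" "M\<^sup>2 \<le> x0"
    using C4 K0 P C1 C8 by (auto simp: x0_def)
  \<comment> \<open>The final bound is x^(-k/2) with k >= x / (4 K0).\<close>
  define c where "c = 1 / (8 * K0)"
  have c: "c > 0" using K0 by (simp add: c_def)
  have nearle: "near T t \<le> 3 * C0 * ln T" if T: "T \<ge> 2" "t \<in> {T..2*T}" for T t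
  proof -
    have "near T t \<le> (\<Sum>\<gamma>\<in>ordinates_half t. omult \<gamma>)" unfolding near_def
    proof (rule sum_mono)
      fix \<gamma>
      have "Q_kernel (ln T / (2 * pi) * (\<gamma> - t)) \<le> 1" by (simp add: Q_kernel_def add_pos_nonneg)
      then show "omult \<gamma> * Q_kernel (ln T / (2 * pi) * (\<gamma> - t)) \<le> omult \<gamma>" using mult_left_mono[of _ 1 "omult \<gamma>"] by simp
    qed
    also have "\<dots> \<le> (\<Sum>\<gamma>\<in>ordinates_near t. omult \<gamma>)"
      by (rule sum_mono2[OF C0(2)]) (use ordinates_half_near[of 0 t] in auto)
    also have "\<dots> \<le> C0 * ell t" by (rule C0(3))
    also have "\<dots> \<le> C0 * (3 * ln T)" using C0(1) ell_le_ln[OF T] by (intro mult_left_mono) auto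
    finally show ?thesis by simp
  qed
  have level: "x \<le> near T t + C4" if "T \<ge> 2" "t \<in> {T..2*T}" "?X T t \<ge> ennreal x" for T t x
  proof -
    have "ennreal x \<le> ennreal (near T t + C4)" using that C4(2) order_trans by blast
    moreover have "near T t + C4 \<ge> 0" using C4(1) unfolding near_def
      by (intro add_nonneg_nonneg sum_nonneg) (auto simp: Q_kernel_def)
    ultimately show ?thesis by (simp add: ennreal_le_iff)
  qed
  have big: "measure lebesgue {t \<in> {T..2*T}. ?X T t \<ge> ennreal x} \<le> 3 * T * exp (- c * x * ln x)"
    if x: "x \<ge> x0" and T: "T \<ge> 2" for x T
  proof -
    define L where "L = K0 * ln T / x"
    have xp: "x > 0" "x \<ge> 2" using x x0 by auto
    \<comment> \<open>The bound 1/2 lets an additive 1 be absorbed: 3 ln T + 1 <= 5 ln T.\<close>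
    have lnT: "ln T > 0" "ln T \<ge> 1/2"
    proof -
      have "ln (1/2 :: real) \<le> 1/2 - 1" by (rule ln_le_minus_one) simp
      then have "ln (2::real) \<ge> 1/2" by (simp add: ln_div)
      moreover have "ln 2 \<le> ln T" using T by (intro ln_mono) auto
      ultimately show "ln T \<ge> 1/2" by linarith
    qed (use T in simp)
    have xL: "x * L = K0 * ln T" using xp by (simp add: L_def)
    have lnTeq: "ln T = x * L / K0" using xL K0 by simp
    show ?thesis
    proof (cases "L \<ge> 4")
      case False
      have "K0 * ln T < 4 * x" using False xp unfolding xL[symmetric] by simp
      moreover have "24 * C0 * ln T \<le> K0 * ln T" using K0 lnT by (intro mult_right_mono) auto
      ultimately have small: "24 * C0 * ln T < 4 * x" by linarith
      have "{t \<in> {T..2*T}. ?X T t \<ge> ennreal x} = {}"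
      proof (rule ccontr)
        assume "{t \<in> {T..2*T}. ?X T t \<ge> ennreal x} \<noteq> {}"
        then obtain t where t: "t \<in> {T..2*T}" "?X T t \<ge> ennreal x" by blast
        show False using level[OF T t] nearle[OF T t(1)] small x x0(2) xp(1) by linarith
      qed
      then have "measure lebesgue {t \<in> {T..2*T}. ?X T t \<ge> ennreal x} = 0" by (simp only: measure_empty)
      also have "0 \<le> 3 * T * exp (- c * x * ln x)" using T by simp
      finally show ?thesis .
    next
      case True
      have L: "L > 0" "L \<ge> 1" using True by auto
      \<comment> \<open>The first bound makes the Poisson kernel wide enough to dominate the given
        one; the second reduces the pole error e^(3L/2) / (1 + |t|) to at most 1.\<close>
      have LlnT: "L \<le> ln T" "3/2 * L \<le> ln T"
      proof -
        have "3/2 * (K0 * ln T) \<le> x * ln T"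
        proof -
          have "3/2 * K0 \<le> x" using x x0(3) K0(1) by linarith
          then have "3/2 * K0 * ln T \<le> x * ln T" using lnT by (intro mult_right_mono) auto
          then show ?thesis by simp
        qed
        then have "3/2 * (x * L) \<le> x * ln T" by (simp only: xL)
        then have "x * (3/2 * L) \<le> x * ln T" by (simp add: mult_ac)
        then show "3/2 * L \<le> ln T" using xp(1) by (simp only: mult_le_cancel_left_pos)
        then show "L \<le> ln T" using L by linarith
      qed
      obtain d :: "nat \<Rightarrow> complex" where d: "\<forall>n. norm (d n) \<le> C1"
        and S: "\<And>t. zero_sum (1/L) t
          \<le> C1 * (ell t + exp (3/2 * L) / (1 + \<bar>t\<bar>))
        + norm (mangoldt_poly {n. real n \<le> exp L} d t)"
        using C1(2)[OF True] by blast
      \<comment> \<open>The budget in units of x L / P: the Poisson sum is at least 1/2, the terms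
        of size ln T take at most 1/4 and the prime powers at most 1/8, which leaves 1/8 for the
        primes.\<close>
      define V where "V = x * L / (8 * P)"
      have V: "V > 0" using xp L P by (simp add: V_def)
      let ?D1 = "\<lambda>t. mangoldt_poly {p. real p \<le> exp L \<and> prime p} d t"
      let ?D2 = "\<lambda>t. mangoldt_poly {n. real n \<le> exp L \<and> \<not> prime n} d t"
      define E where "E = {t \<in> {T..2*T}. norm (?D1 t) \<ge> V}"
      define k where "k = nat \<lfloor>x / (2 * K0)\<rfloor>"
      have sub: "{t \<in> {T..2*T}. ?X T t \<ge> ennreal x} \<subseteq> E"
      proof
        fix t assume "t \<in> {t \<in> {T..2*T}. ?X T t \<ge> ennreal x}"
        then have t: "t \<in> {T..2*T}" "?X T t \<ge> ennreal x" by auto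
        have half: "x/2 \<le> near T t" using level[OF T t] x x0(2) by linarith
        define S0 where "S0 = zero_sum (1/L) t"
        have "near T t \<le> (\<Sum>\<gamma>\<in>ordinates_half t. P / L * (omult \<gamma> * Poisson (1/L) (t - \<gamma>)))"
          unfolding near_def
        proof (rule sum_mono)
          fix \<gamma>
          have "Q_kernel (ln T / (2 * pi) * (\<gamma> - t)) \<le> P / L * Poisson (1/L) (t - \<gamma>)"
            using Q_kernel_le_Poisson[OF L(1) LlnT(1), of "\<gamma> - t"] by (simp only: P_def power2_commute[of \<gamma> t])
          then have "omult \<gamma> * Q_kernel (ln T / (2 * pi) * (\<gamma> - t)) \<le> omult \<gamma> * (P / L * Poisson (1/L) (t - \<gamma>))"
            by (rule mult_left_mono) simp
          then show "omult \<gamma> * Q_kernel (ln T / (2 * pi) * (\<gamma> - t)) \<le> P / L * (omult \<gamma> * Poisson (1/L) (t - \<gamma>))"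
            by (simp only: mult.left_commute)
        qed
        also have "\<dots> = P / L * S0" unfolding S0_def by (rule sum_distrib_left[symmetric])
        finally have "x/2 \<le> P / L * S0" using half by linarith
        then have S0ge: "x * L / (2 * P) \<le> S0" using L P by (simp add: field_simps)
        have "exp (3/2 * L) \<le> exp (ln T)" using LlnT by simp
        also have "\<dots> \<le> 1 + \<bar>t\<bar>" using T t(1) by simp
        finally have "exp (3/2 * L) / (1 + \<bar>t\<bar>) \<le> 1" by (simp add: divide_le_eq add_pos_nonneg)
        then have "ell t + exp (3/2 * L) / (1 + \<bar>t\<bar>) \<le> 5 * ln T"
          using ell_le_ln[OF T t(1)] lnT by linarith
        then have "C1 * (ell t + exp (3/2 * L) / (1 + \<bar>t\<bar>)) \<le> C1 * (5 * ln T)"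
          using C1(1) by (intro mult_left_mono) auto
        also have "\<dots> \<le> x * L / (4 * P)"
        proof -
          have "20 * C1 * P * ln T \<le> K0 * ln T" using K0 lnT by (intro mult_right_mono) auto
          then have "20 * C1 * P * ln T \<le> x * L" by (simp only: xL)
          then show ?thesis using P by (simp add: field_simps)
        qed
        finally have e1: "C1 * (ell t + exp (3/2 * L) / (1 + \<bar>t\<bar>)) \<le> x * L / (4 * P)" .
        have Dsplit: "(mangoldt_poly {n. real n \<le> exp L} d t) = ?D1 t + ?D2 t"
        proof -
          have eq: "{n. real n \<le> exp L} = {n. real n \<le> exp L \<and> prime n} \<union> {n. real n \<le> exp L \<and> \<not> prime n}" by auto
          have fin: "finite {n. real n \<le> exp L \<and> Q n}" for Q
            by (rule finite_subset[OF _ finite_nat_le_real[of "exp L"]]) auto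
          show ?thesis by (subst eq, rule sum.union_disjoint[OF fin fin]) auto
        qed
        have "norm (?D2 t) \<le> (\<Sum>n | real n \<le> exp L \<and> \<not> prime n. C1 * (mangoldt n * real n powr (- 1/2)))"
        proof (rule sum_norm_le)
          fix n :: nat
          have "norm (mangoldt n * npow n (Complex (1/2) t) * d n) = mangoldt n * real n powr (- 1/2) * norm (d n)"
            by (simp add: norm_mult norm_nat_powr)
          also have "\<dots> \<le> mangoldt n * real n powr (- 1/2) * C1"
            using d by (intro mult_left_mono mult_nonneg_nonneg mangoldt_nonneg) auto
          finally show "norm (mangoldt n * npow n (Complex (1/2) t) * d n) \<le> C1 * (mangoldt n * real n powr (- 1/2))"
            by (simp add: mult_ac)
        qed
        also have "\<dots> = C1 * (\<Sum>n | real n \<le> exp L \<and> \<not> prime n. mangoldt n * real n powr (- 1/2))" by (rule sum_distrib_left[symmetric])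
        also have "\<dots> \<le> C1 * (C8 * L)" using C8(2)[OF L(2)] C1(1) by (intro mult_left_mono) auto
        also have "\<dots> \<le> x * L / (8 * P)"
        proof -
          have "8 * P * C1 * C8 * L \<le> x * L" using x x0(4) L by (intro mult_right_mono) auto
          then show ?thesis using P by (simp add: field_simps)
        qed
        finally have e2: "norm (?D2 t) \<le> x * L / (8 * P)" .
        have "x * L / (2 * P) \<le> x * L / (4 * P) + norm (?D1 t + ?D2 t)"
          using S[of t] S0ge e1 unfolding Dsplit S0_def by linarith
        also have "norm (?D1 t + ?D2 t) \<le> norm (?D1 t) + x * L / (8 * P)"
          using norm_triangle_ineq[of "?D1 t" "?D2 t"] e2 by linarith
        finally have "x * L / (2 * P) - x * L / (4 * P) - x * L / (8 * P) \<le> norm (?D1 t)" by linarith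
        moreover have "x * L / (2 * P) - x * L / (4 * P) - x * L / (8 * P) = V" using P by (simp add: V_def field_simps)
        ultimately show "t \<in> E" using t by (simp add: E_def)
      qed
      have E: "E \<in> lmeasurable" and Em: "V ^ (2*k) * measure lebesgue E
          \<le> T * fact k * (C1\<^sup>2 * C2 * L\<^sup>2) ^ k + 2 * exp (2 * L * real k) * (C1 * C2 * L) ^ (2*k)"
      proof -
        have T0: "T \<ge> 0" "V \<ge> 0" using T V by auto
        note dv = prime_polynomial_deviation[OF C2(2)[OF L(2)] L(2) C1(1) T0 d[rule_format]]
        show "E \<in> lmeasurable" unfolding E_def by (rule dv(1))
        show "V ^ (2*k) * measure lebesgue E
          \<le> T * fact k * (C1\<^sup>2 * C2 * L\<^sup>2) ^ k + 2 * exp (2 * L * real k) * (C1 * C2 * L) ^ (2*k)"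
          unfolding E_def by (rule dv(2))
      qed
      \<comment> \<open>Rounding down loses at most 1, which is at most half of x / (2 K0) because x
        >= 4 K0.\<close>
      have kx: "real k \<le> x / (2 * K0)" "real k \<ge> x / (4 * K0)"
      proof -
        have "x / (2 * K0) \<ge> 0" using xp K0 by simp
        then show "real k \<le> x / (2 * K0)" unfolding k_def by linarith
        have "x / (2 * K0) - x / (4 * K0) \<ge> 1"
          using x x0(3) K0(1) by (simp add: field_simps)
        then show "real k \<ge> x / (4 * K0)" unfolding k_def using \<open>x / (2 * K0) \<ge> 0\<close> by linarith
      qed
      have kx': "real k \<le> x"
      proof -
        have "x / (2 * K0) \<le> x / 1" using xp K0 by (intro divide_left_mono) auto
        then show ?thesis using kx by linarith
      qed
      have "2 * L * real k \<le> 2 * L * (x / (2 * K0))" using L kx by (intro mult_left_mono) auto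
      also have "\<dots> = ln T" using K0 lnTeq by (simp add: field_simps)
      finally have eT: "exp (2 * L * real k) \<le> T" using T by (metis exp_le_cancel_iff exp_ln less_le_trans zero_less_numeral)
      have xB: "1 \<le> x ^ k" "0 \<le> B ^ k" using xp B by (auto intro: one_le_power)
      have "V ^ (2*k) * measure lebesgue E \<le> T * x ^ k * (B * L\<^sup>2) ^ k + 2 * T * (B * L\<^sup>2) ^ k"
      proof -
        have "T * fact k * (C1\<^sup>2 * C2 * L\<^sup>2) ^ k \<le> T * x ^ k * (B * L\<^sup>2) ^ k"
          using T B C1(1) C2(1) L fact_le_power_real[OF kx'] xp by (intro mult_mono power_mono) auto
        moreover have "(C1 * C2 * L) ^ (2*k) \<le> (B * L\<^sup>2) ^ k"
        proof -
          have "(C1 * C2 * L) ^ (2*k) = ((C1 * C2)\<^sup>2 * L\<^sup>2) ^ k" by (simp add: power_mult power_mult_distrib)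
          also have "\<dots> \<le> (B * L\<^sup>2) ^ k" using B by (intro power_mono mult_right_mono) auto
          finally show ?thesis .
        qed
        then have "2 * exp (2 * L * real k) * (C1 * C2 * L) ^ (2*k) \<le> 2 * T * (B * L\<^sup>2) ^ k"
          using eT T by (intro mult_mono) auto
        ultimately show ?thesis using Em by linarith
      qed
      also have "\<dots> \<le> 3 * T * (x ^ k * (B * L\<^sup>2) ^ k)"
      proof -
        have "1 * (B * L\<^sup>2) ^ k \<le> x ^ k * (B * L\<^sup>2) ^ k" using xB B by (intro mult_right_mono) auto
        then have "2 * T * (B * L\<^sup>2) ^ k \<le> 2 * T * (x ^ k * (B * L\<^sup>2) ^ k)" using T by (intro mult_left_mono) auto
        then show ?thesis by (simp add: algebra_simps)
      qed
      also have "\<dots> = V ^ (2*k) * (3 * T * (M / x) ^ k)"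
      proof -
        have "x * (B * L\<^sup>2) = V\<^sup>2 * (M / x)"
          using xp P by (simp add: V_def M_def power2_eq_square field_simps)
        then have "x ^ k * (B * L\<^sup>2) ^ k = V ^ (2*k) * (M / x) ^ k"
          by (metis power_mult power_mult_distrib)
        then show ?thesis by simp
      qed
      finally have "measure lebesgue E \<le> 3 * T * (M / x) ^ k" using V by simp
      also have "\<dots> \<le> 3 * T * exp (- c * x * ln x)"
      proof (intro mult_left_mono)
        \<comment> \<open>Half of the saving 1/x per moment is given up to swallow the constant
          M.\<close>
        have "M \<le> sqrt x" using x x0(5) M by (intro real_le_rsqrt) auto
        then have "M / x \<le> sqrt x / x" using xp by (intro divide_right_mono) auto
        also have "\<dots> = x powr (- 1/2)" using xp powr_diff[of x "1/2" 1] by (simp add: powr_half_sqrt)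
        also have "\<dots> = exp (- (1/2) * ln x)" using xp by (simp add: powr_def)
        finally have "(M / x) ^ k \<le> exp (- (1/2) * ln x) ^ k" using M xp by (intro power_mono) auto
        also have "\<dots> = exp (- (1/2) * ln x * real k)" by (simp add: exp_of_nat_mult[symmetric] mult_ac)
        also have "\<dots> \<le> exp (- c * x * ln x)"
        proof -
          have "ln x \<ge> 0" using xp by simp
          then have "x / (4 * K0) * ln x \<le> real k * ln x" using kx(2) by (rule mult_right_mono[rotated])
          then show ?thesis unfolding c_def using K0 by (simp add: field_simps)
        qed
        finally show "(M / x) ^ k \<le> exp (- c * x * ln x)" .
      qed (use T in auto)
      finally have "measure lebesgue E \<le> 3 * T * exp (- c * x * ln x)" .
      moreover have "measure lebesgue {t \<in> {T..2*T}. ?X T t \<ge> ennreal x} \<le> measure lebesgue E"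
        by (rule measure_mono_fmeasurable[OF sub level_set_measurable E])
      ultimately show ?thesis by linarith
    qed
  qed
  show ?thesis
  \<comment> \<open>For x < x0 the left side is at most 1 and monotonicity of x ln x makes the
    factor exp (c x0 ln x0) sufficient; the 3 comes from the case x >= x0.\<close>
  proof (rule exI[of _ c], rule exI[of _ "3 * exp (c * x0 * ln x0)"], intro conjI allI impI)
    show "c > 0" by (rule c)
    show "3 * exp (c * x0 * ln x0) > 0" by simp
    fix x T :: real assume x: "x \<ge> 2" and T: "T \<ge> 2"
    have lx0: "ln x0 \<ge> 0" using x0 by simp
    show "1 / T * measure lebesgue {t \<in> {T..2 * T}. ?X T t \<ge> ennreal x} \<le> 3 * exp (c * x0 * ln x0) * exp (- c * x * ln x)"
    proof (cases "x \<ge> x0")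
      case True
      have "1 / T * measure lebesgue {t \<in> {T..2 * T}. ?X T t \<ge> ennreal x} \<le> 1 / T * (3 * T * exp (- c * x * ln x))"
        using big[OF True T] T by (intro mult_left_mono) auto
      also have "\<dots> = 3 * exp (- c * x * ln x)" using T by simp
      also have "\<dots> \<le> 3 * exp (c * x0 * ln x0) * exp (- c * x * ln x)"
        using c x0 lx0 by (intro mult_right_mono) auto
      finally show ?thesis .
    next
      case False
      have "measure lebesgue {t \<in> {T..2 * T}. ?X T t \<ge> ennreal x} \<le> measure lebesgue {T..2*T}"
        by (rule measure_mono_fmeasurable[OF _ level_set_measurable]) auto
      also have "\<dots> = T" using T by simp
      finally have "1 / T * measure lebesgue {t \<in> {T..2 * T}. ?X T t \<ge> ennreal x} \<le> 1"
        using T by (simp add: field_simps)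
      also have "1 \<le> exp (c * x0 * ln x0 + (- c * x * ln x))"
      proof -
        have "x * ln x \<le> x0 * ln x0" using False x by (intro mult_mono ln_mono) auto
        then have "c * (x * ln x) \<le> c * (x0 * ln x0)" using c by (intro mult_left_mono) auto
        then show ?thesis by (simp add: mult_ac)
      qed
      also have "\<dots> \<le> 3 * exp (c * x0 * ln x0 + (- c * x * ln x))" by simp
      finally show ?thesis by (simp only: exp_add mult.assoc)
    qed
  qed
qed

end
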